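(* Let $p_0\ge1$ and suppose $\psi(x)=O(\|x\|^{p_0})$ as $\|x\|\to\infty$. Suppose a solution of $\min_{q_e\in\mathcal Q}\frac1{\tau_e}\int_0^{\tau_e}\psi(q_e(u))\,du$ exists, with corresponding optimal parameters $(L_*,\mathbf r_* )$, and for each $n\ge1$ let $\pi_*^n$ be the binomial-exhaustive policy with parameters $(L_*,\mathbf r_* )$ in the $n$th system. Assume that for all $i\in\mathcal I$: (a) $\mathbb E[e^{tV_i^n}]<\infty$ for all $t\ge0$ and $n\ge1$; (b) $\mathbb E[(V_i^n/n)^\ell]\to s_i^\ell$ as $n\to\infty$ for all $\ell\ge2$. Then $\{\bar\Psi^n_{\pi_*^n}:n\ge1\}$ is uniformly integrable if either of the following two conditions holds for all $k\in\mathcal K$: (i) $p_0>1$, and for some $\epsilon>0$, $\mathbb E[e^{tS_k}]<\infty$ for all $t\in(-\epsilon,\epsilon)$; (ii) $p_0=1$, and $\mathbb E[S_k^2]<\infty$.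
   Context: **Data.** $K\ge1$ queues $\mathcal K=\{1,\dots,K\}$; stages $\mathcal I=\{1,\dots,I\}$, $I\ge K$; a polling function (basic table) $p:\mathcal I\to\mathcal K$ in which every queue appears (repeated visits to a queue are at nonconsecutive stages). Rates $\lambda_k,\mu_k\in(0,\infty)$, $\rho=\sum_k\lambda_k/\mu_k<1$. Numbers $s_i\ge0$ ($i\in\mathcal I$), $s=\sum_i s_i>0$. For $L\in\mathbb N$, $\mathcal I^L=\{1,\dots,IL\}$ is the stage set of the augmented table ($L$ repetitions of the basic table), with $p$ and $s_i$ extended $I$-periodically. The cost $\psi:\mathbb R_+^K\to\mathbb R_+$ is nondecreasing and continuous. **Stochastic systems.** In system $n\ge1$ class-$k$ customers arrive to queue $k$ (infinite buffer) according to independent Poisson processes of rate $\lambda_k$ and have i.i.d. service times, distributed as $S_k$, with mean $1/\mu_k$. A single server visits the queues $p(1),p(2),\dots$ in the periodic order of the table. The switchover time from stage $i$ to the next is distributed as $V_i^n$, independent of everything else, with $V_i^n/n\Rightarrow s_i$ and $\mathbb E[V_i^n]=ns_i$. The arrival rates and service distributions do not depend on $n$. The polling (departure) epoch of a stage is the time the server's visit starts (ends). A server cycle, under a control whose rules repeat after $IL$ stages, is the time between consecutive polling epochs of stage 1 of $\mathcal I^L$. **Binomial-exhaustive policy** with parameters $(L,\mathbf r)$, $L\in\mathbb N$, $\mathbf r\in\mathcal R:=\{\mathbf r\in[0,1]^{IL}:\sum_{i\in\mathcal I^L:p(i)=k}r_i>0\ \forall k\in\mathcal K\}$: if the server finds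 $N$ customers at the polled queue $p(i)$ at a polling epoch of stage $i\in\mathcal I^L$, then it leaves behind $N-Y$ customers at the departure epoch, where $Y$ is binomial with parameters $N$ and $r_i$, independent of everything else. Equivalently, each customer present at the polling epoch is independently selected with probability $r_i$; the server serves each selected customer and all new arrivals during the service of that customer, so that it attends for $Y$ busy periods of an $M/G/1$ queue with arrival rate $\lambda_{p(i)}$ and service distribution of $S_{p(i)}$. The embedded discrete-time Markov chain (queue vector at the beginnings of server cycles) is ergodic under this policy. $Q^n_\pi(t)\in\mathbb Z_+^K$ is the queue vector of system $n$ under $\pi$ and $\bar Q^n_\pi(t)=Q^n_\pi(nt)/n$. With $T^n$ the length of a stationary server cycle (the queue at the start of the cycle having the stationary distribution of the embedded chain) and $\bar T^n=T^n/n$, $\bar\Psi^n_{\pi}=\int_0^{\bar T^n}\psi(\bar Q^n_\pi(u))\,du$, where $\bar Q^n_\pi(0)$ has the (fluid-scaled) stationary distribution of the embedded chain. **PE-candidates and optimal parameters.** Let $\tau_L=sL/(1-\rho)$. An $L$-cycle PE-candidate is a closed curve $q_e:[0,\tau_L]\to\mathbb R_+^K$, $q_e(0)=q_e(\tau_L)$, for which there are busy times $b_i\ge0$, $i\in\mathcal I^L$, such that, with stage 1 polled at time $0$: when stage $i$ is polled, queue $p(i)$ is served for time $b_i$, during which $\dot q_{e,p(i)}=\lambda_{p(i)}-\mu_{p(i)}$ and $\dot q_{e,k}=\lambda_k$ for $k\ne p(i)$; then the server switches for time $s_i$, during which $\dot q_{e,k}=\lambda_k$ for all $k$; then stage $i+1$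 is polled, the cycle ending at time $\tau_L$ after stage $IL$ and its switchover. $\mathcal Q$ is the set of PE-candidates over all $L\in\mathbb N$; $\tau_e$ denotes the cycle length of $q_e$. If $a_i,d_i$ are the polling and departure epochs of stage $i$ in $q_e$, its ratios are $r_i=(q_{e,p(i)}(a_i)-q_{e,p(i)}(d_i))/q_{e,p(i)}(a_i)$ if $q_{e,p(i)}(a_i)>0$ and $r_i=0$ otherwise. The optimal parameters $(L_*,\mathbf r_* )$ are the number of table cycles and the vector of ratios of a minimizer of $\frac1{\tau_e}\int_0^{\tau_e}\psi(q_e(u))\,du$ over $\mathcal Q$. *)

theory Defs
  imports "HOL-Probability.Probability" "HOL-Library.Landau_Symbols"
begin

text \<open>
  Queues are the elements of a finite type. Stages are numbered from 0, so the basic table is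
  \<open>p 0, \<dots>, p (I - 1)\<close>; the table and all stage data \<open>s\<close> are only read at indices below
  \<open>I\<close> and extended periodically through \<open>j mod I\<close>. The stages of the \<open>L\<close>-fold augmented
  table are \<open>0, \<dots>, I * L - 1\<close>.
\<close>

section \<open>Fluid model\<close>

definition load :: "('k::finite \<Rightarrow> real) \<Rightarrow> ('k \<Rightarrow> real) \<Rightarrow> real" where
  "load lam mu = (\<Sum>k\<in>UNIV. lam k / mu k)"

definition fluid_cycle_length ::
  "nat \<Rightarrow> ('k::finite \<Rightarrow> real) \<Rightarrow> ('k \<Rightarrow> real) \<Rightarrow> (nat \<Rightarrow> real) \<Rightarrow> nat \<Rightarrow> real" where
  "fluid_cycle_length I lam mu s L = (\<Sum>i<I. s i) * real L / (1 - load lam mu)"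

definition fluid_polling_epoch :: "nat \<Rightarrow> (nat \<Rightarrow> real) \<Rightarrow> (nat \<Rightarrow> real) \<Rightarrow> nat \<Rightarrow> real" where
  "fluid_polling_epoch I s b i = (\<Sum>j<i. b j + s (j mod I))"

definition fluid_departure_epoch :: "nat \<Rightarrow> (nat \<Rightarrow> real) \<Rightarrow> (nat \<Rightarrow> real) \<Rightarrow> nat \<Rightarrow> real" where
  "fluid_departure_epoch I s b i = fluid_polling_epoch I s b i + b i"

text \<open>
  The busy times are kept as an argument: the curve alone need not determine them when some
  \<open>s i\<close> vanish.
\<close>

definition PE_candidate ::
  "nat \<Rightarrow> (nat \<Rightarrow> 'k::finite) \<Rightarrow> ('k \<Rightarrow> real) \<Rightarrow> ('k \<Rightarrow> real) \<Rightarrow> (nat \<Rightarrow> real) \<Rightarrow>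
   nat \<Rightarrow> (nat \<Rightarrow> real) \<Rightarrow> (real \<Rightarrow> real^'k) \<Rightarrow> bool" where
  "PE_candidate I p lam mu s L b q \<longleftrightarrow>
     (let \<tau> = fluid_cycle_length I lam mu s L;
          a = fluid_polling_epoch I s b;
          d = fluid_departure_epoch I s b
      in L \<ge> 1 \<and> (\<forall>i<I * L. 0 \<le> b i) \<and> a (I * L) = \<tau> \<and>
         continuous_on {0..\<tau>} q \<and> (\<forall>t\<in>{0..\<tau>}. 0 \<le> q t) \<and> q 0 = q \<tau> \<and>
         (\<forall>i<I * L.
            (\<forall>t\<in>{a i<..<d i}.
               (q has_vector_derivative
                  (\<chi> k. if k = p (i mod I) then lam k - mu k else lam k)) (at t)) \<and>
            (\<forall>t\<in>{d i<..<a (Suc i)}. (q has_vector_derivative (\<chi> k. lam k)) (at t))))"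

definition fluid_average_cost ::
  "nat \<Rightarrow> ('k::finite \<Rightarrow> real) \<Rightarrow> ('k \<Rightarrow> real) \<Rightarrow> (nat \<Rightarrow> real) \<Rightarrow> (real^'k \<Rightarrow> real) \<Rightarrow>
   nat \<Rightarrow> (real \<Rightarrow> real^'k) \<Rightarrow> real" where
  "fluid_average_cost I lam mu s \<psi> L q =
     (let \<tau> = fluid_cycle_length I lam mu s L in 1 / \<tau> * integral {0..\<tau>} (\<lambda>u. \<psi> (q u)))"

definition PE_minimizer ::
  "nat \<Rightarrow> (nat \<Rightarrow> 'k::finite) \<Rightarrow> ('k \<Rightarrow> real) \<Rightarrow> ('k \<Rightarrow> real) \<Rightarrow> (nat \<Rightarrow> real) \<Rightarrow>
   (real^'k \<Rightarrow> real) \<Rightarrow> nat \<Rightarrow> (nat \<Rightarrow> real) \<Rightarrow> (real \<Rightarrow> real^'k) \<Rightarrow> bool" where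
  "PE_minimizer I p lam mu s \<psi> L b q \<longleftrightarrow>
     PE_candidate I p lam mu s L b q \<and>
     (\<forall>L' b' q'. PE_candidate I p lam mu s L' b' q' \<longrightarrow>
        fluid_average_cost I lam mu s \<psi> L q \<le> fluid_average_cost I lam mu s \<psi> L' q')"

definition PE_ratio ::
  "nat \<Rightarrow> (nat \<Rightarrow> 'k::finite) \<Rightarrow> (nat \<Rightarrow> real) \<Rightarrow> (nat \<Rightarrow> real) \<Rightarrow> (real \<Rightarrow> real^'k) \<Rightarrow>
   nat \<Rightarrow> real" where
  "PE_ratio I p s b q i =
     (let k = p (i mod I);
          x = q (fluid_polling_epoch I s b i) $ k;
          y = q (fluid_departure_epoch I s b i) $ k
      in if x > 0 then (x - y) / x else 0)"

definition optimal_parameters ::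
  "nat \<Rightarrow> (nat \<Rightarrow> 'k::finite) \<Rightarrow> ('k \<Rightarrow> real) \<Rightarrow> ('k \<Rightarrow> real) \<Rightarrow> (nat \<Rightarrow> real) \<Rightarrow>
   (real^'k \<Rightarrow> real) \<Rightarrow> nat \<Rightarrow> (nat \<Rightarrow> real) \<Rightarrow> bool" where
  "optimal_parameters I p lam mu s \<psi> L r \<longleftrightarrow>
     (\<exists>b q. PE_minimizer I p lam mu s \<psi> L b q \<and> (\<forall>i<I * L. r i = PE_ratio I p s b q i))"


section \<open>Stochastic system\<close>

text \<open>
  The primitive random variables. Stage visits are numbered \<open>j = 0, 1, 2, \<dots>\<close> over the whole
  time axis. \<open>interarrival X k m\<close> is the time between the \<open>m\<close>-th and the next arrival
  (for \<open>m = 0\<close>: from time 0) to queue \<open>k\<close>; \<open>service X k m\<close> is the service time of the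
  \<open>(m+1)\<close>-st class-\<open>k\<close> customer in the order of service; \<open>switchover X j\<close> is the
  switchover time after visit \<open>j\<close>; \<open>selected X j m\<close> tells whether the \<open>(m+1)\<close>-st customer
  present at the polling epoch of visit \<open>j\<close> is selected; \<open>init X\<close> is the queue vector at
  time 0.
\<close>

record ('k::finite, 'w) primitives =
  prob_sp :: "'w measure"
  interarrival :: "'k \<Rightarrow> nat \<Rightarrow> 'w \<Rightarrow> real"
  service :: "'k \<Rightarrow> nat \<Rightarrow> 'w \<Rightarrow> real"
  switchover :: "nat \<Rightarrow> 'w \<Rightarrow> real"
  selected :: "nat \<Rightarrow> nat \<Rightarrow> 'w \<Rightarrow> bool"
  init :: "'w \<Rightarrow> nat^'k"

datatype 'k source =
  Interarrival 'k nat | Service 'k nat | Switchover nat | Selection nat nat | Initial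

text \<open>
  \<open>nuS k\<close> is the law of \<open>S\<^sub>k\<close> and \<open>nuV i\<close> that of the switchover time from stage \<open>i\<close>
  in the system under consideration. The policy parameters \<open>(L, r)\<close> enter through the
  selection probabilities. The primitives have different value types, so mutual independence is
  stated for the generated sigma-algebras.
\<close>

locale binomial_exhaustive_system = prob_space "prob_sp X"
  for I :: nat and lam :: "'k::finite \<Rightarrow> real" and nuS :: "'k \<Rightarrow> real measure"
    and nuV :: "nat \<Rightarrow> real measure" and L :: nat and r :: "nat \<Rightarrow> real"
    and X :: "('k, 'w) primitives" +
  assumes interarrival_law:
      "\<And>k m. distributed (prob_sp X) lborel (interarrival X k m) (exponential_density (lam k))"
    and service_measurable: "\<And>k m. service X k m \<in> borel_measurable (prob_sp X)"
    and service_law: "\<And>k m. distr (prob_sp X) borel (service X k m) = nuS k"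
    and switchover_measurable: "\<And>j. switchover X j \<in> borel_measurable (prob_sp X)"
    and switchover_law: "\<And>j. distr (prob_sp X) borel (switchover X j) = nuV (j mod I)"
    and selected_measurable:
      "\<And>j m. selected X j m \<in> measurable (prob_sp X) (count_space UNIV)"
    and selected_law:
      "\<And>j m. prob {w \<in> space (prob_sp X). selected X j m w} = r (j mod (I * L))"
    and init_measurable: "init X \<in> measurable (prob_sp X) (count_space UNIV)"
    and independent:
      "indep_sets
         (\<lambda>z. case z of
            Interarrival k m \<Rightarrow>
              sets (vimage_algebra (space (prob_sp X)) (interarrival X k m) borel)
          | Service k m \<Rightarrow> sets (vimage_algebra (space (prob_sp X)) (service X k m) borel)
          | Switchover j \<Rightarrow> sets (vimage_algebra (space (prob_sp X)) (switchover X j) borel)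
          | Selection j m \<Rightarrow>
              sets (vimage_algebra (space (prob_sp X)) (selected X j m) (count_space UNIV))
          | Initial \<Rightarrow> sets (vimage_algebra (space (prob_sp X)) (init X) (count_space UNIV)))
         UNIV"

text \<open>The Poisson arrival process of rate \<open>lam k\<close>, as the counting process of its i.i.d.
  exponential interarrival times.\<close>

definition arrivals :: "('k::finite, 'w) primitives \<Rightarrow> 'k \<Rightarrow> real \<Rightarrow> 'w \<Rightarrow> nat" where
  "arrivals X k t w = card {m. (\<Sum>l\<le>m. interarrival X k l w) \<le> t}"

text \<open>
  A visit to queue \<open>k\<close> that is polled at time \<open>a\<close>, when \<open>c\<close> class-\<open>k\<close> services have
  been completed so far: \<open>N\<close> customers are found, \<open>Y\<close> of them are selected, and the server
  serves until \<open>N - Y\<close> customers are left, that is, for \<open>Y\<close> busy periods. A customer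
  counts as present until the end of the service.
\<close>

definition found :: "('k::finite, 'w) primitives \<Rightarrow> 'k \<Rightarrow> real \<Rightarrow> nat \<Rightarrow> 'w \<Rightarrow> nat" where
  "found X k a c w = init X w $ k + arrivals X k a w - c"

definition num_selected :: "('k::finite, 'w) primitives \<Rightarrow> nat \<Rightarrow> 'k \<Rightarrow> real \<Rightarrow> nat \<Rightarrow> 'w \<Rightarrow> nat" where
  "num_selected X j k a c w = card {m. m < found X k a c w \<and> selected X j m w}"

definition completion_time ::
  "('k::finite, 'w) primitives \<Rightarrow> 'k \<Rightarrow> real \<Rightarrow> nat \<Rightarrow> nat \<Rightarrow> 'w \<Rightarrow> real" where
  "completion_time X k a c m w = a + (\<Sum>l<m. service X k (c + l) w)"

definition num_services :: "('k::finite, 'w) primitives \<Rightarrow> nat \<Rightarrow> 'k \<Rightarrow> real \<Rightarrow> nat \<Rightarrow> 'w \<Rightarrow> nat" where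
  "num_services X j k a c w =
     (LEAST m. found X k (completion_time X k a c m w) (c + m) w
               = found X k a c w - num_selected X j k a c w)"

text \<open>Polling epoch of visit \<open>j\<close>, and the numbers of services completed before it.\<close>

primrec polling_state ::
  "nat \<Rightarrow> (nat \<Rightarrow> 'k::finite) \<Rightarrow> ('k, 'w) primitives \<Rightarrow> nat \<Rightarrow> 'w \<Rightarrow> real \<times> (nat^'k)" where
  "polling_state I p X 0 w = (0, 0)"
| "polling_state I p X (Suc j) w =
     (let (a, C) = polling_state I p X j w;
          k = p (j mod I);
          m = num_services X j k a (C $ k) w
      in (completion_time X k a (C $ k) m w + switchover X j w,
          (\<chi> k'. if k' = k then C $ k + m else C $ k')))"

definition polling_epoch ::
  "nat \<Rightarrow> (nat \<Rightarrow> 'k::finite) \<Rightarrow> ('k, 'w) primitives \<Rightarrow> nat \<Rightarrow> 'w \<Rightarrow> real" where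
  "polling_epoch I p X j w = fst (polling_state I p X j w)"

definition completed_before ::
  "nat \<Rightarrow> (nat \<Rightarrow> 'k::finite) \<Rightarrow> ('k, 'w) primitives \<Rightarrow> nat \<Rightarrow> 'w \<Rightarrow> nat^'k" where
  "completed_before I p X j w = snd (polling_state I p X j w)"

definition embedded_chain ::
  "nat \<Rightarrow> (nat \<Rightarrow> 'k::finite) \<Rightarrow> nat \<Rightarrow> ('k, 'w) primitives \<Rightarrow> nat \<Rightarrow> 'w \<Rightarrow> nat^'k" where
  "embedded_chain I p L X m w =
     (let j = m * (I * L)
      in \<chi> k. found X k (polling_epoch I p X j w) (completed_before I p X j w $ k) w)"

text \<open>As \<open>init X\<close> is independent of the other primitives, this is invariance of its law under
  the transition kernel of the embedded chain.\<close>

definition stationary_start ::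
  "nat \<Rightarrow> (nat \<Rightarrow> 'k::finite) \<Rightarrow> nat \<Rightarrow> ('k, 'w) primitives \<Rightarrow> bool" where
  "stationary_start I p L X \<longleftrightarrow>
     distr (prob_sp X) (count_space UNIV) (embedded_chain I p L X 1)
       = distr (prob_sp X) (count_space UNIV) (init X)"

text \<open>The pair \<open>(j, m)\<close> stands for the \<open>(m+1)\<close>-st service during visit \<open>j\<close>.\<close>

definition completed ::
  "nat \<Rightarrow> (nat \<Rightarrow> 'k::finite) \<Rightarrow> ('k, 'w) primitives \<Rightarrow> 'k \<Rightarrow> real \<Rightarrow> 'w \<Rightarrow> nat" where
  "completed I p X k t w =
     card {(j, m). p (j mod I) = k \<and>
             (let a = polling_epoch I p X j w; c = completed_before I p X j w $ k
              in m < num_services X j k a c w \<and> completion_time X k a c (Suc m) w \<le> t)}"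

definition queue ::
  "nat \<Rightarrow> (nat \<Rightarrow> 'k::finite) \<Rightarrow> ('k, 'w) primitives \<Rightarrow> real \<Rightarrow> 'w \<Rightarrow> nat^'k" where
  "queue I p X t w = (\<chi> k. init X w $ k + arrivals X k t w - completed I p X k t w)"

definition scaled_queue ::
  "nat \<Rightarrow> (nat \<Rightarrow> 'k::finite) \<Rightarrow> nat \<Rightarrow> ('k, 'w) primitives \<Rightarrow> real \<Rightarrow> 'w \<Rightarrow> real^'k" where
  "scaled_queue I p n X u w = (\<chi> k. real (queue I p X (real n * u) w $ k) / real n)"

definition scaled_cycle_cost ::
  "nat \<Rightarrow> (nat \<Rightarrow> 'k::finite) \<Rightarrow> (real^'k \<Rightarrow> real) \<Rightarrow> nat \<Rightarrow> nat \<Rightarrow> ('k, 'w) primitives \<Rightarrow>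
   'w \<Rightarrow> real" where
  "scaled_cycle_cost I p \<psi> L n X w =
     (LINT u:{0..polling_epoch I p X (I * L) w / real n}|lborel. \<psi> (scaled_queue I p n X u w))"

text \<open>The members of the family may live on different probability spaces.\<close>

definition uniformly_integrable ::
  "'i set \<Rightarrow> ('i \<Rightarrow> 'w measure) \<Rightarrow> ('i \<Rightarrow> 'w \<Rightarrow> real) \<Rightarrow> bool" where
  "uniformly_integrable J M Z \<longleftrightarrow>
     (\<forall>i\<in>J. Z i \<in> borel_measurable (M i)) \<and>
     ((\<lambda>c::real. SUP i\<in>J. \<integral>\<^sup>+w. ennreal \<bar>Z i w\<bar> * indicator {w. \<bar>Z i w\<bar> > c} w \<partial>M i)
        \<longlongrightarrow> 0) at_top"

end

theory Submission
  imports Defs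
begin

text \<open>
  The workload \<open>W = \<Sum>k. u k * Q k\<close> at the beginning of a cycle, with \<open>u k\<close> slightly larger than
  \<open>1 / mu k\<close>, is a Lyapunov function. Pathwise, \<open>W\<^sub>1 \<le> \<gamma> W\<^sub>0 + U\<close> with \<open>\<gamma> < 1\<close>, where the error \<open>U\<close>
  consists of the switchover times and of the deviations of the arrival, selection and service
  sequences from their linear trends. Each deviation is at most the supremum of a random walk with
  negative drift, whose law does not depend on \<open>n\<close> and which has finite moments by Lindley's
  recursion; so no Markov property at random times is needed. Since \<open>W\<^sub>0\<close> and \<open>W\<^sub>1\<close> have the same law,
  the tails of \<open>U / n\<close> control those of \<open>W\<^sub>0 / n\<close>, even without a priori moments of the stationary
  distribution. When the service times have only two moments, the supremum of the service walk has
  only one; this bounds the mean number of services per cycle by a multiple of \<open>n\<close>, and Wald's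
  second identity then shows that the service deviation over a cycle is of order \<open>sqrt n\<close> in \<open>L\<^sup>2\<close>.
  The cycle cost is at most \<open>c * G ^ (q + 1)\<close>, where \<open>G\<close> bounds the scaled cycle length and queues.
\<close>

text \<open>The obstacle is that the numbers of arrivals, selections and services in a cycle are
  random and depend on each other. A bound by a linear trend plus the supremum of a walk holds at
  all indices simultaneously, so a cycle can then be estimated path by path with linear
  inequalities. The trends must be perturbed to give these walks negative drift: \<open>eta\<close>
  is so small that arrival rates and mean service times may both grow by the factor
  \<open>1 + eta\<close> while the load stays below 1. For the contraction the cycle length has to
  dominate the initial workload, so each queue needs a stage with positive selection probability;
  the periodicity of the PE-candidate supplies it. Tails are measured by the excess
  \<open>max 0 (G - K) ^ P\<close>, which is convex and monotone in \<open>G\<close> and hence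
  compatible with a contraction between two variables of equal law. The exponent
  \<open>q + 1\<close> has one factor from the cycle length and \<open>q\<close> from the cost along
  the cycle; under two service moments \<open>q = 1\<close>, so order 2 is required where the
  supremum gives order 1.\<close>

section \<open>Ratios of PE-candidates\<close>

text \<open>A queue that is never drained grows at rate \<open>lam k\<close> over the whole period
  and cannot return to its initial value. So some visit has positive busy time, and since
  \<open>lam k < mu k\<close> that visit strictly lowers the queue.\<close>

lemma PE_ratio_pos:
  fixes p :: "nat \<Rightarrow> 'k::finite"
  assumes PE: "PE_candidate I p lam mu s L b q"
    and rates: "\<And>k. lam k > 0" "\<And>k. mu k > 0"
    and stable: "load lam mu < 1"
    and s_nonneg: "\<And>i. i < I \<Longrightarrow> s i \<ge> 0"
    and s_pos: "(\<Sum>i<I. s i) > 0"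
  shows "\<exists>i<I * L. p (i mod I) = k \<and> PE_ratio I p s b q i > 0"
proof (rule ccontr)
  assume contra: "\<not> ?thesis"
  define \<tau> where "\<tau> = fluid_cycle_length I lam mu s L"
  define a where "a = fluid_polling_epoch I s b"
  define d where "d = fluid_departure_epoch I s b"
  have L: "L \<ge> 1" and b0: "\<And>i. i < I * L \<Longrightarrow> 0 \<le> b i" and aIL: "a (I * L) = \<tau>"
    and cont: "continuous_on {0..\<tau>} q" and q0: "\<And>t. t \<in> {0..\<tau>} \<Longrightarrow> 0 \<le> q t" and per: "q 0 = q \<tau>"
    and D1: "\<And>i t. i < I * L \<Longrightarrow> t \<in> {a i<..<d i} \<Longrightarrow> (q has_vector_derivative
                  (\<chi> k. if k = p (i mod I) then lam k - mu k else lam k)) (at t)"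
    and D2: "\<And>i t. i < I * L \<Longrightarrow> t \<in> {d i<..<a (Suc i)} \<Longrightarrow>
      (q has_vector_derivative (\<chi> k. lam k)) (at t)"
    using PE unfolding PE_candidate_def Let_def \<tau>_def a_def d_def by auto
  have I0: "I > 0" using s_pos by (cases I) auto
  have s0: "0 \<le> s (i mod I)" for i using s_nonneg I0 by simp
  have a_Suc: "a (Suc i) = d i + s (i mod I)" "d i = a i + b i" for i
    by (auto simp: a_def d_def fluid_departure_epoch_def fluid_polling_epoch_def)
  have a0: "a 0 = 0" by (simp add: a_def fluid_polling_epoch_def)
  have amono: "a i \<le> a j" if "i \<le> j" "j \<le> I * L" for i j
    unfolding a_def fluid_polling_epoch_def
    by (rule sum_mono2) (use that b0 s0 in \<open>auto intro!: add_nonneg_nonneg\<close>)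
  have tau: "\<tau> > 0"
    using L stable s_pos by (auto simp: \<tau>_def fluid_cycle_length_def intro!: divide_pos_pos mult_pos_pos)
  \<comment> \<open>Derivatives are known only on the open segments between epochs; continuity of
    \<open>q\<close> and the mean value theorem turn them into increments between the end
    points.\<close>
  have incr: "q y $ k - q x $ k = c * (y - x)"
    if "0 \<le> x" "x \<le> y" "y \<le> \<tau>" "\<And>t. t \<in> {x<..<y} \<Longrightarrow> (q has_vector_derivative v) (at t)" "v $ k = c"
    for x y v c
  proof (cases "x = y")
    case False
    with that have xy: "x < y" by simp
    have "continuous_on {x..y} (\<lambda>t. q t $ k)"
      by (intro continuous_on_component continuous_on_subset[OF cont]) (use that in auto)
    moreover have "((\<lambda>t. q t $ k) has_derivative (\<lambda>h. h * c)) (at t)" if "x < t" "t < y" for t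
    proof -
      have "(q has_derivative (\<lambda>h. h *\<^sub>R v)) (at t)"
        using that \<open>\<And>t. t \<in> {x<..<y} \<Longrightarrow> _\<close> by (auto simp: has_vector_derivative_def)
      from bounded_linear.has_derivative[OF bounded_linear_vec_nth this, of k] \<open>v $ k = c\<close>
      show ?thesis by simp
    qed
    ultimately obtain \<xi> where "q y $ k - q x $ k = (y - x) * c"
      using mvt[OF xy, of "\<lambda>t. q t $ k" "\<lambda>_ h. h * c"] by auto
    then show ?thesis by (simp add: mult.commute)
  qed auto
  have rng: "0 \<le> a i" "a i \<le> d i" "d i \<le> a (Suc i)" "a (Suc i) \<le> \<tau>" if "i < I * L" for i
  proof -
    show "0 \<le> a i" using amono[of 0 i] that a0 by simp
    show "a i \<le> d i" "d i \<le> a (Suc i)" using a_Suc[of i] b0[OF that] s0[of i] by auto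
    show "a (Suc i) \<le> \<tau>" using amono[of "Suc i" "I * L"] that aIL by simp
  qed
  have bz: "b i = 0" if i: "i < I * L" "p (i mod I) = k" for i
  proof (rule ccontr)
    assume "b i \<noteq> 0"
    then have bpos: "b i > 0" using b0[OF i(1)] by simp
    have "lam k / mu k \<le> load lam mu"
      unfolding load_def using rates by (intro member_le_sum) (auto intro: less_imp_le)
    then have "lam k / mu k < 1" using stable by simp
    then have lm: "lam k < mu k" using rates(2)[of k] by (simp add: divide_less_eq)
    have "q (d i) $ k - q (a i) $ k = (lam k - mu k) * (d i - a i)"
      by (rule incr[OF _ _ _ D1[OF i(1)]]) (use rng[OF i(1)] i in auto)
    then have diff: "q (a i) $ k - q (d i) $ k = (mu k - lam k) * b i"
      using a_Suc[of i] by (simp add: algebra_simps)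
    have "q (d i) $ k \<ge> 0"
      using q0[of "d i"] rng[OF i(1)] by (auto simp: less_eq_vec_def)
    then have "q (a i) $ k > 0" using diff mult_pos_pos[of "mu k - lam k" "b i"] bpos lm by linarith
    then have "PE_ratio I p s b q i > 0"
      using diff bpos lm i(2) by (auto simp: PE_ratio_def Let_def a_def d_def intro!: divide_pos_pos)
    with contra i show False by auto
  qed
  have step: "q (a (Suc i)) $ k - q (a i) $ k = lam k * (a (Suc i) - a i)" if i: "i < I * L" for i
  proof -
    have 1: "q (a (Suc i)) $ k - q (d i) $ k = lam k * (a (Suc i) - d i)"
      by (rule incr[OF _ _ _ D2[OF i]]) (use rng[OF i] in auto)
    show ?thesis
    proof (cases "p (i mod I) = k")
      case True
      then have "d i = a i" using bz[OF i] a_Suc by simp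
      then show ?thesis using 1 by simp
    next
      case False
      have "q (d i) $ k - q (a i) $ k = lam k * (d i - a i)"
        by (rule incr[OF _ _ _ D1[OF i]]) (use rng[OF i] False in auto)
      then show ?thesis using 1 by (simp add: algebra_simps)
    qed
  qed
  have "(\<Sum>i<I * L. q (a (Suc i)) $ k - q (a i) $ k) = (\<Sum>i<I * L. lam k * (a (Suc i) - a i))"
    by (intro sum.cong) (use step in auto)
  then have "q \<tau> $ k - q 0 $ k = lam k * \<tau>"
    by (simp add: sum_lessThan_telescope[of "\<lambda>i. q (a i) $ k"] sum_distrib_left[symmetric]
      sum_lessThan_telescope[of a] aIL a0)
  then show False using per tau rates(1)[of k] by simp
qed

section \<open>Suprema of random walks with negative drift\<close>

text \<open>Lindley's recursion: \<open>lindley M \<omega>\<close> is the maximum of the first \<open>M\<close> partial sums of \<open>\<omega>\<close>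
  and 0.\<close>

primrec lindley :: "nat \<Rightarrow> (nat \<Rightarrow> real) \<Rightarrow> real" where
  "lindley 0 \<omega> = 0"
| "lindley (Suc M) \<omega> = max 0 (\<omega> 0 + lindley M (\<lambda>l. \<omega> (Suc l)))"

text \<open>\<open>enn2real\<close> gives the value 0 when the supremum is infinite. The function is
  thus total, measurable and nonnegative; under negative drift this default occurs on a null set
  only.\<close>

definition walk_sup :: "(nat \<Rightarrow> real) \<Rightarrow> real" where
  "walk_sup \<omega> = enn2real (SUP M. ennreal (lindley M \<omega>))"

lemma lindley_nonneg: "0 \<le> lindley M \<omega>"
  by (cases M) auto

lemma lindley_Suc_ge: "lindley M \<omega> \<le> lindley (Suc M) \<omega>"
proof (induction M arbitrary: \<omega>)
  case (Suc M)
  show ?case using Suc[of "\<lambda>l. \<omega> (Suc l)"] by simp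
qed simp

lemma incseq_lindley: "incseq (\<lambda>M. lindley M \<omega>)"
  by (intro incseq_SucI lindley_Suc_ge)

lemma walk_le_lindley: "m \<le> M \<Longrightarrow> (\<Sum>l<m. \<omega> l) \<le> lindley M \<omega>"
proof (induction M arbitrary: m \<omega>)
  case (Suc M)
  show ?case
  proof (cases m)
    case (Suc m')
    then show ?thesis
      using Suc.IH[of m' "\<lambda>l. \<omega> (Suc l)"] Suc.prems by (simp add: sum.lessThan_Suc_shift del: sum.lessThan_Suc)
  qed (simp add: lindley_nonneg)
qed simp

lemma walk_sup_nonneg: "0 \<le> walk_sup \<omega>"
  by (simp add: walk_sup_def)

lemma measurable_lindley: "lindley M \<in> borel_measurable (PiM UNIV (\<lambda>_. borel))"
proof (induction M)
  case (Suc M)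
  have "(\<lambda>\<omega> l. \<omega> (Suc l)) \<in> measurable (PiM UNIV (\<lambda>_. borel)) (PiM UNIV (\<lambda>_. borel :: real measure))"
    by (rule measurable_PiM_single') auto
  from measurable_compose[OF this Suc] have "(\<lambda>\<omega>. lindley M (\<lambda>l. \<omega> (Suc l))) \<in> borel_measurable (PiM UNIV (\<lambda>_. borel))" .
  then show ?case unfolding lindley.simps
    by (intro borel_measurable_max borel_measurable_add) auto
qed simp

lemma measurable_walk_sup: "walk_sup \<in> borel_measurable (PiM UNIV (\<lambda>_. borel))"
  unfolding walk_sup_def using measurable_lindley by measurable

lemma lindley_tendsto_walk_sup:
  assumes "(SUP M. ennreal (lindley M \<omega>)) \<noteq> top"
  shows "(\<lambda>M. lindley M \<omega>) \<longlonglongrightarrow> walk_sup \<omega>"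
proof -
  have "incseq (\<lambda>M. ennreal (lindley M \<omega>))"
    by (intro incseq_SucI ennreal_leI lindley_Suc_ge)
  from LIMSEQ_SUP[OF this] have "(\<lambda>M. ennreal (lindley M \<omega>)) \<longlonglongrightarrow> ennreal (walk_sup \<omega>)"
    unfolding walk_sup_def ennreal_enn2real[OF assms[unfolded less_top]] .
  then show ?thesis by (subst (asm) tendsto_ennreal_iff) (auto simp: lindley_nonneg walk_sup_nonneg)
qed

lemma power_walk_sup_le:
  assumes "p \<ge> 1"
  shows "ennreal (walk_sup \<omega> ^ p) \<le> (SUP M. ennreal (lindley M \<omega> ^ p))"
proof (cases "(SUP M. ennreal (lindley M \<omega>)) = top")
  case True
  show ?thesis unfolding walk_sup_def True using assms by (simp add: power_0_left)
next
  case False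
  have "(\<lambda>M. ennreal (lindley M \<omega> ^ p)) \<longlonglongrightarrow> ennreal (walk_sup \<omega> ^ p)"
    by (intro tendsto_ennrealI tendsto_power lindley_tendsto_walk_sup False)
  moreover have "incseq (\<lambda>M. ennreal (lindley M \<omega> ^ p))"
    by (intro incseq_SucI ennreal_leI power_mono lindley_Suc_ge lindley_nonneg)
  note LIMSEQ_SUP[OF this]
  ultimately show ?thesis by (metis LIMSEQ_unique order_refl)
qed

text \<open>One step of Lindley's recursion, expanded by the binomial theorem. The term linear in
  \<open>s\<close> is kept exact, because its expectation carries the negative drift; all lower
  powers of \<open>z\<close> go into a remainder of order \<open>p - 1\<close>.\<close>

lemma power_add_max_le:
  fixes s z :: real
  assumes z: "0 \<le> z" and p: "p \<ge> 1"
  shows "max 0 (s + z) ^ Suc p \<le> z ^ Suc p + real (Suc p) * s * z ^ p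
    + (1 + z) ^ (p - 1) * ((\<Sum>i<p. real (Suc p choose i) * \<bar>s\<bar> ^ (Suc p - i)) + \<bar>s\<bar> ^ Suc p)"
proof -
  let ?q = "Suc p"
  \<comment> \<open>If \<open>s + z < 0\<close>, then \<open>z \<ge> 0\<close> gives
    \<open>\<bar>z + s\<bar> \<le> \<bar>s\<bar>\<close>, so the truncation at 0 costs at most the
    last summand.\<close>
  have "max 0 (s + z) ^ ?q \<le> (z + s) ^ ?q + \<bar>s\<bar> ^ ?q"
  proof (cases "s + z \<ge> 0")
    case False
    have "- ((z + s) ^ ?q) \<le> \<bar>z + s\<bar> ^ ?q"
      by (metis abs_ge_minus_self power_abs)
    also have "\<dots> \<le> \<bar>s\<bar> ^ ?q" by (rule power_mono) (use False z in auto)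
    finally show ?thesis using False by (simp add: max_def)
  qed (simp add: max_def add.commute)
  also have "(z + s) ^ ?q = (\<Sum>i\<le>?q. real (?q choose i) * z ^ i * s ^ (?q - i))"
    by (rule binomial_ring)
  also have "\<dots> = (\<Sum>i<p. real (?q choose i) * z ^ i * s ^ (?q - i)) + real ?q * s * z ^ p + z ^ ?q"
    using p by (simp add: atMost_Suc lessThan_Suc_atMost[symmetric] Suc_diff_le algebra_simps)
  also have "(\<Sum>i<p. real (?q choose i) * z ^ i * s ^ (?q - i)) \<le>
    (\<Sum>i<p. (1 + z) ^ (p - 1) * (real (?q choose i) * \<bar>s\<bar> ^ (?q - i)))"
  proof (rule sum_mono)
    fix i assume i: "i \<in> {..<p}"
    have "z ^ i \<le> (1 + z) ^ i" by (rule power_mono) (use z in auto)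
    also have "\<dots> \<le> (1 + z) ^ (p - 1)" by (rule power_increasing) (use z i in auto)
    finally have 1: "z ^ i \<le> (1 + z) ^ (p - 1)" .
    have 2: "s ^ (?q - i) \<le> \<bar>s\<bar> ^ (?q - i)" by (metis abs_ge_self power_abs)
    have "z ^ i * s ^ (?q - i) \<le> z ^ i * \<bar>s\<bar> ^ (?q - i)"
      using z 2 by (intro mult_left_mono) auto
    also have "\<dots> \<le> (1 + z) ^ (p - 1) * \<bar>s\<bar> ^ (?q - i)"
      using 1 by (intro mult_right_mono) auto
    finally have "real (?q choose i) * (z ^ i * s ^ (?q - i)) \<le>
      real (?q choose i) * ((1 + z) ^ (p - 1) * \<bar>s\<bar> ^ (?q - i))"
      by (rule mult_left_mono) simp
    then show "real (?q choose i) * z ^ i * s ^ (?q - i) \<le>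
      (1 + z) ^ (p - 1) * (real (?q choose i) * \<bar>s\<bar> ^ (?q - i))"
      by (simp add: mult_ac)
  qed
  also have "\<bar>s\<bar> ^ ?q \<le> (1 + z) ^ (p - 1) * \<bar>s\<bar> ^ ?q"
    using z mult_right_mono[of 1 "(1 + z) ^ (p - 1)" "\<bar>s\<bar> ^ ?q"] by (simp del: power_Suc)
  finally show ?thesis by (simp add: algebra_simps sum_distrib_left)
qed

lemma integrable_abs_power_le:
  fixes M :: "real measure"
  assumes "real_distribution M" "integrable M (\<lambda>x. \<bar>x\<bar> ^ q)" "j \<le> q"
  shows "integrable M (\<lambda>x. \<bar>x\<bar> ^ j)"
proof -
  interpret real_distribution M by fact
  have [measurable_cong]: "sets M = sets borel" by simp
  show ?thesis
  proof (rule Bochner_Integration.integrable_bound[where f="\<lambda>x. 1 + \<bar>x\<bar> ^ q"])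
    have "\<bar>x\<bar> ^ j \<le> 1 + \<bar>x\<bar> ^ q" for x :: real
    proof (cases "\<bar>x\<bar> \<le> 1")
      case True
      then have "\<bar>x\<bar> ^ j \<le> 1" by (intro power_le_one) auto
      then show ?thesis by (simp add: add_increasing2)
    next
      case False
      then have "\<bar>x\<bar> ^ j \<le> \<bar>x\<bar> ^ q" using assms(3) by (intro power_increasing) auto
      then show ?thesis by simp
    qed
    then show "AE x in M. norm (\<bar>x\<bar> ^ j) \<le> norm (1 + \<bar>x\<bar> ^ q)" by (simp add: add_nonneg_nonneg)
  qed (use assms(2) in auto)
qed

lemma one_plus_power_le:
  fixes z :: real assumes "0 \<le> z" shows "(1 + z) ^ p \<le> 2 ^ p * (1 + z ^ p)"
proof -
  have "(1 + z) ^ p \<le> (2 * max 1 z) ^ p" by (rule power_mono) (use assms in auto)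
  also have "\<dots> \<le> 2 ^ p * (1 + z ^ p)"
    using assms by (auto simp: power_mult_distrib max_def intro!: mult_left_mono)
  finally show ?thesis .
qed

text \<open>The moment theorem of Kiefer and Wolfowitz: the supremum has one moment less than the
  steps. In the drift inequality for the power \<open>p + 1\<close> the moments of order
  \<open>p + 1\<close> cancel, and what remains bounds the moment of order \<open>p\<close>
  uniformly in the horizon \<open>M\<close>.\<close>

lemma
  fixes \<nu> :: "real measure"
  assumes dist: "real_distribution \<nu>" and mom: "integrable \<nu> (\<lambda>x. \<bar>x\<bar> ^ Suc p)"
    and neg: "(\<integral>x. x \<partial>\<nu>) < 0" and p: "p \<ge> 1"
  shows nn_integral_power_walk_sup:
      "(\<integral>\<^sup>+\<omega>. ennreal (walk_sup \<omega> ^ p) \<partial>PiM UNIV (\<lambda>_. \<nu>)) < \<infinity>"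
    and AE_le_walk_sup: "AE \<omega> in PiM UNIV (\<lambda>_. \<nu>). \<forall>m. (\<Sum>l<m. \<omega> l) \<le> walk_sup \<omega>"
proof -
  interpret real_distribution \<nu> by fact
  interpret sequence_space \<nu> by unfold_locales
  have sets_nu[measurable_cong]: "sets \<nu> = sets borel" by simp
  have sets_S: "sets S = sets (PiM UNIV (\<lambda>_. borel))"
    by (rule sets_PiM_cong) auto
  note [measurable_cong] = sets_S
  note [measurable] = measurable_lindley measurable_walk_sup
  have PS: "prob_space S" by (rule prob_space_PiM) unfold_locales
  note S_1 = prob_space.emeasure_space_1[OF PS] prob_space.prob_space[OF PS]
  have nu_1: "measure \<nu> (space \<nu>) = 1" by (rule prob_space.prob_space) unfold_locales
  interpret P: pair_sigma_finite \<nu> S by unfold_locales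
  \<comment> \<open>\<open>PiM_iter\<close> splits off the first coordinate of the product, so
    \<open>lindley (Suc M)\<close> is one recursion step applied to \<open>lindley M\<close>, driven
    by an independent \<open>s\<close>.\<close>
  have shift: "(\<integral>\<^sup>+\<omega>. f (lindley (Suc M) \<omega>) \<partial>S) = (\<integral>\<^sup>+\<omega>. \<integral>\<^sup>+s. f (max 0 (s + lindley M \<omega>)) \<partial>\<nu> \<partial>S)"
    if [measurable]: "f \<in> borel_measurable borel" for f :: "real \<Rightarrow> ennreal" and M
  proof -
    have cn[measurable]: "(\<lambda>(s, \<omega>). case_nat s \<omega>) \<in> measurable (\<nu> \<Otimes>\<^sub>M S) S" by measurable
    have "(\<integral>\<^sup>+\<omega>. f (lindley (Suc M) \<omega>) \<partial>S) =
        (\<integral>\<^sup>+\<omega>. f (lindley (Suc M) \<omega>) \<partial>distr (\<nu> \<Otimes>\<^sub>M S) S (\<lambda>(s, \<omega>). case_nat s \<omega>))"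
      by (simp only: PiM_iter)
    also have "\<dots> = (\<integral>\<^sup>+x. f (lindley (Suc M) ((\<lambda>(s, \<omega>). case_nat s \<omega>) x)) \<partial>(\<nu> \<Otimes>\<^sub>M S))"
      by (rule nn_integral_distr) (auto simp del: lindley.simps)
    also have "\<dots> = (\<integral>\<^sup>+x. f (max 0 (fst x + lindley M (snd x))) \<partial>(\<nu> \<Otimes>\<^sub>M S))"
      by (simp add: split_beta)
    also have "\<dots> = (\<integral>\<^sup>+\<omega>. \<integral>\<^sup>+s. f (max 0 (s + lindley M \<omega>)) \<partial>\<nu> \<partial>S)"
      by (subst P.nn_integral_snd[symmetric]) (auto simp: split_beta)
    finally show ?thesis .
  qed
  \<comment> \<open>Induction on the moment order: the bound of order \<open>p0\<close> controls the
    remainder in the drift inequality for the power \<open>q = p0 + 2\<close>, which yields the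
    bound of order \<open>P = p0 + 1\<close>.\<close>
  have bound: "integrable \<nu> (\<lambda>x. \<bar>x\<bar> ^ Suc p) \<Longrightarrow>
    \<exists>B\<ge>0. \<forall>M. (\<integral>\<^sup>+\<omega>. ennreal ((1 + lindley M \<omega>) ^ p) \<partial>S) \<le> ennreal B" for p
  proof (induction p)
    case 0
    show ?case by (intro exI[of _ 1]) (simp add: S_1)
  next
    case (Suc p0)
    define P where "P = Suc p0"
    define q where "q = Suc P"
    have P1: "P \<ge> 1" by (simp add: P_def)
    have mq: "integrable \<nu> (\<lambda>x. \<bar>x\<bar> ^ q)" using Suc.prems by (simp add: P_def q_def)
    have m: "integrable \<nu> (\<lambda>x. \<bar>x\<bar> ^ j)" if "j \<le> q" for j
      using integrable_abs_power_le[OF dist mq that] .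
    obtain B0 where B0: "B0 \<ge> 0"
      "\<And>M. (\<integral>\<^sup>+\<omega>. ennreal ((1 + lindley M \<omega>) ^ p0) \<partial>S) \<le> ennreal B0"
      using Suc.IH m[of "Suc p0"] by (auto simp: P_def q_def)
    \<comment> \<open>Finite for each \<open>M\<close>, without uniformity: this is enough to cancel
      the moment of order \<open>q\<close> in \<open>key\<close>.\<close>
    have fin: "(\<integral>\<^sup>+\<omega>. ennreal ((1 + lindley M \<omega>) ^ q) \<partial>S) < \<infinity>" for M
    proof (induction M)
      case (Suc M)
      have "(\<integral>\<^sup>+\<omega>. ennreal ((1 + lindley (Suc M) \<omega>) ^ q) \<partial>S) =
        (\<integral>\<^sup>+\<omega>. \<integral>\<^sup>+s. ennreal ((1 + max 0 (s + lindley M \<omega>)) ^ q) \<partial>\<nu> \<partial>S)"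
        by (rule shift) measurable
      also have "\<dots> \<le> (\<integral>\<^sup>+\<omega>. \<integral>\<^sup>+s. ennreal ((1 + lindley M \<omega>) ^ q) * ennreal (2 ^ q * (1 + \<bar>s\<bar> ^ q)) \<partial>\<nu> \<partial>S)"
      proof (intro nn_integral_mono)
        fix \<omega> s
        have "(1 + max 0 (s + lindley M \<omega>)) ^ q \<le> ((1 + lindley M \<omega>) * (1 + \<bar>s\<bar>)) ^ q"
        proof (rule power_mono)
          have "max 0 (s + lindley M \<omega>) \<le> \<bar>s\<bar> + lindley M \<omega>" using lindley_nonneg[of M \<omega>] by linarith
          moreover have "0 \<le> lindley M \<omega> * \<bar>s\<bar>" using lindley_nonneg by simp
          ultimately show "1 + max 0 (s + lindley M \<omega>) \<le> (1 + lindley M \<omega>) * (1 + \<bar>s\<bar>)"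
            by (simp add: distrib_left distrib_right)
        qed simp
        also have "\<dots> \<le> (1 + lindley M \<omega>) ^ q * (2 ^ q * (1 + \<bar>s\<bar> ^ q))"
          unfolding power_mult_distrib using lindley_nonneg[of M \<omega>]
          by (intro mult_left_mono one_plus_power_le) auto
        finally show "ennreal ((1 + max 0 (s + lindley M \<omega>)) ^ q) \<le>
          ennreal ((1 + lindley M \<omega>) ^ q) * ennreal (2 ^ q * (1 + \<bar>s\<bar> ^ q))"
          using lindley_nonneg[of M \<omega>] by (simp add: ennreal_mult[symmetric] ennreal_leI)
      qed
      also have "\<dots> = (\<integral>\<^sup>+\<omega>. ennreal ((1 + lindley M \<omega>) ^ q) \<partial>S) * (\<integral>\<^sup>+s. ennreal (2 ^ q * (1 + \<bar>s\<bar> ^ q)) \<partial>\<nu>)"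
        by (simp add: nn_integral_cmult nn_integral_multc)
      also have "(\<integral>\<^sup>+s. ennreal (2 ^ q * (1 + \<bar>s\<bar> ^ q)) \<partial>\<nu>) < \<infinity>"
        using mq by (subst nn_integral_eq_integral) auto
      then have "(\<integral>\<^sup>+\<omega>. ennreal ((1 + lindley M \<omega>) ^ q) \<partial>S) * (\<integral>\<^sup>+s. ennreal (2 ^ q * (1 + \<bar>s\<bar> ^ q)) \<partial>\<nu>) < \<infinity>"
        using Suc by (simp add: ennreal_mult_less_top)
      finally show ?case .
    qed (simp add: S_1)
    have intl: "integrable S (\<lambda>\<omega>. (1 + lindley M \<omega>) ^ q)" for M
      using fin[of M] lindley_nonneg[of M] by (intro integrableI_nonneg) auto
    have bnd: "integrable S f" if "f \<in> borel_measurable S" "\<And>\<omega>. 0 \<le> f \<omega>" "\<And>\<omega>. f \<omega> \<le> (1 + lindley M \<omega>) ^ q" for f M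
      using that lindley_nonneg[of M]
      by (intro Bochner_Integration.integrable_bound[OF intl[of M]]) auto
    have pw1: "(1 + z) ^ j \<le> (1 + z) ^ q" "z ^ j \<le> (1 + z) ^ q" if "0 \<le> z" "j \<le> q" for z :: real and j
    proof -
      show 1: "(1 + z) ^ j \<le> (1 + z) ^ q" using that by (intro power_increasing) auto
      have "z ^ j \<le> (1 + z) ^ j" using that by (intro power_mono) auto
      then show "z ^ j \<le> (1 + z) ^ q" using 1 by simp
    qed
    have intz: "integrable S (\<lambda>\<omega>. lindley M \<omega> ^ j)" "integrable S (\<lambda>\<omega>. (1 + lindley M \<omega>) ^ j)" if "j \<le> q" for M j
      using pw1[OF lindley_nonneg that] lindley_nonneg[of M] by (auto intro!: bnd[of _ M])
    define R where "R s = (\<Sum>i<P. real (Suc P choose i) * \<bar>s\<bar> ^ (Suc P - i)) + \<bar>s\<bar> ^ Suc P" for s :: real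
    define \<delta> where "\<delta> = - (\<integral>x. x \<partial>\<nu>)"
    have \<delta>: "\<delta> > 0" using neg by (simp add: \<delta>_def)
    have intR: "integrable \<nu> R"
      unfolding R_def using m by (intro Bochner_Integration.integrable_add integrable_sum integrable_mult_right)
        (auto simp: q_def simp del: power_Suc)
    have int1: "integrable \<nu> (\<lambda>x. x)"
      using m[of 1] by (intro integrable_norm_cancel[of \<nu> "\<lambda>x. x"]) (auto simp: q_def)
    define B where "B = (\<integral>s. R s \<partial>\<nu>)"
    have B: "B \<ge> 0" unfolding B_def R_def by (intro integral_nonneg_AE) (auto intro!: add_nonneg_nonneg sum_nonneg)
    \<comment> \<open>The moment of order \<open>q\<close> of \<open>lindley M\<close> is at most
      that of \<open>lindley (Suc M)\<close> by monotonicity, and the recursion bounds the latter by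
      the former minus the drift term plus the remainder. Cancelling leaves the drift term bounded
      by \<open>B * B0\<close>.\<close>
    have key: "real q * \<delta> * (\<integral>\<omega>. lindley M \<omega> ^ P \<partial>S) \<le> B * B0" for M
    proof -
      let ?u = "\<lambda>z. z ^ q - real q * \<delta> * z ^ P + B * (1 + z) ^ p0"
      have inner: "(\<integral>\<^sup>+s. ennreal (max 0 (s + z) ^ q) \<partial>\<nu>) \<le> ennreal (?u z) \<and> 0 \<le> ?u z" if z: "0 \<le> z" for z
      proof -
        let ?v = "\<lambda>s. z ^ q + real q * s * z ^ P + (1 + z) ^ p0 * R s"
        have v: "max 0 (s + z) ^ q \<le> ?v s" for s
          using power_add_max_le[OF z P1, of s] unfolding q_def R_def P_def by simp
        have v0: "0 \<le> ?v s" for s using v[of s] by (rule order_trans[rotated]) auto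
        have intv: "integrable \<nu> ?v" using intR int1 by auto
        have "(\<integral>s. ?v s \<partial>\<nu>) = ?u z"
          using intR int1 by (simp add: \<delta>_def B_def nu_1[simplified])
        moreover have "(\<integral>\<^sup>+s. ennreal (max 0 (s + z) ^ q) \<partial>\<nu>) \<le> (\<integral>\<^sup>+s. ennreal (?v s) \<partial>\<nu>)"
          by (intro nn_integral_mono ennreal_leI v)
        moreover have "\<dots> = ennreal (\<integral>s. ?v s \<partial>\<nu>)"
          by (rule nn_integral_eq_integral[OF intv]) (use v0 in auto)
        moreover have "0 \<le> (\<integral>s. ?v s \<partial>\<nu>)" by (rule integral_nonneg_AE) (use v0 in auto)
        ultimately show ?thesis by simp
      qed
      have intu: "integrable S (\<lambda>\<omega>. ?u (lindley M \<omega>))"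
        by (intro Bochner_Integration.integrable_add Bochner_Integration.integrable_diff integrable_mult_right intz)
          (auto simp: q_def P_def)
      have "ennreal (\<integral>\<omega>. lindley M \<omega> ^ q \<partial>S) = (\<integral>\<^sup>+\<omega>. ennreal (lindley M \<omega> ^ q) \<partial>S)"
        by (rule nn_integral_eq_integral[symmetric]) (auto simp: intz lindley_nonneg)
      also have "\<dots> \<le> (\<integral>\<^sup>+\<omega>. ennreal (lindley (Suc M) \<omega> ^ q) \<partial>S)"
        by (intro nn_integral_mono ennreal_leI power_mono lindley_Suc_ge lindley_nonneg)
      also have "\<dots> = (\<integral>\<^sup>+\<omega>. \<integral>\<^sup>+s. ennreal (max 0 (s + lindley M \<omega>) ^ q) \<partial>\<nu> \<partial>S)"
        by (rule shift) measurable
      also have "\<dots> \<le> (\<integral>\<^sup>+\<omega>. ennreal (?u (lindley M \<omega>)) \<partial>S)"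
        by (intro nn_integral_mono) (use inner lindley_nonneg in auto)
      also have "\<dots> = ennreal (\<integral>\<omega>. ?u (lindley M \<omega>) \<partial>S)"
        by (rule nn_integral_eq_integral[OF intu]) (use inner lindley_nonneg in auto)
      finally have "(\<integral>\<omega>. lindley M \<omega> ^ q \<partial>S) \<le> (\<integral>\<omega>. ?u (lindley M \<omega>) \<partial>S)"
        using inner lindley_nonneg by (subst (asm) ennreal_le_iff) (auto intro!: integral_nonneg_AE)
      also have "\<dots> = (\<integral>\<omega>. lindley M \<omega> ^ q \<partial>S) - real q * \<delta> * (\<integral>\<omega>. lindley M \<omega> ^ P \<partial>S)
          + B * (\<integral>\<omega>. (1 + lindley M \<omega>) ^ p0 \<partial>S)"
        using intz[of q M] intz[of P M] intz[of p0 M] by (simp add: q_def P_def)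
      also have "(\<integral>\<omega>. (1 + lindley M \<omega>) ^ p0 \<partial>S) \<le> B0"
      proof -
        have "ennreal (\<integral>\<omega>. (1 + lindley M \<omega>) ^ p0 \<partial>S) = (\<integral>\<^sup>+\<omega>. ennreal ((1 + lindley M \<omega>) ^ p0) \<partial>S)"
          by (rule nn_integral_eq_integral[symmetric]) (auto simp: intz lindley_nonneg q_def P_def)
        then show ?thesis using B0 by (metis ennreal_le_iff)
      qed
      finally show ?thesis using B by (simp add: mult_left_mono)
    qed
    let ?B = "2 ^ P * (1 + B * B0 / (real q * \<delta>))"
    have "(\<integral>\<^sup>+\<omega>. ennreal ((1 + lindley M \<omega>) ^ P) \<partial>S) \<le> ennreal ?B" for M
    proof -
      have "(\<integral>\<^sup>+\<omega>. ennreal ((1 + lindley M \<omega>) ^ P) \<partial>S) \<le> (\<integral>\<^sup>+\<omega>. ennreal (2 ^ P * (1 + lindley M \<omega> ^ P)) \<partial>S)"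
        by (intro nn_integral_mono ennreal_leI one_plus_power_le lindley_nonneg)
      also have "\<dots> = ennreal (\<integral>\<omega>. 2 ^ P * (1 + lindley M \<omega> ^ P) \<partial>S)"
        by (rule nn_integral_eq_integral) (auto simp: intz lindley_nonneg q_def)
      also have "(\<integral>\<omega>. 2 ^ P * (1 + lindley M \<omega> ^ P) \<partial>S) = 2 ^ P * (1 + (\<integral>\<omega>. lindley M \<omega> ^ P \<partial>S))"
        using intz[of P M] by (simp add: q_def S_1)
      also have "\<dots> \<le> ?B"
      proof -
        have "0 < real q * \<delta>" using \<delta> by (simp add: q_def)
        from key[of M] this have "(\<integral>\<omega>. lindley M \<omega> ^ P \<partial>S) \<le> B * B0 / (real q * \<delta>)"
          by (simp only: pos_le_divide_eq mult.commute)
        then show ?thesis by (intro mult_left_mono add_left_mono) auto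
      qed
      finally show ?thesis by (simp add: ennreal_leI)
    qed
    moreover have "?B \<ge> 0" using B B0 \<delta> by (auto intro!: mult_nonneg_nonneg divide_nonneg_nonneg add_nonneg_nonneg)
    ultimately show ?case unfolding P_def by blast
  qed
  \<comment> \<open>Monotone convergence passes the uniform bounds to the supremum. The case
    \<open>j = p\<close> gives the moment, the case \<open>j = 1\<close> almost sure
    finiteness.\<close>
  have SUPfin: "(\<integral>\<^sup>+\<omega>. (SUP M. ennreal (lindley M \<omega> ^ j)) \<partial>S) < \<infinity>" if "j \<le> p" for j
  proof -
    obtain B where B: "B \<ge> 0" "\<And>M. (\<integral>\<^sup>+\<omega>. ennreal ((1 + lindley M \<omega>) ^ p) \<partial>S) \<le> ennreal B"
      using bound[OF mom] by blast
    have "(\<integral>\<^sup>+\<omega>. (SUP M. ennreal (lindley M \<omega> ^ j)) \<partial>S) = (SUP M. \<integral>\<^sup>+\<omega>. ennreal (lindley M \<omega> ^ j) \<partial>S)"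
      by (rule nn_integral_monotone_convergence_SUP)
        (auto intro!: incseq_SucI ennreal_leI power_mono lindley_Suc_ge lindley_nonneg simp: le_fun_def simp del: lindley.simps)
    also have "\<dots> \<le> ennreal B"
    proof (rule SUP_least)
      fix M
      have "(\<integral>\<^sup>+\<omega>. ennreal (lindley M \<omega> ^ j) \<partial>S) \<le> (\<integral>\<^sup>+\<omega>. ennreal ((1 + lindley M \<omega>) ^ p) \<partial>S)"
      proof (intro nn_integral_mono ennreal_leI)
        fix \<omega>
        have "lindley M \<omega> ^ j \<le> (1 + lindley M \<omega>) ^ j" by (intro power_mono) (auto simp: lindley_nonneg)
        also have "\<dots> \<le> (1 + lindley M \<omega>) ^ p" using that lindley_nonneg[of M \<omega>] by (intro power_increasing) auto
        finally show "lindley M \<omega> ^ j \<le> (1 + lindley M \<omega>) ^ p" .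
      qed
      then show "(\<integral>\<^sup>+\<omega>. ennreal (lindley M \<omega> ^ j) \<partial>S) \<le> ennreal B" using B(2)[of M] by (rule order_trans)
    qed
    finally show ?thesis by (simp add: le_less_trans)
  qed
  have "(\<integral>\<^sup>+\<omega>. ennreal (walk_sup \<omega> ^ p) \<partial>S) \<le> (\<integral>\<^sup>+\<omega>. (SUP M. ennreal (lindley M \<omega> ^ p)) \<partial>S)"
    by (intro nn_integral_mono power_walk_sup_le p)
  then show "(\<integral>\<^sup>+\<omega>. ennreal (walk_sup \<omega> ^ p) \<partial>S) < \<infinity>"
    using SUPfin[of p] by (simp add: le_less_trans)
  have "AE \<omega> in S. (SUP M. ennreal (lindley M \<omega> ^ 1)) \<noteq> top"
    by (rule nn_integral_noteq_infinite[unfolded infinity_ennreal_def]) (use SUPfin[of 1] p in auto)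
  then show "AE \<omega> in S. \<forall>m. (\<Sum>l<m. \<omega> l) \<le> walk_sup \<omega>"
  proof eventually_elim
    case (elim \<omega>)
    then have "lindley m \<omega> \<le> walk_sup \<omega>" for m
      using incseq_le[OF incseq_lindley lindley_tendsto_walk_sup] by simp
    then show ?case using walk_le_lindley[of _ _ \<omega>] by (meson order_refl order_trans)
  qed
qed

section \<open>Uniformly small tails and stationarity\<close>

text \<open>For nonnegative \<open>G\<close> and \<open>P \<ge> 1\<close> this is uniform
  integrability of the powers \<open>G ^ P\<close>. The excess over \<open>K\<close> replaces the
  truncated integral because it is convex and monotone in \<open>G\<close>; only upper tails are
  controlled.\<close>

definition unif_tail ::
  "nat \<Rightarrow> 'i set \<Rightarrow> ('i \<Rightarrow> 'w measure) \<Rightarrow> ('i \<Rightarrow> 'w \<Rightarrow> real) \<Rightarrow> bool" where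
  "unif_tail P J M G \<longleftrightarrow>
     (\<forall>i\<in>J. G i \<in> borel_measurable (M i)) \<and>
     (\<forall>\<epsilon>>0. \<exists>K\<ge>0. \<forall>i\<in>J. (\<integral>\<^sup>+w. ennreal (max 0 (G i w - K) ^ P) \<partial>M i) \<le> ennreal \<epsilon>)"

lemma unif_tail_measurable: "unif_tail P J M G \<Longrightarrow> i \<in> J \<Longrightarrow> G i \<in> borel_measurable (M i)"
  unfolding unif_tail_def by blast

lemma unif_tailD:
  assumes "unif_tail P J M G" "\<epsilon> > 0"
  obtains K where "K \<ge> 0" "\<And>i. i \<in> J \<Longrightarrow> (\<integral>\<^sup>+w. ennreal (max 0 (G i w - K) ^ P) \<partial>M i) \<le> ennreal \<epsilon>"
  using assms unfolding unif_tail_def by blast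

lemma excess_mono:
  fixes x y K K' :: real
  assumes "x \<le> y" "K' \<le> K" shows "max 0 (x - K) ^ P \<le> max 0 (y - K') ^ P"
  by (intro power_mono) (use assms in auto)

lemma unif_tail_mono:
  assumes G: "unif_tail P J M G" and H: "\<And>i. i \<in> J \<Longrightarrow> H i \<in> borel_measurable (M i)"
    and le: "\<And>i. i \<in> J \<Longrightarrow> AE w in M i. H i w \<le> G i w"
  shows "unif_tail P J M H"
  unfolding unif_tail_def
proof (intro conjI ballI allI impI H)
  fix \<epsilon> :: real assume "\<epsilon> > 0"
  from unif_tailD[OF G this] obtain K where K: "K \<ge> 0"
    "\<And>i. i \<in> J \<Longrightarrow> (\<integral>\<^sup>+w. ennreal (max 0 (G i w - K) ^ P) \<partial>M i) \<le> ennreal \<epsilon>" by metis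
  have "(\<integral>\<^sup>+w. ennreal (max 0 (H i w - K) ^ P) \<partial>M i) \<le> ennreal \<epsilon>" if "i \<in> J" for i
  proof (rule order_trans[OF nn_integral_mono_AE K(2)[OF that]])
    show "AE w in M i. ennreal (max 0 (H i w - K) ^ P) \<le> ennreal (max 0 (G i w - K) ^ P)"
      using le[OF that] by eventually_elim (intro ennreal_leI excess_mono, auto)
  qed
  then show "\<exists>K\<ge>0. \<forall>i\<in>J. (\<integral>\<^sup>+w. ennreal (max 0 (H i w - K) ^ P) \<partial>M i) \<le> ennreal \<epsilon>"
    using K(1) by blast
qed

lemma unif_tail_add:
  assumes G: "unif_tail P J M G" and H: "unif_tail P J M H"
  shows "unif_tail P J M (\<lambda>i w. G i w + H i w)"
  unfolding unif_tail_def
proof (intro conjI ballI allI impI)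
  fix i assume "i \<in> J"
  from unif_tail_measurable[OF G this] unif_tail_measurable[OF H this]
  show "(\<lambda>w. G i w + H i w) \<in> borel_measurable (M i)" by simp
next
  fix \<epsilon> :: real assume \<epsilon>: "\<epsilon> > 0"
  \<comment> \<open>The excess of a sum over \<open>K1 + K2\<close> is at most twice the larger of
    the two excesses, which costs the factor \<open>2 ^ P\<close>; the remaining 2 splits \<epsilon>
    between the summands.\<close>
  define \<delta> where "\<delta> = \<epsilon> / 2 / 2 ^ P"
  have \<delta>: "\<delta> > 0" using \<epsilon> by (simp add: \<delta>_def)
  from unif_tailD[OF G \<delta>] obtain K1 where K1: "K1 \<ge> 0"
    "\<And>i. i \<in> J \<Longrightarrow> (\<integral>\<^sup>+w. ennreal (max 0 (G i w - K1) ^ P) \<partial>M i) \<le> ennreal \<delta>" by metis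
  from unif_tailD[OF H \<delta>] obtain K2 where K2: "K2 \<ge> 0"
    "\<And>i. i \<in> J \<Longrightarrow> (\<integral>\<^sup>+w. ennreal (max 0 (H i w - K2) ^ P) \<partial>M i) \<le> ennreal \<delta>" by metis
  have pw: "max 0 (x + y - (K1 + K2)) ^ P \<le> 2 ^ P * (max 0 (x - K1) ^ P + max 0 (y - K2) ^ P)" for x y :: real
  proof -
    have "max 0 (x + y - (K1 + K2)) ^ P \<le> (2 * max (max 0 (x - K1)) (max 0 (y - K2))) ^ P"
      by (rule power_mono) (auto simp: max_def)
    also have "\<dots> \<le> 2 ^ P * (max 0 (x - K1) ^ P + max 0 (y - K2) ^ P)"
      unfolding power_mult_distrib
      by (intro mult_left_mono) (auto simp: max_def[of "max 0 _" "max 0 _"])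
    finally show ?thesis .
  qed
  have "(\<integral>\<^sup>+w. ennreal (max 0 (G i w + H i w - (K1 + K2)) ^ P) \<partial>M i) \<le> ennreal \<epsilon>" if i: "i \<in> J" for i
  proof -
    note [measurable] = unif_tail_measurable[OF G i] unif_tail_measurable[OF H i]
    have "(\<integral>\<^sup>+w. ennreal (max 0 (G i w + H i w - (K1 + K2)) ^ P) \<partial>M i) \<le>
      (\<integral>\<^sup>+w. ennreal (2 ^ P) * (ennreal (max 0 (G i w - K1) ^ P) + ennreal (max 0 (H i w - K2) ^ P)) \<partial>M i)"
      using pw by (intro nn_integral_mono) (simp add: ennreal_plus[symmetric] ennreal_mult[symmetric] ennreal_leI del: ennreal_plus)
    also have "\<dots> = ennreal (2 ^ P) * ((\<integral>\<^sup>+w. ennreal (max 0 (G i w - K1) ^ P) \<partial>M i) + (\<integral>\<^sup>+w. ennreal (max 0 (H i w - K2) ^ P) \<partial>M i))"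
      by (subst nn_integral_cmult) (auto intro!: arg_cong[where f="(*) _"] nn_integral_add)
    also have "\<dots> \<le> ennreal (2 ^ P) * (ennreal \<delta> + ennreal \<delta>)"
      by (intro mult_left_mono add_mono K1 K2 i) auto
    also have "\<dots> = ennreal \<epsilon>"
      using \<delta> by (simp add: ennreal_plus[symmetric] ennreal_mult[symmetric] \<delta>_def del: ennreal_plus)
    finally show ?thesis .
  qed
  then show "\<exists>K\<ge>0. \<forall>i\<in>J. (\<integral>\<^sup>+w. ennreal (max 0 (G i w + H i w - K) ^ P) \<partial>M i) \<le> ennreal \<epsilon>"
    using K1(1) K2(1) by (intro exI[of _ "K1 + K2"]) auto
qed

lemma unif_tail_const: "P \<ge> 1 \<Longrightarrow> unif_tail P J M (\<lambda>_ _. c)"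
  unfolding unif_tail_def by (auto intro!: exI[of _ "max 0 c"] simp: power_0_left)

lemma unif_tail_sum:
  assumes "finite A" "P \<ge> 1" "\<And>a. a \<in> A \<Longrightarrow> unif_tail P J M (G a)"
  shows "unif_tail P J M (\<lambda>i w. \<Sum>a\<in>A. G a i w)"
  using assms(1,3) by (induction A) (auto intro: unif_tail_const[OF assms(2)] unif_tail_add)

lemma unif_tail_cmult:
  assumes G: "unif_tail P J M G" and c: "c \<ge> 0"
  shows "unif_tail P J M (\<lambda>i w. c * G i w)"
  unfolding unif_tail_def
proof (intro conjI ballI allI impI)
  fix i assume "i \<in> J"
  from unif_tail_measurable[OF G this] show "(\<lambda>w. c * G i w) \<in> borel_measurable (M i)" by simp
next
  fix \<epsilon> :: real assume \<epsilon>: "\<epsilon> > 0"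
  \<comment> \<open>The added 1 keeps the division legitimate when \<open>c = 0\<close>.\<close>
  have cP: "c ^ P + 1 > 0" using c by (simp add: add_nonneg_pos)
  then have "\<epsilon> / (c ^ P + 1) > 0" using \<epsilon> by simp
  from unif_tailD[OF G this] obtain K where K: "K \<ge> 0"
    "\<And>i. i \<in> J \<Longrightarrow> (\<integral>\<^sup>+w. ennreal (max 0 (G i w - K) ^ P) \<partial>M i) \<le> ennreal (\<epsilon> / (c ^ P + 1))" by metis
  have eq: "max 0 (c * x - c * K) ^ P = c ^ P * max 0 (x - K) ^ P" for x
  proof -
    have "max 0 (c * x - c * K) = c * max 0 (x - K)"
      using c by (auto simp: max_def right_diff_distrib[symmetric] zero_le_mult_iff mult_nonneg_nonpos)
    then show ?thesis by (simp add: power_mult_distrib)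
  qed
  have "(\<integral>\<^sup>+w. ennreal (max 0 (c * G i w - c * K) ^ P) \<partial>M i) \<le> ennreal \<epsilon>" if i: "i \<in> J" for i
  proof -
    note [measurable] = unif_tail_measurable[OF G i]
    have "(\<integral>\<^sup>+w. ennreal (max 0 (c * G i w - c * K) ^ P) \<partial>M i) =
      ennreal (c ^ P) * (\<integral>\<^sup>+w. ennreal (max 0 (G i w - K) ^ P) \<partial>M i)"
      using c by (simp add: eq ennreal_mult nn_integral_cmult)
    also have "\<dots> \<le> ennreal (c ^ P) * ennreal (\<epsilon> / (c ^ P + 1))"
      by (intro mult_left_mono K i) auto
    also have "\<dots> \<le> ennreal \<epsilon>"
      using c \<epsilon> cP by (auto simp: ennreal_mult[symmetric] field_simps intro!: ennreal_leI)
    finally show ?thesis .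
  qed
  then show "\<exists>K\<ge>0. \<forall>i\<in>J. (\<integral>\<^sup>+w. ennreal (max 0 (c * G i w - K) ^ P) \<partial>M i) \<le> ennreal \<epsilon>"
    using K(1) c by (intro exI[of _ "c * K"]) auto
qed

lemma excess_small:
  fixes Z :: "'w \<Rightarrow> real"
  assumes [measurable]: "Z \<in> borel_measurable M" and P: "P \<ge> 1"
    and fin: "(\<integral>\<^sup>+w. ennreal (\<bar>Z w\<bar> ^ P) \<partial>M) < \<infinity>" and \<epsilon>: "\<epsilon> > 0"
  shows "\<exists>K\<ge>0. (\<integral>\<^sup>+w. ennreal (max 0 (Z w - K) ^ P) \<partial>M) \<le> ennreal \<epsilon>"
proof -
  have "(\<lambda>n. \<integral>\<^sup>+w. ennreal (max 0 (Z w - real n) ^ P) \<partial>M) \<longlonglongrightarrow> (\<integral>\<^sup>+w. 0 \<partial>M)"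
  proof (rule nn_integral_dominated_convergence)
    show "AE w in M. ennreal (max 0 (Z w - real n) ^ P) \<le> ennreal (\<bar>Z w\<bar> ^ P)" for n
      by (intro AE_I2 ennreal_leI power_mono) auto
    show "AE w in M. (\<lambda>n. ennreal (max 0 (Z w - real n) ^ P)) \<longlonglongrightarrow> 0"
    proof (intro AE_I2 tendsto_eventually)
      fix w
      obtain N where N: "Z w < real N" using reals_Archimedean2 by blast
      show "\<forall>\<^sub>F n in sequentially. ennreal (max 0 (Z w - real n) ^ P) = 0"
        using eventually_ge_at_top[of N]
      proof eventually_elim
        case (elim n)
        then have "max 0 (Z w - real n) = 0" using N by simp
        then show ?case using P by (simp add: power_0_left)
      qed
    qed
  qed (use fin in auto)
  then have "eventually (\<lambda>n. (\<integral>\<^sup>+w. ennreal (max 0 (Z w - real n) ^ P) \<partial>M) < ennreal \<epsilon>) sequentially"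
    using \<epsilon> by (intro order_tendstoD(2)) auto
  then obtain n where "(\<integral>\<^sup>+w. ennreal (max 0 (Z w - real n) ^ P) \<partial>M) < ennreal \<epsilon>"
    by (auto simp: eventually_sequentially)
  then show ?thesis by (intro exI[of _ "real n"]) (auto intro: less_imp_le)
qed

lemma unif_tail_same_law:
  assumes Z: "\<And>i. i \<in> J \<Longrightarrow> Z i \<in> borel_measurable (M i)" and P: "P \<ge> 1"
    and law: "\<And>i. i \<in> J \<Longrightarrow> distr (M i) borel (Z i) = N"
    and fin: "(\<integral>\<^sup>+x. ennreal (\<bar>x\<bar> ^ P) \<partial>N) < \<infinity>"
  shows "unif_tail P J M Z"
  unfolding unif_tail_def
proof (intro conjI ballI allI impI Z)
  fix \<epsilon> :: real assume \<epsilon>: "\<epsilon> > 0"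
  show "\<exists>K\<ge>0. \<forall>i\<in>J. (\<integral>\<^sup>+w. ennreal (max 0 (Z i w - K) ^ P) \<partial>M i) \<le> ennreal \<epsilon>"
  proof (cases "J = {}")
    case False
    then have [measurable_cong]: "sets N = sets borel" using law by (metis ex_in_conv sets_distr)
    obtain K where K: "K \<ge> 0" "(\<integral>\<^sup>+x. ennreal (max 0 (x - K) ^ P) \<partial>N) \<le> ennreal \<epsilon>"
      using excess_small[OF _ P fin \<epsilon>] by auto
    have "(\<integral>\<^sup>+w. ennreal (max 0 (Z i w - K) ^ P) \<partial>M i) \<le> ennreal \<epsilon>" if i: "i \<in> J" for i
    proof -
      note [measurable] = Z[OF i]
      show ?thesis using K(2) unfolding law[OF i, symmetric] by (simp add: nn_integral_distr)
    qed
    then show ?thesis using K(1) by blast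
  qed auto
qed

text \<open>On the event that \<open>Z\<close> exceeds \<open>K\<close>, the additional power of
  \<open>\<bar>Z\<bar>\<close> supplies a factor \<open>1 / K\<close>, which is small uniformly in
  the index.\<close>

lemma unif_tail_moment:
  assumes Z: "\<And>i. i \<in> J \<Longrightarrow> Z i \<in> borel_measurable (M i)" and P: "P \<ge> 1"
    and bound: "\<And>i. i \<in> J \<Longrightarrow> (\<integral>\<^sup>+w. ennreal (\<bar>Z i w\<bar> ^ Suc P) \<partial>M i) \<le> ennreal B"
  shows "unif_tail P J M Z"
  unfolding unif_tail_def
proof (intro conjI ballI allI impI Z)
  fix \<epsilon> :: real assume \<epsilon>: "\<epsilon> > 0"
  define K where "K = (max 0 B + 1) / \<epsilon>"
  have K: "K > 0" unfolding K_def using \<epsilon> by (simp add: add_nonneg_pos)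
  have pw: "max 0 (x - K) ^ P \<le> 1 / K * \<bar>x\<bar> ^ Suc P" for x
  proof (cases "x \<le> K")
    case True
    then show ?thesis using K P by (simp add: max_def power_0_left)
  next
    case False
    then have "max 0 (x - K) ^ P \<le> x ^ P" using K by (intro power_mono) auto
    also have "\<dots> \<le> 1 / K * \<bar>x\<bar> ^ Suc P" using False K by (simp add: field_simps mult_right_mono)
    finally show ?thesis .
  qed
  have "(\<integral>\<^sup>+w. ennreal (max 0 (Z i w - K) ^ P) \<partial>M i) \<le> ennreal \<epsilon>" if i: "i \<in> J" for i
  proof -
    note [measurable] = Z[OF i]
    have "(\<integral>\<^sup>+w. ennreal (max 0 (Z i w - K) ^ P) \<partial>M i) \<le> (\<integral>\<^sup>+w. ennreal (1 / K) * ennreal (\<bar>Z i w\<bar> ^ Suc P) \<partial>M i)"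
      using pw K by (intro nn_integral_mono) (auto simp: ennreal_mult[symmetric] intro!: ennreal_leI)
    also have "\<dots> = ennreal (1 / K) * (\<integral>\<^sup>+w. ennreal (\<bar>Z i w\<bar> ^ Suc P) \<partial>M i)"
      by (rule nn_integral_cmult) measurable
    also have "\<dots> \<le> ennreal (1 / K) * ennreal (max 0 B)"
      by (intro mult_left_mono order_trans[OF bound[OF i]] ennreal_leI) auto
    also have "\<dots> \<le> ennreal \<epsilon>"
      using \<epsilon> K by (subst ennreal_mult[symmetric]) (auto simp: K_def divide_simps intro!: ennreal_leI)
    finally show ?thesis .
  qed
  then show "\<exists>K\<ge>0. \<forall>i\<in>J. (\<integral>\<^sup>+w. ennreal (max 0 (Z i w - K) ^ P) \<partial>M i) \<le> ennreal \<epsilon>"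
    using K by (intro exI[of _ K]) auto
qed

text \<open>No moment above \<open>P\<close> is required when the moments of order \<open>P\<close>
  themselves tend to 0: beyond some \<open>N\<close> they are below \<epsilon> already, and each of
  the finitely many smaller indices has a level of its own by dominated convergence.\<close>

lemma unif_tail_vanishing:
  fixes Z :: "nat \<Rightarrow> 'w \<Rightarrow> real"
  assumes Z: "\<And>n. n \<in> {1..} \<Longrightarrow> Z n \<in> borel_measurable (M n)" and P: "P \<ge> 1"
    and bound: "\<And>n. n \<in> {1..} \<Longrightarrow> (\<integral>\<^sup>+w. ennreal (\<bar>Z n w\<bar> ^ P) \<partial>M n) \<le> ennreal (C / real n)"
  shows "unif_tail P {1..} M Z"
  unfolding unif_tail_def
proof (intro conjI ballI allI impI Z)
  fix \<epsilon> :: real assume \<epsilon>: "\<epsilon> > 0"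
  obtain N :: nat where N: "C / \<epsilon> < real N" using reals_Archimedean2 by blast
  have "\<forall>n\<in>{1..N}. \<exists>K\<ge>0. (\<integral>\<^sup>+w. ennreal (max 0 (Z n w - K) ^ P) \<partial>M n) \<le> ennreal \<epsilon>"
    by (intro ballI excess_small Z P \<epsilon> le_less_trans[OF bound]) auto
  then obtain K where K: "\<And>n. n \<in> {1..N} \<Longrightarrow> K n \<ge> 0 \<and> (\<integral>\<^sup>+w. ennreal (max 0 (Z n w - K n) ^ P) \<partial>M n) \<le> ennreal \<epsilon>"
    by metis
  define K0 where "K0 = (\<Sum>n\<in>{1..N}. K n)"
  have K0: "K0 \<ge> 0" unfolding K0_def using K by (intro sum_nonneg) auto
  have "(\<integral>\<^sup>+w. ennreal (max 0 (Z n w - K0) ^ P) \<partial>M n) \<le> ennreal \<epsilon>" if n: "n \<in> {1..}" for n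
  proof (cases "n \<le> N")
    case True
    have "K n \<le> K0" unfolding K0_def using K n True by (intro member_le_sum) auto
    then have "(\<integral>\<^sup>+w. ennreal (max 0 (Z n w - K0) ^ P) \<partial>M n) \<le> (\<integral>\<^sup>+w. ennreal (max 0 (Z n w - K n) ^ P) \<partial>M n)"
      by (intro nn_integral_mono ennreal_leI excess_mono) auto
    also have "\<dots> \<le> ennreal \<epsilon>" using K[of n] n True by auto
    finally show ?thesis .
  next
    case False
    have "max 0 (x - K0) ^ P \<le> \<bar>x\<bar> ^ P" for x using K0 by (intro power_mono) auto
    then have "(\<integral>\<^sup>+w. ennreal (max 0 (Z n w - K0) ^ P) \<partial>M n) \<le> (\<integral>\<^sup>+w. ennreal (\<bar>Z n w\<bar> ^ P) \<partial>M n)"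
      by (intro nn_integral_mono ennreal_leI)
    also have "\<dots> \<le> ennreal (C / real n)" by (rule bound[OF n])
    also have "\<dots> \<le> ennreal \<epsilon>"
    proof (rule ennreal_leI)
      have "C < real N * \<epsilon>" using N \<epsilon> by (simp add: pos_divide_less_eq)
      also have "\<dots> \<le> real n * \<epsilon>" using False \<epsilon> by (intro mult_right_mono) auto
      finally show "C / real n \<le> \<epsilon>" using n by (simp add: pos_divide_le_eq mult.commute)
    qed
    finally show ?thesis .
  qed
  then show "\<exists>K\<ge>0. \<forall>i\<in>{1..}. (\<integral>\<^sup>+w. ennreal (max 0 (Z i w - K) ^ P) \<partial>M i) \<le> ennreal \<epsilon>"
    using K0 by blast
qed

lemma unif_tail_1_bound:
  assumes G: "unif_tail 1 J M G" and M: "\<And>i. i \<in> J \<Longrightarrow> prob_space (M i)"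
  shows "\<exists>B\<ge>0. \<forall>i\<in>J. (\<integral>\<^sup>+w. ennreal (G i w) \<partial>M i) \<le> ennreal B"
proof -
  from unif_tailD[OF G zero_less_one] obtain K where K: "K \<ge> 0"
    "\<And>i. i \<in> J \<Longrightarrow> (\<integral>\<^sup>+w. ennreal (max 0 (G i w - K) ^ 1) \<partial>M i) \<le> ennreal 1" by metis
  have "(\<integral>\<^sup>+w. ennreal (G i w) \<partial>M i) \<le> ennreal (K + 1)" if i: "i \<in> J" for i
  proof -
    note [measurable] = unif_tail_measurable[OF G i]
    have "(\<integral>\<^sup>+w. ennreal (G i w) \<partial>M i) \<le> (\<integral>\<^sup>+w. ennreal K + ennreal (max 0 (G i w - K) ^ 1) \<partial>M i)"
    proof (rule nn_integral_mono)
      fix w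
      have "G i w \<le> K + max 0 (G i w - K) ^ 1" by simp
      then show "ennreal (G i w) \<le> ennreal K + ennreal (max 0 (G i w - K) ^ 1)"
        using K(1) by (subst ennreal_plus[symmetric]) (auto intro: ennreal_leI simp del: ennreal_plus power_one_right)
    qed
    also have "\<dots> = ennreal K + (\<integral>\<^sup>+w. ennreal (max 0 (G i w - K) ^ 1) \<partial>M i)"
      by (subst nn_integral_add) (auto simp: prob_space.emeasure_space_1[OF M[OF i]])
    also have "\<dots> \<le> ennreal K + ennreal 1" by (intro add_left_mono K(2) i)
    finally show ?thesis using K(1) by simp
  qed
  then show ?thesis using K(1) by (intro exI[of _ "K + 1"]) auto
qed

text \<open>No moment of \<open>Y\<^sub>0\<close> is assumed: the truncated drift \<open>min Y\<^sub>0 m - min (\<gamma> Y\<^sub>0 + u) m\<close> has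
  nonpositive mean and is bounded below by \<open>-u\<close>, so Fatou's lemma applies.\<close>

lemma stationary_contraction:
  fixes Y0 Y1 u :: "'w \<Rightarrow> real"
  assumes "prob_space M"
    and [measurable]: "Y0 \<in> borel_measurable M" "Y1 \<in> borel_measurable M" "u \<in> borel_measurable M"
    and law: "distr M borel Y1 = distr M borel Y0"
    and Y0: "\<And>w. 0 \<le> Y0 w" and Y1: "\<And>w. 0 \<le> Y1 w" and u: "\<And>w. 0 \<le> u w"
    and fin: "(\<integral>\<^sup>+w. ennreal (u w) \<partial>M) < \<infinity>"
    and \<gamma>: "0 \<le> \<gamma>" "\<gamma> < 1"
    and contr: "AE w in M. Y1 w \<le> \<gamma> * Y0 w + u w"
  shows "ennreal (1 - \<gamma>) * (\<integral>\<^sup>+w. ennreal (Y0 w) \<partial>M) \<le> (\<integral>\<^sup>+w. ennreal (u w) \<partial>M)"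
proof -
  interpret prob_space M by fact
  define g where "g m w = min (Y0 w) (real m) - min (\<gamma> * Y0 w + u w) (real m) + u w" for m w
  have g0: "0 \<le> g m w" for m w
  proof -
    have "\<gamma> * Y0 w \<le> Y0 w" using \<gamma> Y0[of w] by (simp add: mult_left_le_one_le)
    then show ?thesis unfolding g_def using u[of w] by (auto simp: min_def)
  qed
  have [measurable]: "g m \<in> borel_measurable M" for m unfolding g_def by measurable
  have Eg: "(\<integral>\<^sup>+w. ennreal (g m w) \<partial>M) \<le> (\<integral>\<^sup>+w. ennreal (u w) \<partial>M)" for m
  proof -
    let ?a = "\<lambda>w. ennreal (min (\<gamma> * Y0 w + u w) (real m))"
    have nn: "0 \<le> min (\<gamma> * Y0 w + u w) (real m)" for w using \<gamma> Y0 u by simp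
    \<comment> \<open>Finiteness allows this truncated term to be added to both sides and cancelled
      at the end, so that no infinite quantities are subtracted.\<close>
    have afin: "(\<integral>\<^sup>+w. ?a w \<partial>M) \<noteq> top"
    proof -
      have "(\<integral>\<^sup>+w. ?a w \<partial>M) \<le> (\<integral>\<^sup>+w. ennreal (real m) \<partial>M)"
        by (intro nn_integral_mono ennreal_leI) simp
      also have "\<dots> < top" by (simp add: emeasure_space_1 ennreal_mult_less_top)
      finally show ?thesis by simp
    qed
    \<comment> \<open>The only use of stationarity: truncated means of \<open>Y0\<close> and
      \<open>Y1\<close> agree, whether or not the untruncated means are finite.\<close>
    have min0: "(\<integral>\<^sup>+w. ennreal (min (Y0 w) (real m)) \<partial>M) = (\<integral>\<^sup>+w. ennreal (min (Y1 w) (real m)) \<partial>M)"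
    proof -
      have "(\<integral>\<^sup>+x. ennreal (min x (real m)) \<partial>distr M borel Y0) = (\<integral>\<^sup>+x. ennreal (min x (real m)) \<partial>distr M borel Y1)"
        by (simp add: law)
      then show ?thesis by (simp add: nn_integral_distr)
    qed
    have "(\<integral>\<^sup>+w. ennreal (g m w) \<partial>M) + (\<integral>\<^sup>+w. ?a w \<partial>M) = (\<integral>\<^sup>+w. ennreal (g m w) + ?a w \<partial>M)"
      by (rule nn_integral_add[symmetric]) measurable
    also have "\<dots> = (\<integral>\<^sup>+w. ennreal (min (Y0 w) (real m)) + ennreal (u w) \<partial>M)"
    proof (rule nn_integral_cong)
      fix w
      show "ennreal (g m w) + ?a w = ennreal (min (Y0 w) (real m)) + ennreal (u w)"
        using g0[of m w] nn[of w] Y0[of w] u[of w]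
        by (simp add: ennreal_plus[symmetric] g_def del: ennreal_plus)
    qed
    also have "\<dots> = (\<integral>\<^sup>+w. ennreal (min (Y1 w) (real m)) \<partial>M) + (\<integral>\<^sup>+w. ennreal (u w) \<partial>M)"
      unfolding min0[symmetric] by (rule nn_integral_add) measurable
    also have "\<dots> \<le> (\<integral>\<^sup>+w. ?a w \<partial>M) + (\<integral>\<^sup>+w. ennreal (u w) \<partial>M)"
      using contr by (intro add_right_mono nn_integral_mono_AE) (auto elim!: eventually_mono intro!: ennreal_leI)
    finally have "(\<integral>\<^sup>+w. ?a w \<partial>M) + (\<integral>\<^sup>+w. ennreal (g m w) \<partial>M) \<le> (\<integral>\<^sup>+w. ?a w \<partial>M) + (\<integral>\<^sup>+w. ennreal (u w) \<partial>M)"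
      by (simp add: add.commute)
    then show ?thesis using afin by (simp add: ennreal_add_left_cancel_le)
  qed
  have lim: "liminf (\<lambda>m. ennreal (g m w)) = ennreal ((1 - \<gamma>) * Y0 w)" for w
  proof -
    obtain N where N: "Y0 w + u w < real N" using reals_Archimedean2 by blast
    have "\<forall>\<^sub>F m in sequentially. ennreal (g m w) = ennreal ((1 - \<gamma>) * Y0 w)"
      using eventually_ge_at_top[of N]
    proof eventually_elim
      case (elim m)
      have "\<gamma> * Y0 w \<le> Y0 w" using \<gamma> Y0[of w] by (simp add: mult_left_le_one_le)
      then have "min (Y0 w) (real m) = Y0 w" "min (\<gamma> * Y0 w + u w) (real m) = \<gamma> * Y0 w + u w"
        using N elim u[of w] by auto
      then have "g m w = (1 - \<gamma>) * Y0 w" by (simp add: g_def algebra_simps)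
      then show ?case by simp
    qed
    then show ?thesis by (intro lim_imp_Liminf) (auto intro: tendsto_eventually)
  qed
  have "ennreal (1 - \<gamma>) * (\<integral>\<^sup>+w. ennreal (Y0 w) \<partial>M) = (\<integral>\<^sup>+w. liminf (\<lambda>m. ennreal (g m w)) \<partial>M)"
    unfolding lim using \<gamma> Y0 by (simp add: ennreal_mult nn_integral_cmult)
  also have "\<dots> \<le> liminf (\<lambda>m. \<integral>\<^sup>+w. ennreal (g m w) \<partial>M)"
    by (rule nn_integral_liminf) measurable
  also have "\<dots> \<le> (\<integral>\<^sup>+w. ennreal (u w) \<partial>M)"
    by (rule order_trans[OF Liminf_mono[of _ "\<lambda>_. \<integral>\<^sup>+w. ennreal (u w) \<partial>M"]]) (auto simp: Eg Liminf_const)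
  finally show ?thesis .
qed

lemma convex_power: "convex_on {0::real..} (\<lambda>x. x ^ P)"
  using convex_power_odd[of P] convex_on_subset[OF convex_power_even[of P]] by (cases "even P") auto

text \<open>With \<open>V = U / (1 - \<gamma>)\<close> the hypothesis says that
  \<open>W1 - K\<close> is at most the convex combination of \<open>W0 - K\<close> and
  \<open>V - K\<close> with weights \<gamma> and \<open>1 - \<gamma>\<close>. Convexity of the
  excess power turns this into a contraction between powers, and
  \<open>stationary_contraction\<close> bounds the mean excess of \<open>W0\<close> by that of
  \<open>V\<close> at the same level \<open>K\<close>.\<close>

lemma unif_tail_stationary:
  assumes M: "\<And>i. i \<in> J \<Longrightarrow> prob_space (M i)"
    and W: "\<And>i. i \<in> J \<Longrightarrow> W0 i \<in> borel_measurable (M i)" "\<And>i. i \<in> J \<Longrightarrow> W1 i \<in> borel_measurable (M i)"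
    and law: "\<And>i. i \<in> J \<Longrightarrow> distr (M i) borel (W1 i) = distr (M i) borel (W0 i)"
    and U: "unif_tail P J M U" and \<gamma>: "0 \<le> \<gamma>" "\<gamma> < 1"
    and contr: "\<And>i. i \<in> J \<Longrightarrow> AE w in M i. W1 i w \<le> \<gamma> * W0 i w + U i w"
  shows "unif_tail P J M W0"
  unfolding unif_tail_def
proof (intro conjI ballI allI impI W)
  fix \<epsilon> :: real assume \<epsilon>: "\<epsilon> > 0"
  have "unif_tail P J M (\<lambda>i w. 1 / (1 - \<gamma>) * U i w)" (is "unif_tail P J M ?V")
    using \<gamma> by (intro unif_tail_cmult U) auto
  from unif_tailD[OF this \<epsilon>] obtain K where K: "K \<ge> 0"
    "\<And>i. i \<in> J \<Longrightarrow> (\<integral>\<^sup>+w. ennreal (max 0 (?V i w - K) ^ P) \<partial>M i) \<le> ennreal \<epsilon>" by metis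
  have "(\<integral>\<^sup>+w. ennreal (max 0 (W0 i w - K) ^ P) \<partial>M i) \<le> ennreal \<epsilon>" if i: "i \<in> J" for i
  proof -
    note [measurable] = W[OF i] unif_tail_measurable[OF U i]
    let ?u = "\<lambda>w. (1 - \<gamma>) * max 0 (?V i w - K) ^ P"
    have u: "(\<integral>\<^sup>+w. ennreal (?u w) \<partial>M i) = ennreal (1 - \<gamma>) * (\<integral>\<^sup>+w. ennreal (max 0 (?V i w - K) ^ P) \<partial>M i)"
      using \<gamma> by (simp add: ennreal_mult nn_integral_cmult)
    have "ennreal (1 - \<gamma>) * (\<integral>\<^sup>+w. ennreal (max 0 (W0 i w - K) ^ P) \<partial>M i) \<le> (\<integral>\<^sup>+w. ennreal (?u w) \<partial>M i)"
    proof (rule stationary_contraction[where ?Y1.0="\<lambda>w. max 0 (W1 i w - K) ^ P"])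
      have "distr (distr (M i) borel (W1 i)) borel (\<lambda>x. max 0 (x - K) ^ P) =
        distr (distr (M i) borel (W0 i)) borel (\<lambda>x. max 0 (x - K) ^ P)"
        by (simp add: law[OF i])
      then show "distr (M i) borel (\<lambda>w. max 0 (W1 i w - K) ^ P) = distr (M i) borel (\<lambda>w. max 0 (W0 i w - K) ^ P)"
        by (subst (asm) (1 2) distr_distr) (auto simp: comp_def)
      have "ennreal (1 - \<gamma>) * ennreal \<epsilon> < \<infinity>"
        using ennreal_mult_less_top by auto
      then show "(\<integral>\<^sup>+w. ennreal (?u w) \<partial>M i) < \<infinity>"
        unfolding u using K(2)[OF i] by (meson le_less_trans mult_left_mono zero_le)
      show "AE w in M i. max 0 (W1 i w - K) ^ P \<le> \<gamma> * max 0 (W0 i w - K) ^ P + ?u w"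
        using contr[OF i]
      proof eventually_elim
        case (elim w)
        let ?a = "max 0 (W0 i w - K)" and ?b = "max 0 (?V i w - K)"
        have "W1 i w - K \<le> \<gamma> * (W0 i w - K) + (1 - \<gamma>) * (?V i w - K)"
        proof -
          have "(1 - \<gamma>) * ?V i w = U i w" using \<gamma> by simp
          then have "\<gamma> * (W0 i w - K) + (1 - \<gamma>) * (?V i w - K) = \<gamma> * W0 i w + U i w - K"
            by (simp only: right_diff_distrib) (simp add: algebra_simps)
          then show ?thesis using elim by simp
        qed
        also have "\<dots> \<le> \<gamma> * ?a + (1 - \<gamma>) * ?b"
          using \<gamma> by (intro add_mono mult_left_mono) auto
        finally have "max 0 (W1 i w - K) \<le> \<gamma> * ?a + (1 - \<gamma>) * ?b"
          using \<gamma> by (simp add: add_nonneg_nonneg)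
        then have "max 0 (W1 i w - K) ^ P \<le> (\<gamma> * ?a + (1 - \<gamma>) * ?b) ^ P"
          by (intro power_mono) auto
        also have "\<dots> \<le> \<gamma> * ?a ^ P + (1 - \<gamma>) * ?b ^ P"
          using convex_onD[OF convex_power[of P], of "1 - \<gamma>" ?a ?b] \<gamma> by simp
        finally show ?case .
      qed
    qed (use \<gamma> M[OF i] in auto)
    also have "\<dots> \<le> ennreal (1 - \<gamma>) * ennreal \<epsilon>"
      unfolding u by (intro mult_left_mono K(2) i) auto
    finally show ?thesis using \<gamma>
      by (subst (asm) ennreal_mult_le_mult_iff) auto
  qed
  then show "\<exists>K\<ge>0. \<forall>i\<in>J. (\<integral>\<^sup>+w. ennreal (max 0 (W0 i w - K) ^ P) \<partial>M i) \<le> ennreal \<epsilon>"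
    using K(1) by blast
qed

lemma uniformly_integrable_if_unif_tail:
  assumes G: "unif_tail P J M G" and Z: "\<And>i. i \<in> J \<Longrightarrow> Z i \<in> borel_measurable (M i)"
    and C: "C \<ge> 0" and G0: "\<And>i. i \<in> J \<Longrightarrow> AE w in M i. 0 \<le> G i w"
    and le: "\<And>i. i \<in> J \<Longrightarrow> AE w in M i. \<bar>Z i w\<bar> \<le> C * G i w ^ P"
  shows "uniformly_integrable J M Z"
  unfolding uniformly_integrable_def
proof (intro conjI ballI Z)
  let ?S = "\<lambda>c::real. SUP i\<in>J. \<integral>\<^sup>+w. ennreal \<bar>Z i w\<bar> * indicator {w. \<bar>Z i w\<bar> > c} w \<partial>M i"
  show "(?S \<longlongrightarrow> 0) at_top"
  proof (rule order_tendstoI)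
    fix a :: ennreal assume "0 < a"
    then obtain b :: real where b: "0 < b" "ennreal b < a"
      by (metis dense ennreal_cases ennreal_less_zero_iff not_less_iff_gr_or_eq top.extremum_strict)
    define \<epsilon> where "\<epsilon> = b / (C * 2 ^ P + 1)"
    have den: "C * 2 ^ P + 1 > 0" using C by (simp add: add_nonneg_pos)
    have \<epsilon>: "\<epsilon> > 0" unfolding \<epsilon>_def using b den by simp
    from unif_tailD[OF G this] obtain K where K: "K \<ge> 0"
      "\<And>i. i \<in> J \<Longrightarrow> (\<integral>\<^sup>+w. ennreal (max 0 (G i w - K) ^ P) \<partial>M i) \<le> ennreal \<epsilon>" by metis
    \<comment> \<open>Above this threshold \<open>\<bar>Z\<bar> > c\<close> forces
      \<open>G > 2 * K\<close>, and there \<open>G \<le> 2 * (G - K)\<close>, so the excess controls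
      the full power \<open>G ^ P\<close>.\<close>
    have "?S c < a" if c: "c \<ge> C * (2 * K) ^ P" for c
    proof -
      have "(\<integral>\<^sup>+w. ennreal \<bar>Z i w\<bar> * indicator {w. \<bar>Z i w\<bar> > c} w \<partial>M i) \<le> ennreal b" if i: "i \<in> J" for i
      proof -
        note [measurable] = unif_tail_measurable[OF G i]
        have "(\<integral>\<^sup>+w. ennreal \<bar>Z i w\<bar> * indicator {w. \<bar>Z i w\<bar> > c} w \<partial>M i) \<le>
          (\<integral>\<^sup>+w. ennreal (C * 2 ^ P) * ennreal (max 0 (G i w - K) ^ P) \<partial>M i)"
        proof (rule nn_integral_mono_AE)
          show "AE w in M i. ennreal \<bar>Z i w\<bar> * indicator {w. \<bar>Z i w\<bar> > c} w \<le> ennreal (C * 2 ^ P) * ennreal (max 0 (G i w - K) ^ P)"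
            using le[OF i] G0[OF i]
          proof eventually_elim
            case (elim w)
            show ?case
            proof (cases "\<bar>Z i w\<bar> > c")
              case True
              have "G i w > 2 * K"
              proof (rule ccontr)
                assume "\<not> ?thesis"
                then have "C * G i w ^ P \<le> C * (2 * K) ^ P" using elim C by (intro mult_left_mono power_mono) auto
                then show False using True elim c by simp
              qed
              then have "G i w ^ P \<le> (2 * max 0 (G i w - K)) ^ P" using elim by (intro power_mono) auto
              then have "C * G i w ^ P \<le> C * 2 ^ P * max 0 (G i w - K) ^ P"
                using C by (simp add: power_mult_distrib mult_left_mono mult.assoc)
              then have "\<bar>Z i w\<bar> \<le> C * 2 ^ P * max 0 (G i w - K) ^ P" using elim by simp
              then show ?thesis using C True by (simp add: ennreal_mult[symmetric] ennreal_leI)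
            qed simp
          qed
        qed
        also have "\<dots> = ennreal (C * 2 ^ P) * (\<integral>\<^sup>+w. ennreal (max 0 (G i w - K) ^ P) \<partial>M i)"
          by (rule nn_integral_cmult) measurable
        also have "\<dots> \<le> ennreal (C * 2 ^ P) * ennreal \<epsilon>"
          by (intro mult_left_mono K(2) i) auto
        also have "\<dots> \<le> ennreal b"
          using C b \<epsilon> den by (subst ennreal_mult[symmetric]) (auto simp: \<epsilon>_def field_simps intro!: ennreal_leI)
        finally show ?thesis .
      qed
      then have "?S c \<le> ennreal b" by (rule SUP_least)
      then show ?thesis using b by simp
    qed
    then show "\<forall>\<^sub>F c in at_top. ?S c < a"
      by (rule eventually_mono[OF eventually_ge_at_top[of "C * (2 * K) ^ P"]])
  qed simp
qed

section \<open>Sample paths of the polling system\<close>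

text \<open>If \<open>m\<close> interarrival times last at least \<open>g * m - Z\<close>, at most
  \<open>(t + Z) / g\<close> arrivals fit into time \<open>t\<close>. Finiteness has to be stated as
  well, since \<open>arrivals\<close> is a \<open>card\<close> and would be 0 for an infinite
  set.\<close>

lemma
  fixes g Z t :: real
  assumes g: "g > 0" and dev: "\<And>m. g * real m \<le> (\<Sum>l<m. interarrival X k l w) + Z"
  shows finite_arrivals: "finite {m. (\<Sum>l\<le>m. interarrival X k l w) \<le> t}" (is "finite ?A")
    and arrivals_le: "0 \<le> t + Z \<Longrightarrow> real (arrivals X k t w) \<le> (t + Z) / g"
proof -
  have sub: "?A \<subseteq> {..<nat \<lfloor>(t + Z) / g\<rfloor>}"
  proof safe
    fix m assume m: "(\<Sum>l\<le>m. interarrival X k l w) \<le> t"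
    have "g * real (Suc m) \<le> t + Z"
      using dev[of "Suc m"] m by (simp add: lessThan_Suc_atMost)
    then have "real (Suc m) \<le> (t + Z) / g" using g by (simp add: field_simps)
    then have "int (Suc m) \<le> \<lfloor>(t + Z) / g\<rfloor>" by (simp add: le_floor_iff)
    then show "m < nat \<lfloor>(t + Z) / g\<rfloor>" by linarith
  qed
  then show fin: "finite ?A" by (rule finite_subset) simp
  show "real (arrivals X k t w) \<le> (t + Z) / g" if "0 \<le> t + Z"
  proof -
    have "arrivals X k t w \<le> nat \<lfloor>(t + Z) / g\<rfloor>"
      unfolding arrivals_def using card_mono[OF _ sub] by simp
    moreover have "real (nat \<lfloor>(t + Z) / g\<rfloor>) \<le> (t + Z) / g"
      using that g by (intro of_nat_floor) simp
    ultimately show ?thesis by linarith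
  qed
qed

text \<open>The conditions on a single sample path that make the recursion behave as intended; they
  hold almost surely. \<open>arrival_deviation\<close> bounds arrivals by a line of slope
  \<open>lam' k\<close>, and \<open>service_growth\<close> says that services are subcritical
  against this slope, so that busy periods end.\<close>

locale regular_path =
  fixes I :: nat and p :: "nat \<Rightarrow> 'k::finite" and X :: "('k, 'w) primitives" and w :: 'w
    and lam' :: "'k \<Rightarrow> real" and ZA :: "'k \<Rightarrow> real"
  assumes service_nonneg: "\<And>k l. service X k l w \<ge> 0"
    and switchover_nonneg: "\<And>j. switchover X j w \<ge> 0"
    and lam'_pos: "\<And>k. lam' k > 0" and ZA_nonneg: "\<And>k. ZA k \<ge> 0"
    and arrival_deviation:
      "\<And>k m. real m / lam' k \<le> (\<Sum>l<m. interarrival X k l w) + ZA k"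
    and service_growth:
      "\<And>k. \<exists>h Z. lam' k * h < 1 \<and> (\<forall>m. (\<Sum>l<m. service X k l w) \<le> h * real m + Z)"
begin

lemma arrivals_upper: "0 \<le> t \<Longrightarrow> real (arrivals X k t w) \<le> lam' k * (t + ZA k)"
  using arrivals_le[of "1 / lam' k" X k w "ZA k" t] arrival_deviation[of _ k] lam'_pos[of k] ZA_nonneg[of k]
  by (simp add: field_simps)

lemma arrivals_mono: "t \<le> u \<Longrightarrow> arrivals X k t w \<le> arrivals X k u w"
  unfolding arrivals_def
  by (intro card_mono finite_arrivals[of "1 / lam' k" _ _ _ "ZA k"])
     (use arrival_deviation[of _ k] lam'_pos[of k] in \<open>auto simp: field_simps\<close>)

lemma completion_time_mono:
  "m \<le> m' \<Longrightarrow> completion_time X k a c m w \<le> completion_time X k a c m' w"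
  unfolding completion_time_def by (auto intro!: sum_mono2 service_nonneg)

lemma num_selected_le: "num_selected X j k a c w \<le> found X k a c w"
  unfolding num_selected_def
  by (rule order_trans[OF card_mono[of "{..<found X k a c w}"]]) auto

lemma found_Suc:
  "found X k (completion_time X k a c m w) (c + m) w
     \<le> Suc (found X k (completion_time X k a c (Suc m) w) (c + Suc m) w)"
  using arrivals_mono[OF completion_time_mono[of m "Suc m" k a c], of k] unfolding found_def by simp

text \<open>With \<open>M = c + m\<close> services begun since time 0, at most
  \<open>B + lam' k * h * M\<close> customers can have been present or arrived, where
  \<open>B\<close> collects what does not grow with \<open>M\<close>. Since
  \<open>lam' k * h < 1\<close>, this falls below \<open>M\<close> eventually.\<close>

lemma found_eventually_0:
  assumes "0 \<le> a"
  shows "\<exists>m. found X k (completion_time X k a c m w) (c + m) w = 0"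
proof -
  obtain h Z where h: "lam' k * h < 1" and Z: "\<And>m. (\<Sum>l<m. service X k l w) \<le> h * real m + Z"
    using service_growth by blast
  define B where "B = real (init X w $ k) + lam' k * (a + Z + ZA k)"
  obtain m :: nat where m: "B / (1 - lam' k * h) < real m" using reals_Archimedean2 by blast
  define M where "M = c + m"
  have MB: "B + lam' k * h * real M \<le> real M"
  proof -
    have "B \<le> real m * (1 - lam' k * h)" using m h by (simp add: pos_divide_less_eq)
    also have "\<dots> \<le> real M * (1 - lam' k * h)"
      using h by (intro mult_right_mono) (auto simp: M_def)
    finally show ?thesis by (simp add: algebra_simps)
  qed
  let ?t = "completion_time X k a c m w"
  have "(\<Sum>l<m. service X k (c + l) w) = (\<Sum>l\<in>{c..<c + m}. service X k l w)"
    by (rule sum.reindex_bij_witness[of _ "\<lambda>l. l - c" "\<lambda>l. c + l"]) auto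
  also have "\<dots> \<le> (\<Sum>l<c + m. service X k l w)"
    by (intro sum_mono2 service_nonneg) auto
  also have "\<dots> \<le> h * real M + Z" using Z unfolding M_def .
  finally have t: "?t \<le> a + h * real M + Z" unfolding completion_time_def by simp
  have t0: "0 \<le> ?t" unfolding completion_time_def using assms by (auto intro!: add_nonneg_nonneg sum_nonneg service_nonneg)
  have "real (init X w $ k) + real (arrivals X k ?t w) \<le> real (init X w $ k) + lam' k * (?t + ZA k)"
    using arrivals_upper[OF t0] by simp
  also have "\<dots> \<le> real (init X w $ k) + lam' k * (a + h * real M + Z + ZA k)"
    using t lam'_pos[of k] by (auto intro!: mult_left_mono)
  also have "\<dots> = B + lam' k * h * real M" unfolding B_def by (simp add: algebra_simps)
  also have "\<dots> \<le> real M" by (rule MB)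
  finally have "init X w $ k + arrivals X k ?t w \<le> c + m" unfolding M_def by linarith
  then show ?thesis unfolding found_def by (intro exI[of _ m]) simp
qed

text \<open>The number of customers left falls by at most one per service, so it meets the target value
  exactly.\<close>

lemma num_services:
  fixes j :: nat
  assumes a: "0 \<le> a" and c: "c \<le> init X w $ k + arrivals X k a w"
  defines "m \<equiv> num_services X j k a c w"
  shows "found X k (completion_time X k a c m w) (c + m) w
      = found X k a c w - num_selected X j k a c w"
    and "num_selected X j k a c w \<le> m"
    and "c + m \<le> init X w $ k + arrivals X k (completion_time X k a c m w) w"
proof -
  let ?f = "\<lambda>m. found X k (completion_time X k a c m w) (c + m) w"
  let ?N = "found X k a c w" and ?Y = "num_selected X j k a c w"
  have f0: "?f 0 = ?N" by (simp add: completion_time_def)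
  have m_eq: "m = (LEAST m. ?f m = ?N - ?Y)" unfolding m_def num_services_def ..
  have fm: "?f m = ?N - ?Y" and before: "\<And>i. i < m \<Longrightarrow> ?f i > ?N - ?Y"
  proof -
    obtain m0 where "?f m0 = 0" using found_eventually_0[OF a] by blast
    then have ex: "\<exists>m. ?f m \<le> ?N - ?Y" by (intro exI[of _ m0]) simp
    define n where "n = (LEAST m. ?f m \<le> ?N - ?Y)"
    have n: "?f n \<le> ?N - ?Y" unfolding n_def using LeastI_ex[OF ex] .
    have lt: "?f i > ?N - ?Y" if "i < n" for i
      using not_less_Least[of i "\<lambda>m. ?f m \<le> ?N - ?Y"] that n_def by simp
    have "?f n = ?N - ?Y"
    proof (cases n)
      case 0
      then show ?thesis using n f0 num_selected_le[of j k a c] by (simp add: completion_time_def)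
    next
      case (Suc n')
      then show ?thesis using n found_Suc[of k a c n'] lt[of n'] unfolding Suc by linarith
    qed
    moreover from this have "m = n" unfolding m_eq
      by (intro Least_equality) (metis lt less_irrefl not_le)+
    ultimately show "?f m = ?N - ?Y" "\<And>i. i < m \<Longrightarrow> ?f i > ?N - ?Y" using lt by auto
  qed
  show "?f m = ?N - ?Y" by (rule fm)
  \<comment> \<open>At most one customer leaves per service, so reaching \<open>?N - ?Y\<close>
    takes at least \<open>?Y\<close> services.\<close>
  have low: "?N \<le> ?f i + i" for i
    by (induction i) (use f0 found_Suc[of k a c] in \<open>auto intro: order_trans\<close>)
  show "?Y \<le> m" using low[of m] fm num_selected_le[of j k a c] by linarith
  \<comment> \<open>Before the last service somebody was still present, so no service is spent on a
    missing customer. This keeps the truncated subtraction in \<open>found\<close> exact at later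
    epochs.\<close>
  show "c + m \<le> init X w $ k + arrivals X k (completion_time X k a c m w) w"
  proof (cases m)
    case 0
    then show ?thesis using c by (simp add: completion_time_def)
  next
    case (Suc m')
    have "?f m' > 0" using before[of m'] Suc by simp
    then show ?thesis
      using arrivals_mono[OF completion_time_mono[of m' m k a c], of k] Suc
      unfolding found_def by simp
  qed
qed

abbreviation "PE j \<equiv> polling_epoch I p X j w"
abbreviation "CB j k \<equiv> completed_before I p X j w $ k"
abbreviation "visit_services j \<equiv>
  num_services X j (p (j mod I)) (PE j) (CB j (p (j mod I))) w"

lemma PE_Suc:
  "PE (Suc j) = completion_time X (p (j mod I)) (PE j) (CB j (p (j mod I))) (visit_services j) w
     + switchover X j w"
  and CB_Suc: "CB (Suc j) k = (if k = p (j mod I) then CB j k + visit_services j else CB j k)"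
  by (simp_all add: polling_epoch_def completed_before_def Let_def split_beta)

lemma PE_0: "PE 0 = 0" and CB_0: "CB 0 k = 0"
  by (simp_all add: polling_epoch_def completed_before_def)

lemma sum_service_CB_Suc:
  "(\<Sum>k\<in>UNIV. \<Sum>l<CB (Suc j) k. service X k l w) =
     (\<Sum>k\<in>UNIV. \<Sum>l<CB j k. service X k l w) +
     (\<Sum>l<visit_services j. service X (p (j mod I)) (CB j (p (j mod I)) + l) w)"
proof -
  let ?k = "p (j mod I)"
  have *: "(\<Sum>l<c + m. service X k l w) = (\<Sum>l<c. service X k l w) + (\<Sum>l<m. service X k (c + l) w)"
    for c m k by (induction m) (auto simp: add.assoc)
  show ?thesis
    by (simp add: CB_Suc sum.remove[of UNIV ?k] *)
qed

text \<open>\<open>PE_eq\<close> expresses that the server is always either serving or switching, so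
  elapsed time equals switchovers plus completed work. \<open>CB_le\<close> is proved along the
  recursion because each visit ends properly only if it starts with a true queue length.\<close>

lemma invariants:
  shows PE_eq: "PE j = (\<Sum>i<j. switchover X i w) + (\<Sum>k\<in>UNIV. \<Sum>l<CB j k. service X k l w)"
    and CB_le: "CB j k \<le> init X w $ k + arrivals X k (PE j) w"
    and CB_Suc_ge: "CB j k \<le> CB (Suc j) k"
    and CB_selected: "CB j (p (j mod I)) + num_selected X j (p (j mod I)) (PE j) (CB j (p (j mod I))) w
      \<le> CB (Suc j) (p (j mod I))"
proof -
  have A: "PE j = (\<Sum>i<j. switchover X i w) + (\<Sum>k\<in>UNIV. \<Sum>l<CB j k. service X k l w)" for j
  proof (induction j)
    case (Suc j)
    show ?case unfolding sum_service_CB_Suc by (subst PE_Suc) (simp add: Suc completion_time_def)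
  qed (simp add: PE_0 CB_0)
  have A0: "0 \<le> PE j" for j
    unfolding A by (intro add_nonneg_nonneg sum_nonneg switchover_nonneg service_nonneg)
  have A1: "completion_time X k a c m w \<ge> a" for k a c m
    unfolding completion_time_def by (auto intro!: sum_nonneg service_nonneg)
  have A2: "PE j \<le> PE (Suc j)" for j
    unfolding PE_Suc by (intro add_increasing2 A1 switchover_nonneg)
  have B: "CB j k \<le> init X w $ k + arrivals X k (PE j) w" for j k
  proof (induction j)
    case (Suc j)
    show ?case
    proof (cases "k = p (j mod I)")
      case True
      let ?t = "completion_time X k (PE j) (CB j k) (visit_services j) w"
      have "CB j k + visit_services j \<le> init X w $ k + arrivals X k ?t w"
        using num_services(3)[OF A0 Suc] True by simp
      also have "arrivals X k ?t w \<le> arrivals X k (PE (Suc j)) w"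
        using True by (intro arrivals_mono) (simp add: PE_Suc switchover_nonneg)
      finally show ?thesis using True by (simp add: CB_Suc)
    next
      case False
      then show ?thesis using Suc arrivals_mono[OF A2, of k j] by (simp add: CB_Suc)
    qed
  qed (simp add: CB_0)
  show "PE j = (\<Sum>i<j. switchover X i w) + (\<Sum>k\<in>UNIV. \<Sum>l<CB j k. service X k l w)" by (rule A)
  show "CB j k \<le> init X w $ k + arrivals X k (PE j) w" by (rule B)
  show "CB j k \<le> CB (Suc j) k" by (simp add: CB_Suc)
  show "CB j (p (j mod I)) + num_selected X j (p (j mod I)) (PE j) (CB j (p (j mod I))) w
      \<le> CB (Suc j) (p (j mod I))"
    using num_services(2)[OF A0 B] by (simp add: CB_Suc)
qed

lemma PE_nonneg: "0 \<le> PE j"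
  unfolding PE_eq by (intro add_nonneg_nonneg sum_nonneg switchover_nonneg service_nonneg)

lemma CB_mono: "i \<le> j \<Longrightarrow> CB i k \<le> CB j k"
  by (rule lift_Suc_mono_le[of "\<lambda>j. CB j k"]) (rule CB_Suc_ge)

text \<open>An initial customer of queue \<open>k\<close> either has been replaced in the count by a
  service before visit \<open>i\<close>, or is still counted in \<open>found\<close> there and is
  selected with frequency at least \<theta> up to \<open>Z\<close>. As \<theta> is at most 1, both
  kinds contribute enough.\<close>

lemma CB_lower:
  assumes i: "i < j" "p (i mod I) = k" and \<theta>: "0 \<le> \<theta>" "\<theta> \<le> 1"
    and sel: "\<And>N. \<theta> * real N \<le> real (card {m. m < N \<and> selected X i m w}) + Z"
  shows "\<theta> * real (init X w $ k) \<le> real (CB j k) + Z"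
proof -
  let ?N = "found X k (PE i) (CB i k) w"
  have "\<theta> * real ?N \<le> real (num_selected X i k (PE i) (CB i k) w) + Z"
    unfolding num_selected_def by (rule sel)
  moreover have "real (CB i k) + real (num_selected X i k (PE i) (CB i k) w) \<le> real (CB j k)"
    using CB_selected[of i] CB_mono[of "Suc i" j k] i by simp
  moreover have "\<theta> * (real (init X w $ k) - real (CB i k)) \<le> \<theta> * real ?N"
    unfolding found_def by (intro mult_left_mono \<theta>) linarith
  moreover have "\<theta> * real (CB i k) \<le> real (CB i k)"
    using \<theta> by (simp add: mult_left_le_one_le)
  ultimately show ?thesis by (simp add: algebra_simps)
qed

lemma found_PE:
  "real (found X k (PE j) (CB j k) w) = real (init X w $ k) + real (arrivals X k (PE j) w) - real (CB j k)"
  using CB_le[of j k] unfolding found_def by simp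

text \<open>Work balance: a served customer removes weight \<open>u k\<close>, so the removed weight
  is at least the time spent serving up to \<open>E\<close>, that is, the epoch minus the
  switchovers. New weight enters at rate at most the sum of \<open>u k * lam' k\<close>. Eliminating
  the numbers of services leaves the net drift.\<close>

lemma cycle_drift:
  fixes u E :: "'k \<Rightarrow> real"
  assumes dev: "\<And>k. (\<Sum>l<CB j k. service X k l w) \<le> u k * real (CB j k) + E k"
    and u: "\<And>k. u k \<ge> 0"
  shows "(\<Sum>k\<in>UNIV. u k * real (found X k (PE j) (CB j k) w)) \<le>
    (\<Sum>k\<in>UNIV. u k * real (init X w $ k)) - (1 - (\<Sum>k\<in>UNIV. u k * lam' k)) * PE j
      + (\<Sum>i<j. switchover X i w) + (\<Sum>k\<in>UNIV. E k) + (\<Sum>k\<in>UNIV. u k * lam' k * ZA k)"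
proof -
  have "PE j \<le> (\<Sum>i<j. switchover X i w) + (\<Sum>k\<in>UNIV. u k * real (CB j k) + E k)"
    unfolding PE_eq[of j] by (intro add_left_mono sum_mono dev)
  moreover have "(\<Sum>k\<in>UNIV. u k * real (arrivals X k (PE j) w)) \<le> (\<Sum>k\<in>UNIV. u k * (lam' k * (PE j + ZA k)))"
    by (intro sum_mono mult_left_mono arrivals_upper PE_nonneg u)
  moreover have "(\<Sum>k\<in>UNIV. u k * (lam' k * (PE j + ZA k))) =
    (\<Sum>k\<in>UNIV. u k * lam' k) * PE j + (\<Sum>k\<in>UNIV. u k * lam' k * ZA k)"
    by (simp add: algebra_simps sum.distrib sum_distrib_left sum_distrib_right)
  ultimately show ?thesis
    unfolding found_PE by (simp add: algebra_simps sum.distrib sum_subtractf)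
qed

end

section \<open>Measurability and stopping of the service sequence\<close>

lemma measurable_nat_fun2:
  fixes f g :: "'a \<Rightarrow> nat"
  assumes f: "f \<in> measurable N (count_space UNIV)" and g: "g \<in> measurable N (count_space UNIV)"
  shows "(\<lambda>w. h (f w) (g w)) \<in> measurable N (count_space UNIV)"
proof (rule measurable_compose_countable[OF _ f])
  fix i show "(\<lambda>w. h i (g w)) \<in> measurable N (count_space UNIV)"
    by (rule measurable_compose[OF g]) simp
qed

text \<open>The measure space is a parameter, so the same measurability results serve the
  probability space and the smaller sigma-algebras in Wald's identity, on which only a cut system is
  measurable.\<close>

locale measurable_primitives =
  fixes N :: "'w measure" and X :: "('k::finite, 'w) primitives"
  assumes measurable_interarrival[measurable]: "\<And>k m. interarrival X k m \<in> borel_measurable N"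
    and measurable_service[measurable]: "\<And>k m. service X k m \<in> borel_measurable N"
    and measurable_switchover[measurable]: "\<And>j. switchover X j \<in> borel_measurable N"
    and measurable_selected[measurable]: "\<And>j m. selected X j m \<in> measurable N (count_space UNIV)"
    and measurable_init[measurable]: "init X \<in> measurable N (count_space UNIV)"
begin

lemma measurable_init_nth[measurable]: "(\<lambda>w. init X w $ k) \<in> measurable N (count_space UNIV)"
  by (rule measurable_compose[OF measurable_init]) simp

lemma measurable_arrivals[measurable (raw)]:
  assumes [measurable]: "t \<in> borel_measurable M'" "g \<in> measurable M' N"
  shows "(\<lambda>x. arrivals X k (t x) (g x)) \<in> measurable M' (count_space UNIV)"
  unfolding arrivals_def by (rule measurable_card) simp

lemma measurable_completion_time:
  assumes a: "a \<in> borel_measurable N" and c: "c \<in> measurable N (count_space UNIV)"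
    and m: "m \<in> measurable N (count_space UNIV)"
  shows "(\<lambda>w. completion_time X k (a w) (c w) (m w) w) \<in> borel_measurable N"
proof (rule measurable_compose_countable[OF _ m])
  fix i :: nat
  have "(\<lambda>w. service X k (c w + l) w) \<in> borel_measurable N" for l
    by (rule measurable_compose_countable[OF _ c, where f="\<lambda>i. service X k (i + l)"]) simp
  then show "(\<lambda>w. completion_time X k (a w) (c w) i w) \<in> borel_measurable N"
    unfolding completion_time_def using a by (intro borel_measurable_add borel_measurable_sum)
qed

lemma measurable_found:
  assumes [measurable]: "a \<in> borel_measurable N" "c \<in> measurable N (count_space UNIV)"
  shows "(\<lambda>w. found X k (a w) (c w) w) \<in> measurable N (count_space UNIV)"
  unfolding found_def by measurable

lemma measurable_num_selected:
  assumes a: "a \<in> borel_measurable N" and c: "c \<in> measurable N (count_space UNIV)"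
  shows "(\<lambda>w. num_selected X j k (a w) (c w) w) \<in> measurable N (count_space UNIV)"
proof -
  note [measurable] = measurable_found[OF a c]
  show ?thesis unfolding num_selected_def by (rule measurable_card) simp
qed

lemma measurable_num_services:
  assumes a: "a \<in> borel_measurable N" and c: "c \<in> measurable N (count_space UNIV)"
  shows "(\<lambda>w. num_services X j k (a w) (c w) w) \<in> measurable N (count_space UNIV)"
proof -
  define f where "f m w = found X k (completion_time X k (a w) (c w) m w) (c w + m) w" for m w
  define g where "g w = found X k (a w) (c w) w - num_selected X j k (a w) (c w) w" for w
  have "(\<lambda>w. c w + m) \<in> measurable N (count_space UNIV)" for m
    by (rule measurable_compose[OF c]) simp
  then have [measurable]: "f m \<in> measurable N (count_space UNIV)" for m
    unfolding f_def by (intro measurable_found measurable_completion_time a c) auto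
  have g: "g \<in> measurable N (count_space UNIV)"
    unfolding g_def by (rule measurable_nat_fun2) (intro measurable_found measurable_num_selected a c)+
  have "(\<lambda>w. f m w = g w) \<in> measurable N (count_space UNIV)" for m
    by (rule measurable_nat_fun2[OF _ g]) simp
  then have "(\<lambda>w. LEAST m. f m w = g w) \<in> measurable N (count_space UNIV)"
    by (rule measurable_Least)
  then show ?thesis unfolding num_services_def f_def g_def .
qed

lemma
  shows measurable_polling_epoch: "polling_epoch I p X j \<in> borel_measurable N"
    and measurable_completed_before:
      "(\<lambda>w. completed_before I p X j w $ k) \<in> measurable N (count_space UNIV)"
proof (induction j arbitrary: k)
  case 0
  { case 1 show ?case by (simp add: polling_epoch_def[abs_def])
  next case 2 show ?case by (simp add: completed_before_def) }
next
  case (Suc j)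
  note a = Suc(1) and c = Suc(2)
  let ?k = "p (j mod I)"
  note m = measurable_num_services[OF a c[of ?k], of j ?k]
  { case 1
    have "polling_epoch I p X (Suc j) = (\<lambda>w.
      completion_time X ?k (polling_epoch I p X j w) (completed_before I p X j w $ ?k)
        (num_services X j ?k (polling_epoch I p X j w) (completed_before I p X j w $ ?k) w) w + switchover X j w)"
      by (simp add: polling_epoch_def[abs_def] completed_before_def Let_def split_beta)
    then show ?case
      by (simp only:) (intro borel_measurable_add measurable_completion_time a c m measurable_switchover)
  next
    case 2
    have "(\<lambda>w. completed_before I p X (Suc j) w $ k) = (\<lambda>w. completed_before I p X j w $ k +
      (if k = ?k then num_services X j ?k (polling_epoch I p X j w) (completed_before I p X j w $ ?k) w else 0))"
      by (auto simp: polling_epoch_def completed_before_def Let_def split_beta)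
    moreover note [measurable] = c[of k] m
    ultimately show ?case by (simp only:) measurable }
qed

lemma measurable_embedded_chain_nth:
  "(\<lambda>w. embedded_chain I p L X m w $ k) \<in> measurable N (count_space UNIV)"
  unfolding embedded_chain_def Let_def vec_lambda_beta
  by (intro measurable_found measurable_polling_epoch measurable_completed_before)

lemma countable_nat_vec: "countable (UNIV :: (nat^'k) set)"
proof -
  have "countable (Pi\<^sub>E (UNIV :: 'k set) (\<lambda>_. UNIV :: nat set))"
    by (intro countable_PiE) auto
  then have "countable (range (vec_lambda :: ('k \<Rightarrow> nat) \<Rightarrow> nat^'k))"
    by (simp add: PiE_UNIV_domain)
  then show ?thesis by (metis surj_def vec_nth_inverse)
qed

lemma measurable_embedded_chain: "embedded_chain I p L X m \<in> measurable N (count_space UNIV)"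
proof -
  note [measurable] = measurable_embedded_chain_nth
  have "{w \<in> space N. \<forall>k. embedded_chain I p L X m w $ k = v $ k} \<in> sets N" for v
    by measurable
  moreover have "{w \<in> space N. \<forall>k. embedded_chain I p L X m w $ k = v $ k} =
    embedded_chain I p L X m -` {v} \<inter> space N" for v
    by (auto simp: vec_eq_iff)
  ultimately show ?thesis
    by (subst measurable_count_space_eq_countable[OF countable_nat_vec]) auto
qed

lemma measurable_completed:
  "(\<lambda>(t, w). completed I p X k t w) \<in> measurable (borel \<Otimes>\<^sub>M N) (count_space UNIV)"
proof -
  let ?a = "polling_epoch I p X" and ?c = "\<lambda>j w. completed_before I p X j w $ k"
  let ?P = "\<lambda>j m t w. p (j mod I) = k \<and> m < num_services X j k (?a j w) (?c j w) w \<and>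
    completion_time X k (?a j w) (?c j w) (Suc m) w \<le> t"
  have [measurable]: "(\<lambda>w. num_services X j k (?a j w) (?c j w) w) \<in> measurable N (count_space UNIV)"
    "(\<lambda>w. completion_time X k (?a j w) (?c j w) m w) \<in> borel_measurable N" for j m
    by (intro measurable_num_services measurable_completion_time measurable_polling_epoch
        measurable_completed_before measurable_const; simp)+
  \<comment> \<open>\<open>prod_decode\<close> numbers the pairs of visit and service, so that
    \<open>measurable_card\<close> applies to a random set of natural numbers.\<close>
  have eq: "completed I p X k t w = card {i. ?P (fst (prod_decode i)) (snd (prod_decode i)) t w}" for t w
  proof -
    have "{(j, m). ?P j m t w} = prod_decode ` {i. ?P (fst (prod_decode i)) (snd (prod_decode i)) t w}"
      (is "?A = _ ` ?B")
    proof (intro set_eqI iffI)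
      fix x assume "x \<in> ?A"
      then have "prod_encode x \<in> ?B" by (cases x) simp
      then show "x \<in> prod_decode ` ?B" by (intro image_eqI[of _ _ "prod_encode x"]) simp_all
    qed (auto simp: split_beta)
    then show ?thesis
      unfolding completed_def Let_def using card_image[OF inj_on_subset[OF inj_prod_decode subset_UNIV], of ?B]
      by simp
  qed
  show ?thesis unfolding eq split_beta by (rule measurable_card) measurable
qed

lemma measurable_scaled_queue:
  "(\<lambda>(u, w). scaled_queue I p n X u w $ k) \<in> borel_measurable (borel \<Otimes>\<^sub>M N)"
proof -
  have 1: "(\<lambda>x. (real n * fst x, snd x)) \<in> measurable (borel \<Otimes>\<^sub>M N) (borel \<Otimes>\<^sub>M N)"
    by measurable
  note [measurable] = measurable_compose[OF 1 measurable_completed[of I p k], simplified]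
  show ?thesis unfolding scaled_queue_def queue_def split_beta vec_lambda_beta by measurable
qed

text \<open>Joint measurability in path and time makes the integral over a random interval
  measurable. The cost is continuous on the orthant only, hence the detour through
  \<open>restrict_space\<close>.\<close>

lemma measurable_scaled_cycle_cost:
  assumes cont: "continuous_on {0..} \<psi>"
  shows "scaled_cycle_cost I p \<psi> L n X \<in> borel_measurable N"
proof -
  let ?q = "\<lambda>x. scaled_queue I p n X (snd x) (fst x)"
  have swap: "(\<lambda>x. (snd x, fst x)) \<in> measurable (N \<Otimes>\<^sub>M lborel) (borel \<Otimes>\<^sub>M N)"
    by measurable
  have "?q \<in> borel_measurable (N \<Otimes>\<^sub>M lborel)"
  proof (subst borel_measurable_euclidean_space, intro ballI)
    fix b :: "real^'k" assume "b \<in> Basis"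
    then obtain k where b: "b = axis k 1" by (auto simp: Basis_vec_def)
    show "(\<lambda>x. ?q x \<bullet> b) \<in> borel_measurable (N \<Otimes>\<^sub>M lborel)"
      unfolding b inner_axis using measurable_compose[OF swap measurable_scaled_queue[of I p n k]]
      by simp
  qed
  moreover have "?q x \<in> {0..}" for x
    by (auto simp: scaled_queue_def less_eq_vec_def)
  ultimately have "?q \<in> measurable (N \<Otimes>\<^sub>M lborel) (restrict_space borel {0..})"
    by (intro measurable_restrict_space2) auto
  from measurable_compose[OF this borel_measurable_continuous_on_restrict[OF cont]]
  have "(\<lambda>x. \<psi> (?q x)) \<in> borel_measurable (N \<Otimes>\<^sub>M lborel)" .
  note [measurable] = measurable_polling_epoch[of I p "I * L"]
  have "(\<lambda>(w, u). indicator {0..polling_epoch I p X (I * L) w / real n} u *\<^sub>R \<psi> (scaled_queue I p n X u w))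
      \<in> borel_measurable (N \<Otimes>\<^sub>M lborel)"
    unfolding split_beta
  proof (rule borel_measurable_scaleR)
    show "(\<lambda>x. indicator {0..polling_epoch I p X (I * L) (fst x) / real n} (snd x) :: real) \<in> borel_measurable (N \<Otimes>\<^sub>M lborel)"
      unfolding indicator_def atLeastAtMost_iff of_bool_def by measurable
  qed fact
  from lborel.borel_measurable_lebesgue_integral[OF this]
  show ?thesis unfolding scaled_cycle_cost_def[abs_def] set_lebesgue_integral_def by simp
qed

end

lemma (in binomial_exhaustive_system) measurable_primitives: "measurable_primitives (prob_sp X) X"
proof
  show "interarrival X k m \<in> borel_measurable (prob_sp X)" for k m
    using distributed_measurable[OF interarrival_law] by simp
qed (rule service_measurable switchover_measurable selected_measurable init_measurable)+

section \<open>Cut service sequences and the stopping property\<close>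

text \<open>Services with index at least \<open>m\<close> are cut to length 0. Before \<open>m\<close> class-\<open>k\<close> services have
  been completed, the path does not notice; hence the number of services per cycle is a stopping
  time for the service times.\<close>

definition cut_services :: "'k \<Rightarrow> nat \<Rightarrow> ('k::finite, 'w) primitives \<Rightarrow> ('k, 'w) primitives" where
  "cut_services k m X =
     X\<lparr>service := \<lambda>k' l. if k' = k \<and> m \<le> l then (\<lambda>_. 0) else service X k' l\<rparr>"

lemma cut_services_simps:
  "interarrival (cut_services k m X) = interarrival X" "switchover (cut_services k m X) = switchover X"
  "selected (cut_services k m X) = selected X" "init (cut_services k m X) = init X"
  "service (cut_services k m X) k' l = (if k' = k \<and> m \<le> l then (\<lambda>_. 0) else service X k' l)"
  by (simp_all add: cut_services_def)

lemma regular_path_cut_services: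
  assumes "regular_path X w lam' ZA"
  shows "regular_path (cut_services k m X) w lam' ZA"
proof -
  interpret regular_path I p X w lam' ZA for I p by fact
  show ?thesis
  proof
    fix k' show "\<exists>h Z. lam' k' * h < 1 \<and> (\<forall>j. (\<Sum>l<j. service (cut_services k m X) k' l w) \<le> h * real j + Z)"
    proof -
      obtain h Z where h: "lam' k' * h < 1" "\<And>j. (\<Sum>l<j. service X k' l w) \<le> h * real j + Z"
        using service_growth by blast
      have "(\<Sum>l<j. service (cut_services k m X) k' l w) \<le> (\<Sum>l<j. service X k' l w)" for j
        by (intro sum_mono) (auto simp: cut_services_simps service_nonneg)
      then show ?thesis using h by (meson order_trans)
    qed
  qed (auto simp: cut_services_simps service_nonneg switchover_nonneg lam'_pos ZA_nonneg arrival_deviation)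
qed

text \<open>The equality holds only where the visits end, because the \<open>LEAST\<close> in the definition of
  the number of services is arbitrary otherwise.\<close>

lemma polling_state_agree:
  fixes X X' :: "('k::finite, 'w) primitives"
  assumes path: "regular_path X w lam' ZA"
    and agree: "interarrival X' = interarrival X" "switchover X' = switchover X"
      "selected X' = selected X" "init X' = init X"
      "\<And>k' l. k' \<noteq> k \<or> l < m \<Longrightarrow> service X' k' l = service X k' l"
    and le: "completed_before I p X j w $ k \<le> m"
  shows "polling_state I p X' j w = polling_state I p X j w"
  using le
proof (induction j)
  case (Suc j)
  interpret regular_path I p X w lam' ZA by fact
  let ?k = "p (j mod I)"
  have "CB j k \<le> m" using CB_Suc_ge[of j k] Suc.prems by simp
  from Suc.IH[OF this] have IH: "polling_state I p X' j w = polling_state I p X j w" .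
  define a where "a = PE j"
  define c where "c = CB j ?k"
  let ?ns = "num_services X j ?k a c w"
  have found: "found X' k' t c w = found X k' t c w" for k' t c
    by (simp add: found_def arrivals_def agree)
  have sel: "num_selected X' j ?k a c w = num_selected X j ?k a c w"
    by (simp add: num_selected_def found agree)
  \<comment> \<open>A visit after which the class-\<open>k\<close> count is at most \<open>m\<close>
    consumes only services with index below \<open>m\<close>, where both systems agree. Indices
    beyond \<open>?ns\<close> are deliberately not compared.\<close>
  have ct: "completion_time X' ?k a c i w = completion_time X ?k a c i w" if i: "i \<le> ?ns" for i
  proof -
    have "service X' ?k (c + l) = service X ?k (c + l)" if "l < i" for l
    proof (rule agree(5))
      show "?k \<noteq> k \<or> c + l < m"
        using Suc.prems CB_Suc[of j k] i that by (auto simp: c_def a_def)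
    qed
    then show ?thesis unfolding completion_time_def by (intro arg_cong2[where f="(+)"] sum.cong) auto
  qed
  have "num_services X' j ?k a c w = ?ns"
    unfolding num_services_def[of X']
  proof (rule Least_equality)
    show "found X' ?k (completion_time X' ?k a c ?ns w) (c + ?ns) w = found X' ?k a c w - num_selected X' j ?k a c w"
      using num_services(1)[where j=j and k="?k" and a="PE j" and c="CB j ?k", OF PE_nonneg CB_le, folded c_def a_def] by (simp add: ct found sel)
    fix i assume i: "found X' ?k (completion_time X' ?k a c i w) (c + i) w = found X' ?k a c w - num_selected X' j ?k a c w"
    show "?ns \<le> i"
    proof (rule ccontr)
      assume "\<not> ?ns \<le> i"
      then have "i < ?ns" "completion_time X' ?k a c i w = completion_time X ?k a c i w" using ct by auto
      then show False using i not_less_Least[of i "\<lambda>m. found X ?k (completion_time X ?k a c m w) (c + m) w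
        = found X ?k a c w - num_selected X j ?k a c w"]
        by (simp add: found sel num_services_def)
    qed
  qed
  then have "num_services X' j ?k a (CB j ?k) w = num_services X j ?k a (CB j ?k) w"
    "completion_time X' ?k a (CB j ?k) (num_services X j ?k a (CB j ?k) w) w =
      completion_time X ?k a (CB j ?k) (num_services X j ?k a (CB j ?k) w) w"
    using ct[of ?ns] by (simp_all add: c_def)
  moreover have "polling_state I p X j w = (a, completed_before I p X j w)"
    by (simp add: a_def polling_epoch_def completed_before_def)
  ultimately show ?case
    by (simp add: IH Let_def agree(2) cong: if_cong)
qed simp

text \<open>Both directions are \<open>polling_state_agree\<close>, with the original and the cut
  path exchanged; the cut path is regular too, since it has shorter services. Hence the event of
  more than \<open>m\<close> services is decided by the services with index below
  \<open>m\<close>.\<close>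

lemma completed_before_cut_services:
  assumes path: "regular_path X w lam' ZA"
  shows "completed_before I p (cut_services k m X) j w $ k \<le> m \<longleftrightarrow> completed_before I p X j w $ k \<le> m"
proof -
  have 1: "completed_before I p X j w $ k \<le> m \<Longrightarrow>
    polling_state I p (cut_services k m X) j w = polling_state I p X j w"
    by (rule polling_state_agree[OF path]) (auto simp: cut_services_simps)
  have 2: "completed_before I p (cut_services k m X) j w $ k \<le> m \<Longrightarrow>
    polling_state I p X j w = polling_state I p (cut_services k m X) j w"
    by (rule polling_state_agree[OF regular_path_cut_services[OF path]]) (auto simp: cut_services_simps)
  show ?thesis using 1 2 by (auto simp: completed_before_def)
qed

section \<open>Independence and Wald's identity\<close>

definition source_sets :: "('k::finite, 'w) primitives \<Rightarrow> 'k source \<Rightarrow> 'w set set" where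
  "source_sets X z = (case z of
      Interarrival k m \<Rightarrow> sets (vimage_algebra (space (prob_sp X)) (interarrival X k m) borel)
    | Service k m \<Rightarrow> sets (vimage_algebra (space (prob_sp X)) (service X k m) borel)
    | Switchover j \<Rightarrow> sets (vimage_algebra (space (prob_sp X)) (switchover X j) borel)
    | Selection j m \<Rightarrow>
        sets (vimage_algebra (space (prob_sp X)) (selected X j m) (count_space UNIV))
    | Initial \<Rightarrow> sets (vimage_algebra (space (prob_sp X)) (init X) (count_space UNIV)))"

lemma (in prob_space) indep_sets_reindex:
  assumes indep: "indep_sets F UNIV" and inj: "inj z"
  shows "indep_sets (\<lambda>l. F (z l)) UNIV"
proof (rule indep_setsI)
  show "F (z i) \<subseteq> events" for i using indep by (auto simp: indep_sets_def)
  fix A J assume J: "J \<noteq> {}" "finite J" "\<forall>j\<in>J. A j \<in> F (z j)"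
  have eq: "A (inv z (z j)) = A j" for j using inj by simp
  have "prob (\<Inter>i\<in>z ` J. A (inv z i)) = (\<Prod>i\<in>z ` J. prob (A (inv z i)))"
    using J inj by (intro indep_setsD[OF indep]) (auto simp: eq)
  then show "prob (\<Inter>j\<in>J. A j) = (\<Prod>j\<in>J. prob (A j))"
    using inj by (simp add: prod.reindex inj_on_subset[OF inj] eq)
qed

lemma (in prob_space) indep_vars_if_indep_sets:
  assumes indep: "indep_sets F UNIV" and inj: "inj z"
    and F: "\<And>l. F (z l) = sets (vimage_algebra (space M) (V l) N)"
    and V: "\<And>l. random_variable N (V l)"
  shows "indep_vars (\<lambda>_. N) V UNIV"
proof -
  have "F (z l) = {V l -` A \<inter> space M | A. A \<in> sets N}" for l
    unfolding F using measurable_space[OF V] by (intro sets_vimage_algebra2) auto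
  with indep_sets_reindex[OF indep inj] show ?thesis
    unfolding indep_vars_def2 using V by simp
qed

text \<open>Disjoint groups of independent generators stay independent after passing to the
  generated sigma-algebras. In use, one service time stands against everything that precedes it in
  its own sequence and all other sources.\<close>

lemma (in prob_space) indep_var_if_sigma:
  assumes indep: "indep_sets E UNIV" and stable: "\<And>i. Int_stable (E i)" and AB: "A \<inter> B = {}"
    and Y: "Y \<in> measurable (sigma (space M) (\<Union>i\<in>A. E i)) S"
    and Z: "Z \<in> measurable (sigma (space M) (\<Union>i\<in>B. E i)) T"
  shows "indep_var S Y T Z"
proof -
  have E: "E i \<subseteq> events" for i using indep by (auto simp: indep_sets_def)
  have sub: "(\<Union>i\<in>C. E i) \<subseteq> Pow (space M)" for C using E sets.space_closed[of M] by blast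
  have sub': "sigma_sets (space M) (\<Union>i\<in>C. E i) \<subseteq> events" for C
    using E by (intro sets.sigma_sets_subset) auto
  have rv: "f \<in> measurable M R" if f: "f \<in> measurable (sigma (space M) (\<Union>i\<in>C. E i)) R" for f C and R :: "'d measure"
    by (rule measurable_from_subalg[OF _ f])
      (use sub' in \<open>auto simp: subalgebra_def space_measure_of[OF sub] sets_measure_of[OF sub]\<close>)
  have gen: "sigma_sets (space M) {f -` D \<inter> space M | D. D \<in> sets R} \<subseteq> sigma_sets (space M) (\<Union>i\<in>C. E i)"
    if f: "f \<in> measurable (sigma (space M) (\<Union>i\<in>C. E i)) R" for f C and R :: "'d measure"
  proof (rule sigma_sets_mono)
    show "{f -` D \<inter> space M | D. D \<in> sets R} \<subseteq> sigma_sets (space M) (\<Union>i\<in>C. E i)"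
      using measurable_sets[OF f] by (auto simp: space_measure_of[OF sub] sets_measure_of[OF sub])
  qed
  have "indep_sets (\<lambda>b. sigma_sets (space M) (\<Union>i\<in>case_bool A B b. E i)) UNIV"
  proof (rule indep_sets_collect_sigma)
    show "indep_sets E (\<Union>b\<in>UNIV. case_bool A B b)" by (rule indep_sets_mono_index[OF _ indep]) auto
    show "disjoint_family_on (case_bool A B) UNIV"
      using AB by (auto simp: disjoint_family_on_def split: bool.splits)
  qed (rule stable)
  then have ind: "indep_set (sigma_sets (space M) (\<Union>i\<in>A. E i)) (sigma_sets (space M) (\<Union>i\<in>B. E i))"
    unfolding indep_set_def
    by (rule indep_sets_mono_sets) (auto split: bool.splits)
  have "indep_set (sigma_sets (space M) {Y -` D \<inter> space M | D. D \<in> sets S})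
      (sigma_sets (space M) {Z -` D \<inter> space M | D. D \<in> sets T})"
    using ind unfolding indep_set_def
    by (rule indep_sets_mono_sets) (use gen[OF Y] gen[OF Z] in \<open>auto split: bool.splits\<close>)
  then show ?thesis unfolding indep_var_eq using rv[OF Y] rv[OF Z] by blast
qed

lemma (in prob_space) distr_iid_sequence:
  fixes \<xi> :: "nat \<Rightarrow> 'a \<Rightarrow> real"
  assumes "indep_vars (\<lambda>_. borel) \<xi> UNIV" and "\<And>l. distr M borel (\<xi> l) = \<nu>"
  shows "distr M (PiM UNIV (\<lambda>_. borel)) (\<lambda>w l. \<xi> l w) = PiM UNIV (\<lambda>_. \<nu>)"
  using assms indep_vars_iff_distr_eq_PiM'[of UNIV \<xi> "\<lambda>_. borel"]
  by (auto simp: indep_vars_def restrict_UNIV)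

lemma (in prob_space)
  fixes \<xi> :: "nat \<Rightarrow> 'a \<Rightarrow> real"
  assumes indep: "indep_vars (\<lambda>_. borel) \<xi> UNIV" and law: "\<And>l. distr M borel (\<xi> l) = \<nu>"
  shows measurable_walk_sup_sequence: "(\<lambda>w. walk_sup (\<lambda>l. \<xi> l w)) \<in> borel_measurable M"
    and distr_walk_sup_sequence: "distr M borel (\<lambda>w. walk_sup (\<lambda>l. \<xi> l w)) =
      distr (PiM UNIV (\<lambda>_. \<nu>)) borel walk_sup"
    and AE_le_walk_sup_sequence: "integrable \<nu> (\<lambda>x. x\<^sup>2) \<Longrightarrow> (\<integral>x. x \<partial>\<nu>) < 0 \<Longrightarrow>
      AE w in M. \<forall>m. (\<Sum>l<m. \<xi> l w) \<le> walk_sup (\<lambda>l. \<xi> l w)"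
proof -
  have seq: "(\<lambda>w l. \<xi> l w) \<in> measurable M (PiM UNIV (\<lambda>_. borel))"
    using indep by (intro measurable_PiM_single') (auto simp: indep_vars_def)
  note eq = distr_iid_sequence[OF indep law]
  show "(\<lambda>w. walk_sup (\<lambda>l. \<xi> l w)) \<in> borel_measurable M"
    using measurable_compose[OF seq measurable_walk_sup] .
  show "distr M borel (\<lambda>w. walk_sup (\<lambda>l. \<xi> l w)) = distr (PiM UNIV (\<lambda>_. \<nu>)) borel walk_sup"
    unfolding eq[symmetric] by (subst distr_distr[OF measurable_walk_sup seq]) (simp add: comp_def)
  show "AE w in M. \<forall>m. (\<Sum>l<m. \<xi> l w) \<le> walk_sup (\<lambda>l. \<xi> l w)"
    if sq: "integrable \<nu> (\<lambda>x. x\<^sup>2)" and neg: "(\<integral>x. x \<partial>\<nu>) < 0"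
  proof -
    have "real_distribution \<nu>"
      using indep law[of 0] by (auto simp: indep_vars_def intro!: real_distribution_distr)
    moreover have "(\<lambda>x::real. \<bar>x\<bar> ^ Suc 1) = power2" by (simp add: fun_eq_iff power2_eq_square)
    then have "integrable \<nu> (\<lambda>x. \<bar>x\<bar> ^ Suc 1)" using sq by simp
    ultimately have "AE \<omega> in PiM UNIV (\<lambda>_. \<nu>). \<forall>m. (\<Sum>l<m. \<omega> l) \<le> walk_sup \<omega>"
      using neg by (intro AE_le_walk_sup[where p=1]) auto
    then show ?thesis unfolding eq[symmetric] by (rule AE_distrD[OF seq])
  qed
qed

text \<open>The supremum is a function of an i.i.d. sequence whose law is the same for all members
  of the family, so one finite moment is automatically uniform.\<close>

lemma unif_tail_walk_sup:
  fixes \<xi> :: "'i \<Rightarrow> nat \<Rightarrow> 'w \<Rightarrow> real"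
  assumes M: "\<And>i. i \<in> J \<Longrightarrow> prob_space (M i)"
    and indep: "\<And>i. i \<in> J \<Longrightarrow> prob_space.indep_vars (M i) (\<lambda>_. borel) (\<xi> i) UNIV"
    and law: "\<And>i l. i \<in> J \<Longrightarrow> distr (M i) borel (\<xi> i l) = \<nu>"
    and mom: "integrable \<nu> (\<lambda>x. \<bar>x\<bar> ^ Suc P)" and neg: "(\<integral>x. x \<partial>\<nu>) < 0" and P: "P \<ge> 1"
  shows "unif_tail P J M (\<lambda>i w. walk_sup (\<lambda>l. \<xi> i l w))"
proof (cases "J = {}")
  case False
  then obtain i0 where i0: "i0 \<in> J" by blast
  have "\<xi> i0 0 \<in> borel_measurable (M i0)"
    using indep[OF i0] by (auto simp: prob_space.indep_vars_def[OF M[OF i0]])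
  then have "real_distribution \<nu>"
    using prob_space.real_distribution_distr[OF M[OF i0], of "\<xi> i0 0"] law[OF i0] by auto
  from nn_integral_power_walk_sup[OF this mom neg P]
  have "(\<integral>\<^sup>+\<omega>. ennreal (walk_sup \<omega> ^ P) \<partial>PiM UNIV (\<lambda>_. \<nu>)) < \<infinity>" .
  moreover have "walk_sup \<in> borel_measurable (PiM UNIV (\<lambda>_. \<nu>))"
  proof -
    have s: "sets \<nu> = sets borel" using \<open>real_distribution \<nu>\<close> by (simp add: real_distribution.events_eq_borel)
    have "sets (PiM UNIV (\<lambda>_. \<nu>)) = sets (PiM (UNIV :: nat set) (\<lambda>_. borel))" by (intro sets_PiM_cong) (simp_all add: s)
    then show ?thesis using measurable_walk_sup measurable_cong_sets by blast
  qed
  ultimately have "(\<integral>\<^sup>+x. ennreal (\<bar>x\<bar> ^ P) \<partial>distr (PiM UNIV (\<lambda>_. \<nu>)) borel walk_sup) < \<infinity>"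
    by (simp add: nn_integral_distr walk_sup_nonneg)
  note fin = this
  show ?thesis
  proof (rule unif_tail_same_law[OF _ P _ fin])
    fix i assume i: "i \<in> J"
    show "(\<lambda>w. walk_sup (\<lambda>l. \<xi> i l w)) \<in> borel_measurable (M i)"
      by (rule prob_space.measurable_walk_sup_sequence[OF M[OF i] indep[OF i] law[OF i]])
    show "distr (M i) borel (\<lambda>w. walk_sup (\<lambda>l. \<xi> i l w)) = distr (PiM UNIV (\<lambda>_. \<nu>)) borel walk_sup"
      by (rule prob_space.distr_walk_sup_sequence[OF M[OF i] indep[OF i] law[OF i]])
  qed
qed (auto simp: unif_tail_def)

text \<open>The sigma-algebra \<open>G m\<close> carries the past up to
  step \<open>m\<close>, where \<open>\<tau>\<close> is a stopping time up to null sets.\<close>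

lemma (in prob_space) wald_second_moment:
  fixes Y :: "nat \<Rightarrow> 'a \<Rightarrow> real" and \<tau> :: "'a \<Rightarrow> nat" and G :: "nat \<Rightarrow> 'a measure"
  assumes Y: "\<And>l. random_variable borel (Y l)" and \<tau>: "random_variable (count_space UNIV) \<tau>"
    and sq: "\<And>l. integrable M (\<lambda>w. (Y l w)\<^sup>2)" and mean: "\<And>l. expectation (Y l) = 0"
    and var: "\<And>l. expectation (\<lambda>w. (Y l w)\<^sup>2) = v"
    and past: "\<And>l m. l < m \<Longrightarrow> Y l \<in> borel_measurable (G m)"
    and B: "\<And>m. Measurable.pred (G m) (B m)"
    and B_eq: "\<And>m. AE w in M. B m w \<longleftrightarrow> m < \<tau> w"
    and indep: "\<And>m f. f \<in> borel_measurable (G m) \<Longrightarrow> indep_var borel (Y m) borel f"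
  shows "(\<integral>\<^sup>+w. ennreal ((\<Sum>l<\<tau> w. Y l w)\<^sup>2) \<partial>M) \<le> ennreal v * (\<integral>\<^sup>+w. ennreal (real (\<tau> w)) \<partial>M)"
proof -
  note [measurable] = Y \<tau>
  have v: "v \<ge> 0" using var[of 0] by (metis integral_nonneg_AE AE_I2 zero_le_power2)
  have intY: "integrable M (Y l)" for l
    by (rule square_integrable_imp_integrable[OF Y sq])
  \<comment> \<open>\<open>R m\<close> is the sum stopped at \<tau> and truncated at
    \<open>m\<close>. Its summands need not be \<open>G m\<close>-measurable, so the unstopped sum
    \<open>D m\<close> and the version \<open>b m\<close> of the indicator of
    \<open>m < \<tau>\<close> replace it; on that event \<open>R m\<close> and \<open>D m\<close>
    coincide.\<close>
  define R where "R m w = (\<Sum>l<m. of_bool (l < \<tau> w) * Y l w)" for m w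
  have [measurable]: "R m \<in> borel_measurable M" for m unfolding R_def by measurable
  define b where "b m w = (of_bool (B m w) :: real)" for m w
  define D where "D m w = (\<Sum>l<m. Y l w)" for m w
  have bG: "b m \<in> borel_measurable (G m)" for m
    unfolding b_def using B[of m] by measurable
  have DG: "D m \<in> borel_measurable (G m)" for m
    unfolding D_def using past by (intro borel_measurable_sum) auto
  have bM[measurable]: "b m \<in> borel_measurable M" for m
    using indep[OF bG] by (rule indep_var_rv2)
  have [measurable]: "D m \<in> borel_measurable M" for m unfolding D_def by measurable
  have b_eq: "AE w in M. b m w = of_bool (m < \<tau> w)" for m
    using B_eq[of m] by eventually_elim (simp add: b_def)
  have D2: "integrable M (\<lambda>w. (D m w)\<^sup>2)" for m
  proof (induction m)
    case (Suc m)
    have "(\<lambda>w. (D (Suc m) w)\<^sup>2) = (\<lambda>w. (D m w + Y m w)\<^sup>2)" by (simp add: D_def)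
    note eq = this
    have dom: "integrable M (\<lambda>w. 2 * (D m w)\<^sup>2 + 2 * (Y m w)\<^sup>2)" using Suc sq by simp
    have le: "norm ((x + y)\<^sup>2) \<le> norm (2 * x\<^sup>2 + 2 * y\<^sup>2)" for x y :: real
    proof -
      have "(x + y)\<^sup>2 \<le> 2 * x\<^sup>2 + 2 * y\<^sup>2" using sum_squares_bound[of x y] by (simp add: power2_sum)
      then show ?thesis by simp
    qed
    have "integrable M (\<lambda>w. (D m w + Y m w)\<^sup>2)"
      by (rule Bochner_Integration.integrable_bound[OF dom _ AE_I2[OF le]]) measurable
    then show ?case by (simp add: eq)
  qed (simp add: D_def)
  have Dint: "integrable M (D m)" for m unfolding D_def using intY by simp
  have bint: "integrable M (b m)" for m
    by (rule integrable_const_bound[where B=1]) (auto simp: b_def)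
  have bDint: "integrable M (\<lambda>w. b m w * D m w)" for m
    by (rule Bochner_Integration.integrable_bound[OF Dint[of m]]) (measurable, simp add: b_def)
  \<comment> \<open>The new centred term is independent of its \<open>G m\<close>-measurable factor,
    so the cross term of the square has mean 0; the diagonal term below contributes \<open>v\<close>
    times the probability of not having stopped.\<close>
  have cross_int: "integrable M (\<lambda>w. Y m w * (b m w * D m w))"
    and cross: "expectation (\<lambda>w. Y m w * (b m w * D m w)) = 0" for m
  proof -
    have ind: "indep_var borel (Y m) borel (\<lambda>w. b m w * D m w)"
      by (rule indep) (intro borel_measurable_times bG DG)
    show "integrable M (\<lambda>w. Y m w * (b m w * D m w))"
      by (rule indep_var_integrable[OF ind intY bDint])
    show "expectation (\<lambda>w. Y m w * (b m w * D m w)) = 0"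
      using indep_var_lebesgue_integral[OF ind intY bDint] mean by simp
  qed
  have diag_int: "integrable M (\<lambda>w. (Y m w)\<^sup>2 * b m w)"
    and diag: "expectation (\<lambda>w. (Y m w)\<^sup>2 * b m w) = v * expectation (b m)" for m
  proof -
    have ind: "indep_var borel (\<lambda>w. (Y m w)\<^sup>2) borel (b m)"
      using indep_var_compose[OF indep[OF bG], of "\<lambda>x. x\<^sup>2" borel id borel m] by (simp add: comp_def)
    show "integrable M (\<lambda>w. (Y m w)\<^sup>2 * b m w)"
      by (rule indep_var_integrable[OF ind sq bint])
    show "expectation (\<lambda>w. (Y m w)\<^sup>2 * b m w) = v * expectation (b m)"
      using indep_var_lebesgue_integral[OF ind sq bint] var by simp
  qed
  have step: "AE w in M. (R (Suc m) w)\<^sup>2 = (R m w)\<^sup>2 + (2 * (Y m w * (b m w * D m w)) + (Y m w)\<^sup>2 * b m w)" for m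
    using b_eq[of m]
  proof eventually_elim
    case (elim w)
    have "R m w = D m w" if "m < \<tau> w"
      unfolding R_def D_def using that by (intro sum.cong) auto
    moreover have "R (Suc m) w = R m w + of_bool (m < \<tau> w) * Y m w" by (simp add: R_def)
    ultimately show ?case unfolding elim by (cases "m < \<tau> w") (auto simp: power2_eq_square algebra_simps)
  qed
  have R: "integrable M (\<lambda>w. (R m w)\<^sup>2) \<and> expectation (\<lambda>w. (R m w)\<^sup>2) = v * (\<Sum>l<m. expectation (b l))" for m
  proof (induction m)
    case 0
    show ?case by (simp add: R_def)
  next
    case (Suc m)
    let ?f = "\<lambda>w. (R m w)\<^sup>2 + (2 * (Y m w * (b m w * D m w)) + (Y m w)\<^sup>2 * b m w)"
    have cd: "integrable M (\<lambda>w. 2 * (Y m w * (b m w * D m w)))" using cross_int[of m] by simp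
    have f: "integrable M ?f"
      using Suc cd diag_int[of m] by (intro Bochner_Integration.integrable_add) auto
    have "expectation ?f = expectation (\<lambda>w. (R m w)\<^sup>2) + (2 * expectation (\<lambda>w. Y m w * (b m w * D m w))
        + expectation (\<lambda>w. (Y m w)\<^sup>2 * b m w))"
      using Suc cd diag_int[of m] by (subst Bochner_Integration.integral_add; simp)+
    then have f2: "expectation ?f = v * (\<Sum>l<Suc m. expectation (b l))"
      using Suc by (simp add: cross diag distrib_left)
    have "integrable M (\<lambda>w. (R (Suc m) w)\<^sup>2)"
      using f by (subst integrable_cong_AE[OF _ _ step]) auto
    moreover have "expectation (\<lambda>w. (R (Suc m) w)\<^sup>2) = expectation ?f"
      by (rule integral_cong_AE[OF _ _ step]) auto
    ultimately show ?case using f2 by simp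
  qed
  have bound: "(\<integral>\<^sup>+w. ennreal ((R m w)\<^sup>2) \<partial>M) \<le> ennreal v * (\<integral>\<^sup>+w. ennreal (real (\<tau> w)) \<partial>M)" for m
  proof -
    have "(\<integral>\<^sup>+w. ennreal ((R m w)\<^sup>2) \<partial>M) = ennreal (expectation (\<lambda>w. (R m w)\<^sup>2))"
      using R[of m] by (intro nn_integral_eq_integral) auto
    also have "\<dots> = ennreal (v * expectation (\<lambda>w. \<Sum>l<m. b l w))"
      using R[of m] bint by simp
    also have "\<dots> = ennreal v * ennreal (expectation (\<lambda>w. \<Sum>l<m. b l w))"
      using v by (intro ennreal_mult) (auto intro!: integral_nonneg_AE sum_nonneg simp: b_def)
    also have "ennreal (expectation (\<lambda>w. \<Sum>l<m. b l w)) = (\<integral>\<^sup>+w. ennreal (\<Sum>l<m. b l w) \<partial>M)"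
    proof (rule nn_integral_eq_integral[symmetric])
      show "AE w in M. 0 \<le> (\<Sum>l<m. b l w)" by (intro AE_I2 sum_nonneg) (simp add: b_def)
    qed (use bint in simp)
    also have "\<dots> \<le> (\<integral>\<^sup>+w. ennreal (real (\<tau> w)) \<partial>M)"
    proof (rule nn_integral_mono_AE)
      have "AE w in M. \<forall>l. b l w = of_bool (l < \<tau> w)" using b_eq by (simp add: AE_all_countable)
      then show "AE w in M. ennreal (\<Sum>l<m. b l w) \<le> ennreal (real (\<tau> w))"
      proof eventually_elim
        case (elim w)
        have "(\<Sum>l<m. b l w) = real (card ({..<m} \<inter> {..<\<tau> w}))"
          using elim by (simp add: sum.If_cases of_bool_def lessThan_def Collect_conj_eq[symmetric])
        also have "\<dots> \<le> real (\<tau> w)" by (metis Int_lower2 card_lessThan card_mono finite_lessThan of_nat_mono)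
        finally show ?case by (rule ennreal_leI)
      qed
    qed
    finally show ?thesis by (simp add: mult_left_mono)
  qed
  have lim: "liminf (\<lambda>m. ennreal ((R m w)\<^sup>2)) = ennreal ((\<Sum>l<\<tau> w. Y l w)\<^sup>2)" for w
  proof -
    have "\<forall>\<^sub>F m in sequentially. ennreal ((R m w)\<^sup>2) = ennreal ((\<Sum>l<\<tau> w. Y l w)\<^sup>2)"
      using eventually_ge_at_top[of "\<tau> w"]
    proof eventually_elim
      case (elim m)
      have "R m w = (\<Sum>l<\<tau> w. Y l w)"
        unfolding R_def using elim by (intro sum.mono_neutral_cong_right) auto
      then show ?case by simp
    qed
    then show ?thesis by (intro lim_imp_Liminf) (auto intro: tendsto_eventually)
  qed
  have "(\<integral>\<^sup>+w. ennreal ((\<Sum>l<\<tau> w. Y l w)\<^sup>2) \<partial>M) \<le> liminf (\<lambda>m. \<integral>\<^sup>+w. ennreal ((R m w)\<^sup>2) \<partial>M)"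
    unfolding lim[symmetric] by (rule nn_integral_liminf) measurable
  also have "\<dots> \<le> ennreal v * (\<integral>\<^sup>+w. ennreal (real (\<tau> w)) \<partial>M)"
    by (rule order_trans[OF Liminf_mono[of _ "\<lambda>_. ennreal v * (\<integral>\<^sup>+w. ennreal (real (\<tau> w)) \<partial>M)"]])
      (auto simp: bound Liminf_const)
  finally show ?thesis .
qed

context binomial_exhaustive_system
begin

lemma indep_sources: "indep_sets (source_sets X) UNIV"
  using independent unfolding source_sets_def .

lemma source_measurable:
  assumes "z \<in> A" "source_sets X z = sets (vimage_algebra (space (prob_sp X)) V R)" "random_variable R V"
  shows "V \<in> measurable (sigma (space (prob_sp X)) (\<Union>z\<in>A. source_sets X z)) R"
proof (rule measurableI)
  have sub: "(\<Union>z\<in>A. source_sets X z) \<subseteq> Pow (space (prob_sp X))"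
    using indep_sources sets.space_closed[of "prob_sp X"] unfolding indep_sets_def by blast
  show "V w \<in> space R" if "w \<in> space (sigma (space (prob_sp X)) (\<Union>z\<in>A. source_sets X z))" for w
    using that measurable_space[OF assms(3)] by (simp add: space_measure_of[OF sub])
  fix D assume "D \<in> sets R"
  then have "V -` D \<inter> space (prob_sp X) \<in> source_sets X z"
    unfolding assms(2) using measurable_space[OF assms(3)] by (subst sets_vimage_algebra2) auto
  then show "V -` D \<inter> space (sigma (space (prob_sp X)) (\<Union>z\<in>A. source_sets X z))
      \<in> sets (sigma (space (prob_sp X)) (\<Union>z\<in>A. source_sets X z))"
    unfolding space_measure_of[OF sub] sets_measure_of[OF sub] using assms(1)
    by (intro sigma_sets.Basic UN_I)
qed

sublocale measurable_primitives "prob_sp X" X by (rule measurable_primitives)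

lemma indep_service: "indep_vars (\<lambda>_. borel) (service X k) UNIV"
  by (rule indep_vars_if_indep_sets[OF indep_sources, of "Service k"]) (simp_all add: source_sets_def inj_def)

lemma indep_interarrival: "indep_vars (\<lambda>_. borel) (interarrival X k) UNIV"
  by (rule indep_vars_if_indep_sets[OF indep_sources, of "Interarrival k"]) (simp_all add: source_sets_def inj_def)

lemma indep_selected: "indep_vars (\<lambda>_. count_space UNIV) (selected X j) UNIV"
  by (rule indep_vars_if_indep_sets[OF indep_sources, of "Selection j"]) (simp_all add: source_sets_def inj_def)

text \<open>The count in the cut system is measurable with respect to \<open>G m\<close>, and almost
  surely it exceeds \<open>m\<close> exactly when the true count does. So the true count is a
  stopping time up to null sets.\<close>

lemma wald_services:
  assumes path: "AE w in prob_sp X. \<exists>lam' ZA. regular_path X w lam' ZA"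
    and dist: "real_distribution (nuS k)" and sq: "integrable (nuS k) (\<lambda>x. x\<^sup>2)" and mean: "(\<integral>x. x \<partial>nuS k) = c"
  shows "(\<integral>\<^sup>+w. ennreal ((\<Sum>l<completed_before I p X j w $ k. service X k l w - c)\<^sup>2) \<partial>prob_sp X) \<le>
    ennreal (\<integral>x. (x - c)\<^sup>2 \<partial>nuS k) * (\<integral>\<^sup>+w. ennreal (real (completed_before I p X j w $ k)) \<partial>prob_sp X)"
proof -
  interpret nu: real_distribution "nuS k" by fact
  \<comment> \<open>Everything is known except class-\<open>k\<close> services of index at least
    \<open>m\<close>: even future arrivals, selections and switchovers are included. The filtration
    follows the service index, not time.\<close>
  define A where "A m = UNIV - {Service k l | l. m \<le> l}" for m
  define G where "G m = sigma (space (prob_sp X)) (\<Union>z\<in>A m. source_sets X z)" for m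
  note sm = source_measurable[of _ "A m" for m, folded G_def]
  have G: "measurable_primitives (G m) (cut_services k m X)" for m
  proof
    fix k' l j
    show "interarrival (cut_services k m X) k' l \<in> borel_measurable (G m)"
      unfolding cut_services_simps by (rule sm[of "Interarrival k' l"]) (auto simp: A_def source_sets_def)
    show "switchover (cut_services k m X) j \<in> borel_measurable (G m)"
      unfolding cut_services_simps by (rule sm[of "Switchover j"]) (auto simp: A_def source_sets_def)
    show "selected (cut_services k m X) j l \<in> measurable (G m) (count_space UNIV)"
      unfolding cut_services_simps by (rule sm[of "Selection j l"]) (auto simp: A_def source_sets_def)
    show "init (cut_services k m X) \<in> measurable (G m) (count_space UNIV)"
      unfolding cut_services_simps by (rule sm[of "Initial"]) (auto simp: A_def source_sets_def)
    show "service (cut_services k m X) k' l \<in> borel_measurable (G m)"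
    proof (cases "k' = k \<and> m \<le> l")
      case False
      then have "service X k' l \<in> borel_measurable (G m)"
        by (intro sm[of "Service k' l"]) (auto simp: A_def source_sets_def)
      then show ?thesis using False by (auto simp: cut_services_simps)
    qed (simp add: cut_services_simps)
  qed
  have int1: "integrable (nuS k) (\<lambda>x. x)" using sq by (rule nu.square_integrable_imp_integrable[rotated]) simp
  have int2: "integrable (nuS k) (\<lambda>x. (x - c)\<^sup>2)"
    using sq int1 by (simp add: power2_diff)
  have law: "distr (prob_sp X) borel (service X k l) = nuS k" for l by (rule service_law)
  show ?thesis
  proof (rule wald_second_moment[where G=G and B="\<lambda>m w. m < completed_before I p (cut_services k m X) j w $ k"])
    show "random_variable (count_space UNIV) (\<lambda>w. completed_before I p X j w $ k)"
      by (rule measurable_completed_before)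
    show "integrable (prob_sp X) (\<lambda>w. (service X k l w - c)\<^sup>2)" for l
      using int2 unfolding law[of l, symmetric] by (subst (asm) integrable_distr_eq) auto
    show "expectation (\<lambda>w. service X k l w - c) = 0" for l
    proof -
      have "expectation (\<lambda>w. service X k l w - c) = (\<integral>x. x - c \<partial>nuS k)"
        unfolding law[of l, symmetric] by (subst integral_distr) auto
      then show ?thesis using int1 mean nu.prob_space by simp
    qed
    show "expectation (\<lambda>w. (service X k l w - c)\<^sup>2) = (\<integral>x. (x - c)\<^sup>2 \<partial>nuS k)" for l
      unfolding law[of l, symmetric] by (subst integral_distr) auto
    show "(\<lambda>w. service X k l w - c) \<in> borel_measurable (G m)" if "l < m" for l m
    proof -
      have "service X k l \<in> borel_measurable (G m)"
        using that by (intro sm[of "Service k l"]) (auto simp: A_def source_sets_def)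
      then show ?thesis by simp
    qed
    show "Measurable.pred (G m) (\<lambda>w. m < completed_before I p (cut_services k m X) j w $ k)" for m
      by (rule measurable_compose[OF measurable_primitives.measurable_completed_before[OF G]]) simp
    show "AE w in prob_sp X. (m < completed_before I p (cut_services k m X) j w $ k) \<longleftrightarrow>
        m < completed_before I p X j w $ k" for m
      using path
    proof eventually_elim
      case (elim w)
      then obtain lam' ZA where "regular_path X w lam' ZA" by blast
      from completed_before_cut_services[OF this, of I p k m j] show ?case by (simp add: not_le[symmetric])
    qed
    show "indep_var borel (\<lambda>w. service X k m w - c) borel f" if f: "f \<in> borel_measurable (G m)" for m f
    proof (rule indep_var_if_sigma[OF indep_sources, where A="{Service k m}" and B="A m"])
      show "Int_stable (source_sets X z)" for z
        by (cases z) (simp_all add: source_sets_def sets.Int_stable)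
      have "service X k m \<in> borel_measurable (sigma (space (prob_sp X)) (\<Union>z\<in>{Service k m}. source_sets X z))"
        by (rule source_measurable[of "Service k m"]) (auto simp: source_sets_def)
      then show "(\<lambda>w. service X k m w - c) \<in> borel_measurable (sigma (space (prob_sp X)) (\<Union>z\<in>{Service k m}. source_sets X z))"
        by (rule borel_measurable_diff) simp
    qed (use f in \<open>auto simp: A_def G_def\<close>)
  qed simp
qed

end

section \<open>Affine walks, moments of the primitive laws and growth of the cost\<close>

lemma integrable_abs_affine_power:
  fixes \<nu> :: "real measure"
  assumes "real_distribution \<nu>" and int: "integrable \<nu> (\<lambda>x. \<bar>x\<bar> ^ q)"
  shows "integrable \<nu> (\<lambda>x. \<bar>a + b * x\<bar> ^ q)"
proof -
  interpret real_distribution \<nu> by fact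
  have dom: "integrable \<nu> (\<lambda>x. 2 ^ q * (\<bar>a\<bar> ^ q + \<bar>b\<bar> ^ q * \<bar>x\<bar> ^ q))" using int by simp
  have le: "norm (\<bar>a + b * x\<bar> ^ q) \<le> norm (2 ^ q * (\<bar>a\<bar> ^ q + \<bar>b\<bar> ^ q * \<bar>x\<bar> ^ q))" for x
  proof -
    have "\<bar>a + b * x\<bar> \<le> 2 * max \<bar>a\<bar> \<bar>b * x\<bar>"
      using abs_triangle_ineq[of a "b * x"] by linarith
    then have "\<bar>a + b * x\<bar> ^ q \<le> (2 * max \<bar>a\<bar> \<bar>b * x\<bar>) ^ q" by (intro power_mono) auto
    also have "\<dots> = 2 ^ q * max \<bar>a\<bar> \<bar>b * x\<bar> ^ q" by (rule power_mult_distrib)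
    also have "\<dots> \<le> 2 ^ q * (\<bar>a\<bar> ^ q + \<bar>b * x\<bar> ^ q)"
      by (intro mult_left_mono) (auto simp: max_def)
    finally show ?thesis by (simp add: abs_mult power_mult_distrib)
  qed
  show ?thesis
    by (rule Bochner_Integration.integrable_bound[OF dom _ AE_I2[OF le]]) measurable
qed

text \<open>All deviations share this form: \<open>b = 1\<close> for an excess of the sums over a
  line, \<open>b = -1\<close> for a shortfall below it, and the drift \<open>a + b * mean\<close> is
  negative in either case.\<close>

lemma
  fixes V :: "'i \<Rightarrow> nat \<Rightarrow> 'w \<Rightarrow> real"
  assumes M: "\<And>i. i \<in> J \<Longrightarrow> prob_space (M i)"
    and indep: "\<And>i. i \<in> J \<Longrightarrow> prob_space.indep_vars (M i) (\<lambda>_. borel) (V i) UNIV"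
    and law: "\<And>i l. i \<in> J \<Longrightarrow> distr (M i) borel (V i l) = \<nu>"
    and dist: "real_distribution \<nu>" and mom: "integrable \<nu> (\<lambda>x. \<bar>x\<bar> ^ Suc P)"
    and neg: "a + b * (\<integral>x. x \<partial>\<nu>) < 0" and P: "P \<ge> 1"
  shows unif_tail_affine_walk: "unif_tail P J M (\<lambda>i w. walk_sup (\<lambda>l. a + b * V i l w))"
    and AE_affine_walk: "i \<in> J \<Longrightarrow> AE w in M i. \<forall>m. real m * a + b * (\<Sum>l<m. V i l w) \<le> walk_sup (\<lambda>l. a + b * V i l w)"
proof -
  interpret nu: real_distribution \<nu> by fact
  define \<nu>' where "\<nu>' = distr \<nu> borel (\<lambda>x. a + b * x)"
  have g[measurable]: "(\<lambda>x. a + b * x) \<in> borel_measurable \<nu>" by simp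
  have V: "V i l \<in> borel_measurable (M i)" if "i \<in> J" for i l
    using indep[OF that] by (auto simp: prob_space.indep_vars_def[OF M[OF that]])
  have indep': "prob_space.indep_vars (M i) (\<lambda>_. borel) (\<lambda>l w. a + b * V i l w) UNIV" if "i \<in> J" for i
    using prob_space.indep_vars_compose2[OF M[OF that] indep[OF that], of "\<lambda>_ x. a + b * x" "\<lambda>_. borel"] by simp
  have law': "distr (M i) borel (\<lambda>w. a + b * V i l w) = \<nu>'" if "i \<in> J" for i l
    unfolding \<nu>'_def law[OF that, of l, symmetric]
    by (subst distr_distr) (auto simp: comp_def V[OF that])
  have mom': "integrable \<nu>' (\<lambda>x. \<bar>x\<bar> ^ Suc P)"
    unfolding \<nu>'_def using integrable_abs_affine_power[OF dist mom, of a b]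
    by (subst integrable_distr_eq) (simp_all del: power_Suc)
  have "integrable \<nu> (\<lambda>x. \<bar>x\<bar> ^ 1)" by (rule integrable_abs_power_le[OF dist mom]) simp
  then have "integrable \<nu> (\<lambda>x. x)" by (intro integrable_norm_cancel[of \<nu> "\<lambda>x. x"]) simp_all
  then have int: "integrable \<nu> (\<lambda>x. b * x)" by (rule integrable_mult_right)
  have "(\<integral>x. x \<partial>\<nu>') = (\<integral>x. a + b * x \<partial>\<nu>)"
    unfolding \<nu>'_def by (rule integral_distr) simp_all
  also have "\<dots> = (\<integral>x. a \<partial>\<nu>) + (\<integral>x. b * x \<partial>\<nu>)"
    by (rule Bochner_Integration.integral_add[OF _ int]) simp
  also have "(\<integral>x. a \<partial>\<nu>) = a" by (simp only: lebesgue_integral_const nu.prob_space scaleR_one)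
  also have "(\<integral>x. b * x \<partial>\<nu>) = b * (\<integral>x. x \<partial>\<nu>)" by (rule integral_mult_right_zero)
  finally have neg': "(\<integral>x. x \<partial>\<nu>') < 0" using neg by (simp only:)
  show "unif_tail P J M (\<lambda>i w. walk_sup (\<lambda>l. a + b * V i l w))"
    by (rule unif_tail_walk_sup[OF M indep' law' mom' neg' P])
  show "AE w in M i. \<forall>m. real m * a + b * (\<Sum>l<m. V i l w) \<le> walk_sup (\<lambda>l. a + b * V i l w)" if i: "i \<in> J"
  proof -
    have "real_distribution \<nu>'" unfolding \<nu>'_def by (rule nu.real_distribution_distr) simp
    from integrable_abs_power_le[OF this mom', of 2] P have "integrable \<nu>' (\<lambda>x. x\<^sup>2)" by simp
    from prob_space.AE_le_walk_sup_sequence[OF M[OF i] indep'[OF i] law'[OF i] this neg']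
    show ?thesis by (simp add: sum.distrib sum_distrib_left)
  qed
qed

lemma unif_tail_div:
  fixes Z :: "nat \<Rightarrow> 'w \<Rightarrow> real"
  assumes Z: "unif_tail P {1..} M Z" and nonneg: "\<And>n w. 0 \<le> Z n w"
  shows "unif_tail P {1..} M (\<lambda>n w. Z n w / real n)"
proof (rule unif_tail_mono[OF Z])
  fix n :: nat assume n: "n \<in> {1..}"
  show "(\<lambda>w. Z n w / real n) \<in> borel_measurable (M n)" using unif_tail_measurable[OF Z n] by simp
  have "Z n w / real n \<le> Z n w" for w
    using n nonneg[of n w] by (simp add: divide_le_eq mult_le_cancel_left1)
  then show "AE w in M n. Z n w / real n \<le> Z n w" by simp
qed

lemma real_distribution_exponential:
  assumes "0 < c"
  shows "real_distribution (density lborel (exponential_density c))"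
  using prob_space_exponential_density[OF assms] by (simp add: real_distribution_def real_distribution_axioms_def)

lemma has_bochner_integral_exponential_moment:
  assumes c: "0 < c"
  shows "has_bochner_integral lborel (\<lambda>x. exponential_density c x *\<^sub>R \<bar>x\<bar> ^ q) (fact q / c ^ q)"
proof (rule has_bochner_integral_nn_integral)
  have eq: "(\<lambda>x. exponential_density c x *\<^sub>R \<bar>x\<bar> ^ q) = (\<lambda>x. exponential_density c x * x ^ q)"
    by (simp add: fun_eq_iff exponential_density_def)
  show "(\<integral>\<^sup>+x. ennreal (exponential_density c x *\<^sub>R \<bar>x\<bar> ^ q) \<partial>lborel) = ennreal (fact q / c ^ q)"
    unfolding fun_cong[OF eq] using nn_integral_erlang_ith_moment[OF c, of 0 q] by simp
qed (use c in auto)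

lemma integrable_exponential_power:
  assumes c: "0 < c"
  shows "integrable (density lborel (exponential_density c)) (\<lambda>x. \<bar>x\<bar> ^ q)"
  using has_bochner_integral_exponential_moment[OF c, of q] c
  by (subst integrable_density) (auto simp: has_bochner_integral_iff)

lemma integral_exponential:
  assumes c: "0 < c"
  shows "(\<integral>x. x \<partial>density lborel (exponential_density c)) = 1 / c"
proof -
  have eq: "(\<lambda>x. exponential_density c x *\<^sub>R x) = (\<lambda>x. exponential_density c x *\<^sub>R \<bar>x\<bar> ^ 1)"
    by (simp add: fun_eq_iff exponential_density_def)
  have "(\<integral>x. x \<partial>density lborel (exponential_density c)) = (\<integral>x. exponential_density c x *\<^sub>R x \<partial>lborel)"
    using c by (intro integral_density) auto
  also have "\<dots> = 1 / c"
    unfolding eq using has_bochner_integral_exponential_moment[OF c, of 1]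
    by (simp only: has_bochner_integral_iff) simp
  finally show ?thesis .
qed

text \<open>The growth hypothesis says nothing about bounded arguments. By monotonicity
  \<open>x\<close> is replaced by the vector with all entries \<open>y + R\<close>, whose norm lies
  in the asymptotic range and is at most the number of queues times \<open>y + R\<close>.\<close>

lemma growth_bound:
  fixes \<psi> :: "real^'k::finite \<Rightarrow> real"
  assumes growth: "\<psi> \<in> O[inf at_infinity (principal {0..})](\<lambda>x. norm x powr p0)"
    and mono: "mono_on {0..} \<psi>" and p0: "0 \<le> p0" "p0 \<le> real q"
  shows "\<exists>C R. 0 \<le> C \<and> 0 \<le> R \<and> (\<forall>x y. 0 \<le> x \<longrightarrow> (\<forall>k. x $ k \<le> y) \<longrightarrow> \<psi> x \<le> C * (y + R) ^ q)"
proof -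
  obtain c where c: "c > 0" "\<forall>\<^sub>F x in inf at_infinity (principal {0..}). norm (\<psi> x) \<le> c * norm (norm x powr p0)"
    using landau_o.bigE[OF growth] by blast
  then obtain b where b: "\<And>x. b \<le> norm x \<Longrightarrow> 0 \<le> x \<Longrightarrow> \<bar>\<psi> x\<bar> \<le> c * norm x powr p0"
    by (auto simp: eventually_inf_principal eventually_at_infinity)
  \<comment> \<open>The bound \<open>b\<close> makes the asymptotic estimate applicable, the bound 1
    allows the exponent \<open>p0\<close> to be raised to the integer \<open>q\<close>.\<close>
  define R where "R = max b 1"
  define K where "K = real CARD('k)"
  have "\<psi> x \<le> (c * K ^ q) * (y + R) ^ q" if x: "0 \<le> x" "\<And>k. x $ k \<le> y" for x :: "real^'k" and y
  proof -
    have y: "0 \<le> y" using x(1) x(2)[of undefined] by (auto simp: less_eq_vec_def intro: order_trans)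
    define z :: "real^'k" where "z = (\<chi> k. y + R)"
    have z: "0 \<le> z" "x \<le> z" using x y by (auto simp: z_def less_eq_vec_def R_def intro: order_trans add_increasing2)
    have nz: "y + R \<le> norm z" using component_le_norm_cart[of z undefined] y by (simp add: z_def R_def)
    have "norm z \<le> (\<Sum>k\<in>UNIV. \<bar>z $ k\<bar>)" by (rule norm_le_l1_cart)
    also have "\<dots> = K * (y + R)" using y by (simp add: z_def K_def R_def)
    finally have zn: "norm z \<le> K * (y + R)" .
    have "\<psi> x \<le> \<psi> z" using mono z x by (auto simp: mono_on_def)
    also have "\<dots> \<le> c * norm z powr p0" proof -
      have "b \<le> norm z" using nz y unfolding R_def by linarith
      then show ?thesis using b[of z] z by auto
    qed
    also have "norm z powr p0 \<le> norm z powr real q"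
      using nz y p0 by (intro powr_mono) (auto simp: R_def)
    also have "norm z powr real q = norm z ^ q" using nz y by (intro powr_realpow) (auto simp: R_def)
    also have "\<dots> \<le> (K * (y + R)) ^ q" using zn by (intro power_mono) auto
    finally show ?thesis using c by (simp add: power_mult_distrib mult_ac)
  qed
  then show ?thesis using c by (intro exI[of _ "c * K ^ q"] exI[of _ R]) (auto simp: K_def R_def)
qed

lemma integrable_power_if_exp:
  fixes \<nu> :: "real measure"
  assumes "real_distribution \<nu>" and nonneg: "AE x in \<nu>. 0 \<le> x" and t: "0 < t" and int: "integrable \<nu> (\<lambda>x. exp (t * x))"
  shows "integrable \<nu> (\<lambda>x. \<bar>x\<bar> ^ q)"
proof -
  interpret real_distribution \<nu> by fact
  have dom: "integrable \<nu> (\<lambda>x. fact q / t ^ q * exp (t * x))" using int by simp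
  show ?thesis
  proof (rule Bochner_Integration.integrable_bound[OF dom])
    show "AE x in \<nu>. norm (\<bar>x\<bar> ^ q) \<le> norm (fact q / t ^ q * exp (t * x))"
      using nonneg
    proof eventually_elim
      case (elim x)
      \<comment> \<open>A single term of the exponential series, all of whose terms are nonnegative
        here.\<close>
      have "(t * x) ^ q /\<^sub>R fact q \<le> exp (t * x)"
      proof -
        have "(\<Sum>n\<in>{q}. (t * x) ^ n /\<^sub>R fact n) \<le> (\<Sum>n. (t * x) ^ n /\<^sub>R fact n)"
          using elim t by (intro sum_le_suminf summable_exp_generic) auto
        then show ?thesis by (simp add: exp_def)
      qed
      then have "fact q / t ^ q * ((t * x) ^ q /\<^sub>R fact q) \<le> fact q / t ^ q * exp (t * x)"
        using t by (intro mult_left_mono) auto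
      moreover have eq: "fact q / t ^ q * ((t * x) ^ q /\<^sub>R fact q) = x ^ q"
        using t by (simp add: power_mult_distrib)
      ultimately have "x ^ q \<le> fact q / t ^ q * exp (t * x)" by (simp only: eq)
      moreover have "0 \<le> fact q / t ^ q * exp (t * x)" using t by simp
      ultimately show ?case using elim by (simp only: real_norm_def abs_of_nonneg power_abs zero_le_power)
    qed
  qed measurable
qed

section \<open>A family of scaled systems\<close>

text \<open>The hypotheses in the form in which the estimates use them: \<open>visit\<close> records
  what the optimal ratios provide, and \<open>switch_moments\<close> bounds scaled switchover
  moments uniformly in \<open>n\<close>.\<close>

locale polling_family =
  fixes I :: nat and p :: "nat \<Rightarrow> 'k::finite" and lam mu :: "'k \<Rightarrow> real"
    and nuS :: "'k \<Rightarrow> real measure" and nuV :: "nat \<Rightarrow> nat \<Rightarrow> real measure"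
    and L :: nat and r :: "nat \<Rightarrow> real" and X :: "nat \<Rightarrow> ('k, 'w) primitives"
  assumes lam_pos: "\<And>k. lam k > 0" and mu_pos: "\<And>k. mu k > 0"
    and stable: "load lam mu < 1"
    and service_dist: "\<And>k. real_distribution (nuS k)"
    and service_AE_nonneg: "\<And>k. AE x in nuS k. x \<ge> 0"
    and service_mean: "\<And>k. (\<integral>x. x \<partial>nuS k) = 1 / mu k"
    and service_sq: "\<And>k. integrable (nuS k) (\<lambda>x. x\<^sup>2)"
    and switch_AE_nonneg: "\<And>n i. n \<ge> 1 \<Longrightarrow> i < I \<Longrightarrow> AE x in nuV n i. x \<ge> 0"
    and switch_moments: "\<And>i q. i < I \<Longrightarrow> q \<ge> 2 \<Longrightarrow>
      \<exists>B. \<forall>n\<ge>1. (\<integral>\<^sup>+x. ennreal (\<bar>x / real n\<bar> ^ q) \<partial>nuV n i) \<le> ennreal B"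
    and system: "\<And>n. n \<ge> 1 \<Longrightarrow> binomial_exhaustive_system I lam nuS (nuV n) L r (X n)"
    and stationary: "\<And>n. n \<ge> 1 \<Longrightarrow> stationary_start I p L (X n)"
    and visit: "\<And>k. \<exists>i<I * L. p (i mod I) = k \<and> r i > 0"
begin

abbreviation "M n \<equiv> prob_sp (X n)"
abbreviation "T n w \<equiv> polling_epoch I p (X n) (I * L) w"
abbreviation "C n k w \<equiv> completed_before I p (X n) (I * L) w $ k"
abbreviation "init_queue n k w \<equiv> real (init (X n) w $ k)"

lemma prob_space_M: "n \<in> {1..} \<Longrightarrow> prob_space (M n)"
  using system[of n] by (auto simp: binomial_exhaustive_system_def)

lemma I_pos: "I > 0"
  using visit by (cases I) auto

text \<open>Since \<open>eta \<le> 1 / 2\<close>, \<open>(1 + eta)\<close> squared is at most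
  \<open>1 + 3 * eta\<close>, and \<open>3 * eta\<close> is at most half of
  \<open>1 - load lam mu\<close>; so the perturbed load stays below 1. The bound
  \<open>1 / 2\<close> also serves in \<open>mult_mono_third\<close>.\<close>

definition eta :: real where "eta = min (1 / 2) ((1 - load lam mu) / 6)"
definition lam' :: "'k \<Rightarrow> real" where "lam' k = (1 + eta) * lam k"
definition u :: "'k \<Rightarrow> real" where "u k = (1 + eta) / mu k"

lemma eta: "0 < eta" "eta \<le> 1 / 2" "6 * eta \<le> 1 - load lam mu"
  using stable by (auto simp: eta_def min_def)

lemma lam'_pos: "0 < lam' k" and u_pos: "0 < u k"
  using eta lam_pos[of k] mu_pos[of k] by (auto simp: lam'_def u_def)

lemma sum_u_lam': "(\<Sum>k\<in>UNIV. u k * lam' k) < 1"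
proof -
  have load0: "0 \<le> load lam mu"
    unfolding load_def by (intro sum_nonneg divide_nonneg_nonneg less_imp_le lam_pos mu_pos)
  have "(\<Sum>k\<in>UNIV. u k * lam' k) = (1 + eta)\<^sup>2 * load lam mu"
    unfolding load_def sum_distrib_left by (intro sum.cong) (auto simp: u_def lam'_def power2_eq_square)
  also have "(1 + eta)\<^sup>2 \<le> 1 + 3 * eta"
    using eta mult_mono[of eta "1/2" eta eta] by (simp add: power2_eq_square algebra_simps)
  then have "(1 + eta)\<^sup>2 * load lam mu \<le> (1 + 3 * eta) * load lam mu"
    using load0 by (rule mult_right_mono)
  also have "\<dots> \<le> load lam mu + 3 * eta"
    using eta stable load0 mult_left_mono[of "load lam mu" 1 "3 * eta"] by (simp add: algebra_simps)
  also have "\<dots> < 1" using eta stable by linarith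
  finally show ?thesis .
qed

lemma lam'_u_less_1: "lam' k * u k < 1"
proof -
  have "u k * lam' k \<le> (\<Sum>k\<in>UNIV. u k * lam' k)"
    by (intro member_le_sum) (auto intro: mult_nonneg_nonneg less_imp_le lam'_pos u_pos)
  then show ?thesis using sum_u_lam' by (simp add: mult.commute)
qed

text \<open>The four deviations: interarrival sums below slope \<open>1 / lam' k\<close>, service
  sums above slope \<open>u k\<close>, service sums below slope \<open>(1 - eta) / mu k\<close>, and
  numbers of selected customers below half their mean. The shape \<open>a + b * V\<close> fits
  \<open>unif_tail_affine_walk\<close>.\<close>

definition ZA :: "nat \<Rightarrow> 'k \<Rightarrow> 'w \<Rightarrow> real" where
  "ZA n k w = walk_sup (\<lambda>l. 1 / lam' k + (- 1) * interarrival (X n) k l w)"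
definition ZS_up :: "nat \<Rightarrow> 'k \<Rightarrow> 'w \<Rightarrow> real" where
  "ZS_up n k w = walk_sup (\<lambda>l. - u k + 1 * service (X n) k l w)"
definition ZS_low :: "nat \<Rightarrow> 'k \<Rightarrow> 'w \<Rightarrow> real" where
  "ZS_low n k w = walk_sup (\<lambda>l. (1 - eta) / mu k + (- 1) * service (X n) k l w)"
definition Zsel :: "nat \<Rightarrow> nat \<Rightarrow> 'w \<Rightarrow> real" where
  "Zsel n i w = walk_sup (\<lambda>l. r i / 2 + (- 1) * of_bool (selected (X n) i l w))"

lemma distr_interarrival:
  "n \<in> {1..} \<Longrightarrow> distr (M n) borel (interarrival (X n) k l) = density lborel (exponential_density (lam k))"
  using distributed_distr_eq_density[OF binomial_exhaustive_system.interarrival_law[OF system]]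
  by (metis atLeast_iff distr_cong sets_lborel)

lemma ZA:
  assumes P: "P \<ge> 1"
  shows unif_tail_ZA: "unif_tail P {1..} M (\<lambda>n. ZA n k)"
    and AE_ZA: "n \<in> {1..} \<Longrightarrow> AE w in M n. \<forall>m. real m / lam' k \<le> (\<Sum>l<m. interarrival (X n) k l w) + ZA n k w"
proof -
  have indep: "prob_space.indep_vars (M n) (\<lambda>_. borel) (interarrival (X n) k) UNIV" if "n \<in> {1..}" for n
    using binomial_exhaustive_system.indep_interarrival[OF system] that by auto
  have "1 / lam' k < 1 / lam k" 
    unfolding lam'_def using eta lam_pos[of k] by (intro divide_strict_left_mono) auto
  then have neg: "1 / lam' k + (- 1) * (\<integral>x. x \<partial>density lborel (exponential_density (lam k))) < 0"
    by (simp add: integral_exponential[OF lam_pos])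
  note facts = prob_space_M indep distr_interarrival real_distribution_exponential[OF lam_pos]
    integrable_exponential_power[OF lam_pos] neg P
  show "unif_tail P {1..} M (\<lambda>n. ZA n k)"
    unfolding ZA_def[abs_def] by (rule unif_tail_affine_walk[OF facts])
  show "AE w in M n. \<forall>m. real m / lam' k \<le> (\<Sum>l<m. interarrival (X n) k l w) + ZA n k w" if "n \<in> {1..}"
  proof -
    have "AE w in M n. \<forall>m. real m * (1 / lam' k) + (- 1) * (\<Sum>l<m. interarrival (X n) k l w) \<le> ZA n k w"
      unfolding ZA_def
      by (rule AE_affine_walk[where M=M and J="{1..}" and V="\<lambda>n. interarrival (X n) k", OF facts that])
    then show ?thesis by (rule eventually_mono) (auto simp: algebra_simps)
  qed
qed

lemma ZS:
  assumes P: "P \<ge> 1" and mom: "integrable (nuS k) (\<lambda>x. \<bar>x\<bar> ^ Suc P)"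
  shows unif_tail_ZS_up: "unif_tail P {1..} M (\<lambda>n. ZS_up n k)"
    and AE_ZS_up: "n \<in> {1..} \<Longrightarrow> AE w in M n. \<forall>m. (\<Sum>l<m. service (X n) k l w) \<le> u k * real m + ZS_up n k w"
    and unif_tail_ZS_low: "unif_tail P {1..} M (\<lambda>n. ZS_low n k)"
    and AE_ZS_low: "n \<in> {1..} \<Longrightarrow>
      AE w in M n. \<forall>m. (1 - eta) / mu k * real m \<le> (\<Sum>l<m. service (X n) k l w) + ZS_low n k w"
proof -
  have indep: "prob_space.indep_vars (M n) (\<lambda>_. borel) (service (X n) k) UNIV" if "n \<in> {1..}" for n
    using binomial_exhaustive_system.indep_service[OF system] that by auto
  have law: "distr (M n) borel (service (X n) k l) = nuS k" if "n \<in> {1..}" for n l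
    using binomial_exhaustive_system.service_law[OF system] that by auto
  have up: "- u k + 1 * (\<integral>x. x \<partial>nuS k) < 0" and low: "(1 - eta) / mu k + (- 1) * (\<integral>x. x \<partial>nuS k) < 0"
    using eta mu_pos[of k] by (simp_all add: service_mean u_def divide_strict_right_mono)
  note facts_up = prob_space_M indep law service_dist mom up P
  note facts_low = prob_space_M indep law service_dist mom low P
  show "unif_tail P {1..} M (\<lambda>n. ZS_up n k)"
    unfolding ZS_up_def[abs_def] by (rule unif_tail_affine_walk[OF facts_up])
  show "unif_tail P {1..} M (\<lambda>n. ZS_low n k)"
    unfolding ZS_low_def[abs_def] by (rule unif_tail_affine_walk[OF facts_low])
  show "AE w in M n. \<forall>m. (\<Sum>l<m. service (X n) k l w) \<le> u k * real m + ZS_up n k w" if "n \<in> {1..}"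
  proof -
    have "AE w in M n. \<forall>m. real m * - u k + 1 * (\<Sum>l<m. service (X n) k l w) \<le> ZS_up n k w"
      unfolding ZS_up_def
      by (rule AE_affine_walk[where M=M and J="{1..}" and V="\<lambda>n. service (X n) k", OF facts_up that])
    then show ?thesis by (rule eventually_mono) (auto simp: algebra_simps)
  qed
  show "AE w in M n. \<forall>m. (1 - eta) / mu k * real m \<le> (\<Sum>l<m. service (X n) k l w) + ZS_low n k w" if "n \<in> {1..}"
  proof -
    have "AE w in M n. \<forall>m. real m * ((1 - eta) / mu k) + (- 1) * (\<Sum>l<m. service (X n) k l w) \<le> ZS_low n k w"
      unfolding ZS_low_def
      by (rule AE_affine_walk[where M=M and J="{1..}" and V="\<lambda>n. service (X n) k", OF facts_low that])
    then show ?thesis by (rule eventually_mono) (auto simp: mult.commute add.commute diff_le_eq)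
  qed
qed

lemma r_le_1: "i < I * L \<Longrightarrow> r i \<le> 1"
proof -
  assume "i < I * L"
  interpret binomial_exhaustive_system I lam nuS "nuV 1" L r "X 1" by (rule system) simp
  show "r i \<le> 1" using selected_law[of i 0] prob_le_1 \<open>i < I * L\<close> by (metis mod_less)
qed

lemma Zsel:
  assumes i: "i < I * L" "r i > 0" and P: "P \<ge> 1"
  shows unif_tail_Zsel: "unif_tail P {1..} M (\<lambda>n. Zsel n i)"
    and AE_Zsel: "n \<in> {1..} \<Longrightarrow>
      AE w in M n. \<forall>N. r i / 2 * real N \<le> real (card {m. m < N \<and> selected (X n) i m w}) + Zsel n i w"
proof -
  define \<nu> where "\<nu> = distr (measure_pmf (bernoulli_pmf (r i))) borel (of_bool :: bool \<Rightarrow> real)"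
  have indep: "prob_space.indep_vars (M n) (\<lambda>_. borel) (\<lambda>l w. of_bool (selected (X n) i l w) :: real) UNIV"
    if n: "n \<in> {1..}" for n
  proof -
    interpret binomial_exhaustive_system I lam nuS "nuV n" L r "X n" using system n by auto
    show ?thesis
      by (rule indep_vars_compose2[OF indep_selected[of i], of "\<lambda>_. of_bool" "\<lambda>_. borel"]) simp
  qed
  have law: "distr (M n) borel (\<lambda>w. of_bool (selected (X n) i l w) :: real) = \<nu>" if n: "n \<in> {1..}" for n l
  proof -
    interpret binomial_exhaustive_system I lam nuS "nuV n" L r "X n" using system n by auto
    have "distr (M n) (count_space UNIV) (selected (X n) i l) = measure_pmf (bernoulli_pmf (r i))"
    proof (rule measure_eqI_countable[of _ UNIV])
      fix b :: bool
      have pr: "prob {w \<in> space (M n). selected (X n) i l w} = r i"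
        using selected_law[of i l] i by simp
      have "prob {w \<in> space (M n). \<not> selected (X n) i l w} = 1 - r i"
        using prob_neg[of "selected (X n) i l"] pr by simp
      then have "prob (selected (X n) i l -` {b} \<inter> space (M n)) = pmf (bernoulli_pmf (r i)) b"
        using pr i r_le_1[OF i(1)] by (cases b) (auto simp: vimage_def Int_def conj_commute)
      then show "emeasure (distr (M n) (count_space UNIV) (selected (X n) i l)) {b} = emeasure (measure_pmf (bernoulli_pmf (r i))) {b}"
        by (simp add: emeasure_distr emeasure_eq_measure emeasure_pmf_single)
    qed auto
    then have "\<nu> = distr (distr (M n) (count_space UNIV) (selected (X n) i l)) borel of_bool"
      by (simp add: \<nu>_def)
    also have "\<dots> = distr (M n) borel (\<lambda>w. of_bool (selected (X n) i l w))"
      by (subst distr_distr) (auto simp: comp_def)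
    finally show ?thesis ..
  qed
  have dist: "real_distribution \<nu>"
    unfolding \<nu>_def by (rule prob_space.real_distribution_distr) (auto simp: measure_pmf.prob_space_axioms)
  have mom: "integrable \<nu> (\<lambda>x. \<bar>x\<bar> ^ Suc P)"
    unfolding \<nu>_def by (subst integrable_distr_eq) (auto intro!: integrable_measure_pmf_finite simp del: power_Suc)
  have "(\<integral>x. x \<partial>\<nu>) = r i"
    unfolding \<nu>_def using i r_le_1[OF i(1)] by (subst integral_distr) auto
  then have neg: "r i / 2 + (- 1) * (\<integral>x. x \<partial>\<nu>) < 0" using i by simp
  note facts = prob_space_M indep law dist mom neg P
  show "unif_tail P {1..} M (\<lambda>n. Zsel n i)"
    unfolding Zsel_def[abs_def] by (rule unif_tail_affine_walk[OF facts])
  show "AE w in M n. \<forall>N. r i / 2 * real N \<le> real (card {m. m < N \<and> selected (X n) i m w}) + Zsel n i w" if "n \<in> {1..}"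
  proof (rule eventually_mono)
    show "AE w in M n. \<forall>m. real m * (r i / 2) + (- 1) * (\<Sum>l<m. of_bool (selected (X n) i l w)) \<le> Zsel n i w"
      unfolding Zsel_def
      by (rule AE_affine_walk[where M=M and J="{1..}" and V="\<lambda>n l w. of_bool (selected (X n) i l w)", OF facts that])
    fix w assume *: "\<forall>m. real m * (r i / 2) + (- 1) * (\<Sum>l<m. of_bool (selected (X n) i l w)) \<le> Zsel n i w"
    have "(\<Sum>l<N. of_bool (selected (X n) i l w)) = real (card {m. m < N \<and> selected (X n) i m w})" for N
      by (simp add: sum.If_cases of_bool_def lessThan_def Collect_conj_eq[symmetric])
    then show "\<forall>N. r i / 2 * real N \<le> real (card {m. m < N \<and> selected (X n) i m w}) + Zsel n i w"
      using * by (simp add: algebra_simps)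
  qed
qed

lemma nuS_moment_2: "integrable (nuS k) (\<lambda>x. \<bar>x\<bar> ^ Suc 1)"
proof -
  have "(\<lambda>x::real. \<bar>x\<bar> ^ Suc 1) = power2" by (simp add: fun_eq_iff power2_eq_square)
  then show ?thesis using service_sq[of k] by simp
qed

text \<open>Only countably many almost sure statements are combined. The subcritical slope in
  \<open>service_growth\<close> is \<open>u k\<close>, as \<open>lam' k * u k\<close> is one summand
  of the perturbed load.\<close>

lemma AE_regular_path:
  assumes n: "n \<in> {1..}"
  shows "AE w in M n. regular_path (X n) w lam' (\<lambda>k. ZA n k w)"
proof -
  interpret binomial_exhaustive_system I lam nuS "nuV n" L r "X n" using system n by auto
  have "AE w in M n. service (X n) k l w \<ge> 0" for k l
    using service_AE_nonneg[of k] unfolding service_law[of k l, symmetric]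
    by (subst (asm) AE_distr_iff) auto
  then have 1: "AE w in M n. \<forall>k l. service (X n) k l w \<ge> 0" by (simp add: AE_all_countable)
  have "AE w in M n. switchover (X n) j w \<ge> 0" for j
  proof -
    have "AE x in nuV n (j mod I). x \<ge> 0" using switch_AE_nonneg[of n "j mod I"] n I_pos by simp
    then show ?thesis unfolding switchover_law[of j, symmetric]
      by (subst (asm) AE_distr_iff) auto
  qed
  then have 2: "AE w in M n. \<forall>j. switchover (X n) j w \<ge> 0" by (simp add: AE_all_countable)
  have 3: "AE w in M n. \<forall>k m. real m / lam' k \<le> (\<Sum>l<m. interarrival (X n) k l w) + ZA n k w"
    using AE_ZA[OF le_refl n] by (simp add: AE_all_countable)
  have 4: "AE w in M n. \<forall>k m. (\<Sum>l<m. service (X n) k l w) \<le> u k * real m + ZS_up n k w"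
    using AE_ZS_up[OF le_refl nuS_moment_2 n] by (simp add: AE_all_countable)
  from 1 2 3 4 show ?thesis
  proof eventually_elim
    case (elim w)
    show ?case
    proof
      show "\<exists>h Z. lam' k * h < 1 \<and> (\<forall>m. (\<Sum>l<m. service (X n) k l w) \<le> h * real m + Z)" for k
        using elim(4) lam'_u_less_1[of k] by blast
      show "0 \<le> ZA n k w" for k by (simp add: ZA_def walk_sup_nonneg)
    qed (use elim lam'_pos in auto)
  qed
qed

lemma unif_tail_switchover:
  assumes P: "P \<ge> 1"
  shows "unif_tail P {1..} M (\<lambda>n w. switchover (X n) j w / real n)"
proof -
  have "j mod I < I" using I_pos by simp
  from switch_moments[OF this, of "Suc P"] P obtain B where
    B: "\<And>n. n \<ge> 1 \<Longrightarrow> (\<integral>\<^sup>+x. ennreal (\<bar>x / real n\<bar> ^ Suc P) \<partial>nuV n (j mod I)) \<le> ennreal B" by auto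
  show ?thesis
  proof (rule unif_tail_moment[OF _ P])
    fix n :: nat assume n: "n \<in> {1..}"
    interpret binomial_exhaustive_system I lam nuS "nuV n" L r "X n" using system n by auto
    show "(\<lambda>w. switchover (X n) j w / real n) \<in> borel_measurable (M n)" by simp
    show "(\<integral>\<^sup>+w. ennreal (\<bar>switchover (X n) j w / real n\<bar> ^ Suc P) \<partial>M n) \<le> ennreal B"
    proof -
      have "(\<integral>\<^sup>+x. ennreal (\<bar>x / real n\<bar> ^ Suc P) \<partial>nuV n (j mod I)) \<le> ennreal B" using B[of n] n by simp
      then show ?thesis unfolding switchover_law[of j, symmetric]
        by (subst (asm) nn_integral_distr) (simp_all del: power_Suc)
    qed
  qed
qed

definition W :: "nat \<Rightarrow> ('w \<Rightarrow> nat^'k) \<Rightarrow> 'w \<Rightarrow> real" where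
  "W n Q w = (\<Sum>k\<in>UNIV. u k * real (Q w $ k)) / real n"

lemma distr_W:
  assumes n: "n \<in> {1..}"
  shows "distr (M n) borel (W n (embedded_chain I p L (X n) 1)) = distr (M n) borel (W n (init (X n)))"
proof -
  interpret binomial_exhaustive_system I lam nuS "nuV n" L r "X n" using system n by auto
  let ?f = "\<lambda>v :: nat^'k. (\<Sum>k\<in>UNIV. u k * real (v $ k)) / real n"
  have "distr (distr (M n) (count_space UNIV) (embedded_chain I p L (X n) 1)) borel ?f =
      distr (distr (M n) (count_space UNIV) (init (X n))) borel ?f"
    using stationary n by (simp add: stationary_start_def)
  then show ?thesis
    unfolding W_def[abs_def]
    by (subst (asm) (1 2) distr_distr) (auto simp: comp_def measurable_embedded_chain)
qed

end

text \<open>Converts the pessimistic service rate \<open>(1 - e) / m\<close> into the Lyapunov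
  weight \<open>(1 + e) / m\<close>; the factor 3 suffices because
  \<open>(1 + e) / 3 \<le> 1 - e\<close> for \<open>e \<le> 1 / 2\<close>.\<close>

lemma mult_mono_third:
  fixes e m \<theta> \<theta>0 x :: real
  assumes "0 < e" "e \<le> 1 / 2" "0 < m" "0 \<le> \<theta>0" "\<theta>0 \<le> \<theta>" "0 \<le> x"
  shows "\<theta>0 / 3 * ((1 + e) / m * x) \<le> (1 - e) / m * (\<theta> * x)"
proof -
  have "\<theta>0 * ((1 + e) / 3) \<le> \<theta> * (1 - e)"
    using assms by (intro mult_mono) auto
  then have "\<theta>0 * ((1 + e) / 3) * (x / m) \<le> \<theta> * (1 - e) * (x / m)"
    using assms by (intro mult_right_mono) auto
  then show ?thesis by (simp add: mult_ac)
qed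

section \<open>Lyapunov drift over a cycle\<close>

context polling_family
begin

lemma weights_nonneg[simp]: "0 \<le> lam' k" "0 \<le> u k" "0 \<le> mu k"
  by (simp_all add: less_imp_le lam'_pos u_pos mu_pos)

text \<open>The Lyapunov function is the workload \<open>W\<close>. Over a cycle it decreases by a multiple of the
  cycle length, which in turn dominates a multiple of the initial workload, since from each queue
  some visit serves a positive fraction of the customers.\<close>

lemma unif_tail_cycle:
  fixes E :: "nat \<Rightarrow> 'k \<Rightarrow> 'w \<Rightarrow> real"
  assumes P: "P \<ge> 1" and E_nonneg: "\<And>n k w. 0 \<le> E n k w"
    and E_tail: "\<And>k. unif_tail P {1..} M (\<lambda>n w. E n k w / real n)"
    and E_up: "\<And>n k. n \<in> {1..} \<Longrightarrow>
      AE w in M n. (\<Sum>l<C n k w. service (X n) k l w) \<le> u k * real (C n k w) + E n k w"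
    and E_low: "\<And>n k. n \<in> {1..} \<Longrightarrow>
      AE w in M n. (1 - eta) / mu k * real (C n k w) \<le> (\<Sum>l<C n k w. service (X n) k l w) + E n k w"
  shows "\<exists>G. unif_tail P {1..} M G \<and> (\<forall>n\<in>{1..}. AE w in M n. 0 \<le> G n w \<and> T n w \<le> real n * G n w \<and>
    (\<forall>k. init_queue n k w + real (arrivals (X n) k (T n w) w) \<le> real n * G n w))"
proof -
  have "\<forall>k. \<exists>i. i < I * L \<and> p (i mod I) = k \<and> r i > 0" using visit by blast
  then obtain i0 where i0: "\<And>k. i0 k < I * L" "\<And>k. p (i0 k mod I) = k" "\<And>k. r (i0 k) > 0" by metis
  define \<theta> where "\<theta> k = r (i0 k) / 2" for k
  have \<theta>: "0 < \<theta> k" "\<theta> k \<le> 1" for k using i0(3)[of k] r_le_1[OF i0(1)[of k]] by (auto simp: \<theta>_def)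
  define \<theta>0 where "\<theta>0 = Min (range \<theta>)"
  have \<theta>0: "0 < \<theta>0" "\<theta>0 \<le> 1" "\<And>k. \<theta>0 \<le> \<theta> k"
  proof -
    show le: "\<theta>0 \<le> \<theta> k" for k unfolding \<theta>0_def by (intro Min_le) auto
    show "0 < \<theta>0" unfolding \<theta>0_def using \<theta> by (subst Min_gr_iff) auto
    show "\<theta>0 \<le> 1" using le \<theta>(2) by (rule order_trans)
  qed
  define K where "K = real CARD('k)"
  have K: "K \<ge> 1" unfolding K_def by (metis One_nat_def Suc_leI of_nat_1 of_nat_mono zero_less_card_finite)
  define \<rho> where "\<rho> = (\<Sum>k\<in>UNIV. u k * lam' k)"
  have \<rho>: "\<rho> < 1" "0 \<le> \<rho>"
    using sum_u_lam' by (auto simp: \<rho>_def intro!: sum_nonneg mult_nonneg_nonneg weights_nonneg)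
  \<comment> \<open>Adding one lower bound for the cycle length per queue bounds \<open>K\<close>
    copies of it; \<kappa> rescales these to the drift term \<open>(1 - \<rho>) * T\<close>.\<close>
  define \<kappa> where "\<kappa> = (1 - \<rho>) / K"
  have \<kappa>: "0 < \<kappa>" "\<kappa> \<le> 1" "\<kappa> * K = 1 - \<rho>"
    using \<rho> K by (auto simp: \<kappa>_def divide_le_eq)
  define \<gamma> where "\<gamma> = 1 - \<kappa> * (\<theta>0 / 3)"
  have \<gamma>: "0 \<le> \<gamma>" "\<gamma> < 1"
    using \<kappa> \<theta>0 mult_mono[of \<kappa> 1 "\<theta>0 / 3" 1] by (auto simp: \<gamma>_def)
  \<comment> \<open>All errors of \<open>cycle_drift\<close> and, with weight \<kappa>, those of
    \<open>T_low\<close>. The service error \<open>E\<close> stays abstract because it is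
    instantiated by walk suprema first and by a centred sum later.\<close>
  define U where "U n w = (\<Sum>j<I * L. switchover (X n) j w) + (\<Sum>k\<in>UNIV. E n k w) + (\<Sum>k\<in>UNIV. u k * lam' k * ZA n k w)
    + (\<Sum>k\<in>UNIV. \<kappa> * (1 / mu k * Zsel n (i0 k) w + E n k w))" for n w
  note Z0 = walk_sup_nonneg[of "\<lambda>l. 1 / lam' k + (- 1) * interarrival (X n) k l w" for n k w, folded ZA_def]
    walk_sup_nonneg[of "\<lambda>l. r i / 2 + (- 1) * of_bool (selected (X n) i l w)" for n i w, folded Zsel_def]
  have tails: "unif_tail P {1..} M (\<lambda>n w. ZA n k w / real n)" "unif_tail P {1..} M (\<lambda>n w. Zsel n (i0 k) w / real n)" for k
    using unif_tail_div[OF unif_tail_ZA[OF P]] unif_tail_div[OF unif_tail_Zsel[OF i0(1) i0(3) P]] Z0 by auto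
  have U_eq: "U n w / real n = (\<Sum>j<I * L. switchover (X n) j w / real n) + (\<Sum>k\<in>UNIV. E n k w / real n)
    + (\<Sum>k\<in>UNIV. u k * lam' k * (ZA n k w / real n))
    + (\<Sum>k\<in>UNIV. \<kappa> * (1 / mu k * (Zsel n (i0 k) w / real n) + E n k w / real n))" for n w
    unfolding U_def by (simp add: add_divide_distrib sum_divide_distrib distrib_left)
  have U_tail: "unif_tail P {1..} M (\<lambda>n w. U n w / real n)"
    unfolding U_eq
    by (intro unif_tail_add unif_tail_sum unif_tail_cmult unif_tail_switchover P tails E_tail)
      (use \<kappa> in \<open>auto intro: weights_nonneg\<close>)
  let ?W0 = "\<lambda>n. W n (init (X n))" and ?W1 = "\<lambda>n. W n (embedded_chain I p L (X n) 1)"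
  have drift: "AE w in M n. (\<forall>k. init_queue n k w + real (arrivals (X n) k (T n w) w) \<le>
        init_queue n k w + lam' k * (T n w + ZA n k w)) \<and> 0 \<le> T n w \<and> 0 \<le> U n w \<and>
      real n * ?W1 n w \<le> \<gamma> * (real n * ?W0 n w) + U n w \<and> (1 - \<rho>) * T n w \<le> real n * ?W0 n w + U n w"
    if n: "n \<in> {1..}" for n
  proof -
    have up: "AE w in M n. \<forall>k. (\<Sum>l<C n k w. service (X n) k l w) \<le> u k * real (C n k w) + E n k w"
      using E_up[OF n] by (simp add: AE_all_countable)
    have low: "AE w in M n. \<forall>k. (1 - eta) / mu k * real (C n k w) \<le> (\<Sum>l<C n k w. service (X n) k l w) + E n k w"
      using E_low[OF n] by (simp add: AE_all_countable)
    have sel: "AE w in M n. \<forall>k N. \<theta> k * real N \<le> real (card {m. m < N \<and> selected (X n) (i0 k) m w}) + Zsel n (i0 k) w"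
      using AE_Zsel[OF i0(1) i0(3) le_refl n] by (simp add: AE_all_countable \<theta>_def)
    from AE_regular_path[OF n] up low sel show ?thesis
    proof eventually_elim
      case (elim w)
      interpret regular_path I p "X n" w lam' "\<lambda>k. ZA n k w" by (rule elim(1))
      have n0: "real n > 0" using n by simp
      have W0: "real n * ?W0 n w = (\<Sum>k\<in>UNIV. u k * init_queue n k w)" using n0 by (simp add: W_def)
      have W1: "real n * ?W1 n w = (\<Sum>k\<in>UNIV. u k * real (found (X n) k (T n w) (C n k w) w))"
        using n0 by (simp add: W_def embedded_chain_def Let_def)
      have W1_nonneg: "0 \<le> real n * ?W1 n w"
        unfolding W1 by (intro sum_nonneg mult_nonneg_nonneg weights_nonneg) simp
      have T_nonneg: "0 \<le> T n w" by (rule PE_nonneg)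
      have V: "0 \<le> (\<Sum>j<I * L. switchover (X n) j w)" by (intro sum_nonneg switchover_nonneg)
      have rest: "0 \<le> (\<Sum>k\<in>UNIV. \<kappa> * (1 / mu k * Zsel n (i0 k) w + E n k w))"
        using \<kappa> by (intro sum_nonneg mult_nonneg_nonneg add_nonneg_nonneg E_nonneg Z0) (auto intro: weights_nonneg)
      have U0: "0 \<le> U n w"
        unfolding U_def using V rest
        by (intro add_nonneg_nonneg sum_nonneg mult_nonneg_nonneg E_nonneg Z0 switchover_nonneg)
          (use \<kappa> in auto)
      have main: "real n * ?W1 n w \<le> real n * ?W0 n w - (1 - \<rho>) * T n w
          + (\<Sum>j<I * L. switchover (X n) j w) + (\<Sum>k\<in>UNIV. E n k w) + (\<Sum>k\<in>UNIV. u k * lam' k * ZA n k w)"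
        unfolding W0 W1 \<rho>_def
        using cycle_drift[where u=u and E="\<lambda>k. E n k w" and j="I * L"] elim(2) by simp
      \<comment> \<open>The cycle contains the time of all class-\<open>k\<close> services, and
        these are at least a fraction \<open>\<theta> k\<close> of the initial queue up to selection
        and service errors.\<close>
      have T_low: "\<theta>0 / 3 * (u k * init_queue n k w) \<le> T n w + (1 / mu k * Zsel n (i0 k) w + E n k w)" for k
      proof -
        have "(\<Sum>l<C n k w. service (X n) k l w) \<le> (\<Sum>k\<in>UNIV. \<Sum>l<C n k w. service (X n) k l w)"
          by (rule member_le_sum[of k UNIV "\<lambda>k. \<Sum>l<C n k w. service (X n) k l w"]) (auto intro!: sum_nonneg service_nonneg)
        then have S: "(\<Sum>l<C n k w. service (X n) k l w) \<le> T n w"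
          using V PE_eq[of "I * L"] by linarith
        have "\<theta> k * init_queue n k w \<le> real (C n k w) + Zsel n (i0 k) w"
          using i0 \<theta> elim(4) by (intro CB_lower[of "i0 k"]) (simp_all add: less_imp_le)
        then have "(1 - eta) / mu k * (\<theta> k * init_queue n k w) \<le> (1 - eta) / mu k * (real (C n k w) + Zsel n (i0 k) w)"
          using eta mu_pos[of k] by (intro mult_left_mono) auto
        also have "\<dots> \<le> (1 - eta) / mu k * real (C n k w) + 1 / mu k * Zsel n (i0 k) w"
        proof -
          have "(1 - eta) / mu k * Zsel n (i0 k) w \<le> 1 / mu k * Zsel n (i0 k) w"
            using eta mu_pos[of k] Z0(2) by (intro mult_right_mono divide_right_mono) (simp_all add: less_imp_le)
          then show ?thesis by (simp add: distrib_left)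
        qed
        also have "(1 - eta) / mu k * real (C n k w) \<le> T n w + E n k w"
          using elim(3) S by (meson add_right_mono order_trans)
        finally have "(1 - eta) / mu k * (\<theta> k * init_queue n k w) \<le> T n w + (1 / mu k * Zsel n (i0 k) w + E n k w)"
          by simp
        moreover have "\<theta>0 / 3 * (u k * init_queue n k w) \<le> (1 - eta) / mu k * (\<theta> k * init_queue n k w)"
          unfolding u_def using eta mu_pos \<theta>0 by (intro mult_mono_third) (simp_all add: less_imp_le)
        ultimately show ?thesis by linarith
      qed
      have "(\<Sum>k\<in>UNIV. \<theta>0 / 3 * (u k * init_queue n k w)) \<le> (\<Sum>k\<in>UNIV. T n w + (1 / mu k * Zsel n (i0 k) w + E n k w))"
        by (intro sum_mono T_low)
      then have "\<theta>0 / 3 * (real n * ?W0 n w) \<le> K * T n w + (\<Sum>k\<in>UNIV. 1 / mu k * Zsel n (i0 k) w + E n k w)"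
        unfolding W0 K_def sum_distrib_left by (simp add: sum.distrib)
      then have "\<kappa> * (\<theta>0 / 3 * (real n * ?W0 n w)) \<le> \<kappa> * (K * T n w + (\<Sum>k\<in>UNIV. 1 / mu k * Zsel n (i0 k) w + E n k w))"
        using \<kappa> by (intro mult_left_mono) auto
      also have "\<dots> = (1 - \<rho>) * T n w + (\<Sum>k\<in>UNIV. \<kappa> * (1 / mu k * Zsel n (i0 k) w + E n k w))"
        unfolding \<kappa>(3)[symmetric] by (simp add: distrib_left sum_distrib_left)
      finally have low': "\<kappa> * (\<theta>0 / 3) * (real n * ?W0 n w) \<le> (1 - \<rho>) * T n w + (\<Sum>k\<in>UNIV. \<kappa> * (1 / mu k * Zsel n (i0 k) w + E n k w))"
        by (simp only: mult.assoc)
      have "\<gamma> * (real n * ?W0 n w) = real n * ?W0 n w - \<kappa> * (\<theta>0 / 3) * (real n * ?W0 n w)"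
        unfolding \<gamma>_def by (simp add: left_diff_distrib)
      then have "real n * ?W1 n w \<le> \<gamma> * (real n * ?W0 n w) + U n w"
        using main low' unfolding U_def by linarith
      moreover have "(1 - \<rho>) * T n w \<le> real n * ?W0 n w + U n w"
        using main W1_nonneg rest unfolding U_def by linarith
      ultimately show ?case using arrivals_upper[OF T_nonneg] T_nonneg U0 by simp
    qed
  qed
  have W_meas: "?W0 n \<in> borel_measurable (M n)" "?W1 n \<in> borel_measurable (M n)" if n: "n \<in> {1..}" for n
  proof -
    interpret binomial_exhaustive_system I lam nuS "nuV n" L r "X n" using system n by auto
    note [measurable] = measurable_embedded_chain_nth[of I p L 1]
    show "?W0 n \<in> borel_measurable (M n)" "?W1 n \<in> borel_measurable (M n)" unfolding W_def[abs_def] by measurable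
  qed
  have W_tail: "unif_tail P {1..} M ?W0"
  proof (rule unif_tail_stationary[OF prob_space_M W_meas distr_W U_tail \<gamma>])
    fix n :: nat assume n: "n \<in> {1..}"
    then have n0: "real n > 0" by simp
    show "AE w in M n. ?W1 n w \<le> \<gamma> * ?W0 n w + U n w / real n"
      using drift[OF n]
    proof eventually_elim
      case (elim w)
      then have "real n * ?W1 n w \<le> real n * (\<gamma> * ?W0 n w + U n w / real n)"
        using n0 by (simp add: distrib_left mult.left_commute)
      then show ?case using n0 by (simp only: mult_le_cancel_left_pos)
    qed
  qed
  \<comment> \<open>\<open>S = (n * W0 + U) / (1 - \<rho>)\<close> bounds the cycle length. In
    \<open>a\<close> the summand 1 pays for this length itself and the sum of the
    \<open>lam' k\<close> for the arrivals during it; the second part of \<open>G\<close> pays for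
    the initial queues and the arrival errors.\<close>
  define a where "a = (1 + (\<Sum>k\<in>UNIV. lam' k)) / (1 - \<rho>)"
  define G where "G n w = a * (?W0 n w + U n w / real n) + (\<Sum>k\<in>UNIV. 1 / u k * ?W0 n w + lam' k * (ZA n k w / real n))" for n w
  have sl: "0 \<le> (\<Sum>k\<in>UNIV. lam' k)" by (intro sum_nonneg weights_nonneg)
  have "unif_tail P {1..} M G"
    unfolding G_def[abs_def] using sl \<rho>
    by (intro unif_tail_add unif_tail_sum unif_tail_cmult W_tail U_tail tails P)
      (auto simp: a_def intro: weights_nonneg)
  moreover have "AE w in M n. 0 \<le> G n w \<and> T n w \<le> real n * G n w \<and>
    (\<forall>k. init_queue n k w + real (arrivals (X n) k (T n w) w) \<le> real n * G n w)" if n: "n \<in> {1..}" for n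
    using drift[OF n]
  proof eventually_elim
    case (elim w)
    have n0: "real n > 0" using n by simp
    let ?R = "\<lambda>k. 1 / u k * (real n * ?W0 n w) + lam' k * ZA n k w"
    let ?S = "(real n * ?W0 n w + U n w) / (1 - \<rho>)"
    have nG: "real n * G n w = (1 + (\<Sum>k\<in>UNIV. lam' k)) * ?S + (\<Sum>k\<in>UNIV. ?R k)"
    proof -
      have "real n * (a * (?W0 n w + U n w / real n)) = a * (real n * (?W0 n w + U n w / real n))"
        by (rule mult.left_commute)
      also have "real n * (?W0 n w + U n w / real n) = real n * ?W0 n w + U n w"
        using n0 by (simp add: distrib_left)
      finally have "real n * (a * (?W0 n w + U n w / real n)) = (1 + (\<Sum>k\<in>UNIV. lam' k)) * ?S"
        by (simp add: a_def)
      moreover have "real n * (\<Sum>k\<in>UNIV. 1 / u k * ?W0 n w + lam' k * (ZA n k w / real n)) = (\<Sum>k\<in>UNIV. ?R k)"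
        unfolding sum_distrib_left using n0 by (intro sum.cong) (simp_all add: distrib_left)
      ultimately show ?thesis unfolding G_def distrib_left[of "real n"] by simp
    qed
    have W0n: "0 \<le> real n * ?W0 n w"
      unfolding W_def by (intro mult_nonneg_nonneg divide_nonneg_nonneg sum_nonneg) (auto intro: weights_nonneg)
    have W0n': "0 \<le> ?W0 n w" using W0n n0 by (simp add: zero_le_mult_iff)
    have R0: "0 \<le> ?R k" for k
      using W0n' by (simp add: Z0)
    have TS: "T n w \<le> ?S" using elim \<rho> by (simp add: pos_le_divide_eq mult.commute)
    then have S0: "0 \<le> ?S" using elim by linarith
    have prod0: "0 \<le> (\<Sum>k\<in>UNIV. lam' k) * ?S" using sl S0 by (rule mult_nonneg_nonneg)
    have sum0: "0 \<le> (\<Sum>k\<in>UNIV. ?R k)" by (intro sum_nonneg R0)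
    have G1: "?S \<le> real n * G n w" unfolding nG distrib_right using prod0 sum0 by simp
    have "init_queue n k w + real (arrivals (X n) k (T n w) w) \<le> real n * G n w" for k
    proof -
      have "u k * init_queue n k w \<le> real n * ?W0 n w"
        using n0 member_le_sum[of k UNIV "\<lambda>k. u k * init_queue n k w"] u_pos by (simp add: W_def less_imp_le)
      then have "init_queue n k w \<le> 1 / u k * (real n * ?W0 n w)"
        using u_pos[of k] by (simp add: pos_le_divide_eq mult.commute)
      moreover have "lam' k * T n w \<le> (\<Sum>k\<in>UNIV. lam' k) * ?S"
        using TS elim by (intro mult_mono member_le_sum sl) (auto intro: weights_nonneg)
      moreover have "?R k \<le> (\<Sum>k\<in>UNIV. ?R k)" by (intro member_le_sum R0) auto
      moreover have "init_queue n k w + real (arrivals (X n) k (T n w) w) \<le> init_queue n k w + lam' k * (T n w + ZA n k w)"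
        using elim by blast
      ultimately show ?thesis unfolding nG distrib_right distrib_left using S0 by linarith
    qed
    moreover have "T n w \<le> real n * G n w" using TS G1 by linarith
    moreover have "0 \<le> G n w" using S0 G1 n0 by (metis order_trans zero_le_mult_iff less_le_not_le)
    ultimately show ?case by blast
  qed
  ultimately show ?thesis by blast
qed

end

lemma abs_set_integral_le:
  fixes f :: "real \<Rightarrow> real"
  assumes a: "0 \<le> a" and f: "\<And>v. v \<in> {0..a} \<Longrightarrow> 0 \<le> f v" "\<And>v. v \<in> {0..a} \<Longrightarrow> f v \<le> c"
  shows "\<bar>LINT v:{0..a}|lborel. f v\<bar> \<le> a * c"
proof -
  have c: "0 \<le> c" using f[of 0] a by auto
  have "\<bar>LINT v:{0..a}|lborel. f v\<bar> \<le> (\<integral>v. norm (indicator {0..a} v *\<^sub>R f v) \<partial>lborel)"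
    unfolding set_lebesgue_integral_def using integral_norm_bound[of lborel "\<lambda>v. indicator {0..a} v *\<^sub>R f v"] by simp
  also have "\<dots> \<le> (\<integral>v. indicator {0..a} v *\<^sub>R c \<partial>lborel)"
  proof (rule integral_mono')
    show "integrable lborel (\<lambda>v. indicator {0..a} v *\<^sub>R c)"
      by (intro integrable_scaleR_left integrable_real_indicator) (simp_all add: a)
  qed (use c f in \<open>auto simp: indicator_def\<close>)
  also have "\<dots> = a * c" using a by simp
  finally show ?thesis .
qed

section \<open>Cycle bounds under the two service conditions, and the cost\<close>

context polling_family
begin

text \<open>The services are controlled at their random number by suprema over all indices, at the
  price of one moment. Adding the upper and the lower supremum gives a single error for both
  inequalities.\<close>

lemma unif_tail_cycle_service_moments:
  assumes P: "P \<ge> 1" and mom: "\<And>k. integrable (nuS k) (\<lambda>x. \<bar>x\<bar> ^ Suc P)"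
  shows "\<exists>G. unif_tail P {1..} M G \<and> (\<forall>n\<in>{1..}. AE w in M n. 0 \<le> G n w \<and> T n w \<le> real n * G n w \<and>
    (\<forall>k. init_queue n k w + real (arrivals (X n) k (T n w) w) \<le> real n * G n w))"
proof (rule unif_tail_cycle[OF P, where E="\<lambda>n k w. ZS_up n k w + ZS_low n k w"])
  show "0 \<le> ZS_up n k w + ZS_low n k w" for n k w
    by (simp add: ZS_up_def ZS_low_def walk_sup_nonneg)
  show "unif_tail P {1..} M (\<lambda>n w. (ZS_up n k w + ZS_low n k w) / real n)" for k
    by (intro unif_tail_div unif_tail_add unif_tail_ZS_up unif_tail_ZS_low P mom)
      (simp add: ZS_up_def ZS_low_def walk_sup_nonneg)
  fix n :: nat and k assume n: "n \<in> {1..}"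
  have up: "0 \<le> ZS_up n k w" and low: "0 \<le> ZS_low n k w" for w
    by (simp_all add: ZS_up_def ZS_low_def walk_sup_nonneg)
  show "AE w in M n. (\<Sum>l<C n k w. service (X n) k l w) \<le> u k * real (C n k w) + (ZS_up n k w + ZS_low n k w)"
    using AE_ZS_up[where k=k, OF P mom n]
  proof eventually_elim
    case (elim w)
    from spec[OF elim, of "C n k w"] low[of w] show ?case by linarith
  qed
  show "AE w in M n. (1 - eta) / mu k * real (C n k w) \<le> (\<Sum>l<C n k w. service (X n) k l w) + (ZS_up n k w + ZS_low n k w)"
    using AE_ZS_low[where k=k, OF P mom n]
  proof eventually_elim
    case (elim w)
    from spec[OF elim, of "C n k w"] up[of w] show ?case by linarith
  qed
qed

text \<open>With two service moments the supremum of the service walk has only a first moment. This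
  yields mean cycle lengths of order \<open>n\<close>, and Wald's identity then gives the second moments.\<close>

lemma unif_tail_cycle_square:
  "\<exists>G. unif_tail 2 {1..} M G \<and> (\<forall>n\<in>{1..}. AE w in M n. 0 \<le> G n w \<and> T n w \<le> real n * G n w \<and>
    (\<forall>k. init_queue n k w + real (arrivals (X n) k (T n w) w) \<le> real n * G n w))"
proof -
  obtain G where G: "unif_tail 1 {1..} M G" and G_bound: "\<And>n. n \<in> {1..} \<Longrightarrow>
      AE w in M n. 0 \<le> G n w \<and> T n w \<le> real n * G n w \<and>
        (\<forall>k. init_queue n k w + real (arrivals (X n) k (T n w) w) \<le> real n * G n w)"
    using unif_tail_cycle_service_moments[OF le_refl nuS_moment_2] by blast
  obtain B where B: "B \<ge> 0" "\<And>n. n \<in> {1..} \<Longrightarrow> (\<integral>\<^sup>+w. ennreal (G n w) \<partial>M n) \<le> ennreal B"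
    using unif_tail_1_bound[OF G prob_space_M] by blast
  define D where "D n k w = (\<Sum>l<C n k w. service (X n) k l w - 1 / mu k)" for n k w
  have D_eq: "(\<Sum>l<C n k w. service (X n) k l w) = 1 / mu k * real (C n k w) + D n k w" for n k w
    by (simp add: D_def sum_subtractf)
  \<comment> \<open>The number of services is at most the initial queue plus the arrivals of the
    cycle, which the first-order bound \<open>G\<close> already dominates.\<close>
  have C_mean: "(\<integral>\<^sup>+w. ennreal (real (C n k w)) \<partial>M n) \<le> ennreal (real n * B)" if n: "n \<in> {1..}" for n k
  proof -
    note [measurable] = unif_tail_measurable[OF G n]
    have "(\<integral>\<^sup>+w. ennreal (real (C n k w)) \<partial>M n) \<le> (\<integral>\<^sup>+w. ennreal (real n) * ennreal (G n w) \<partial>M n)"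
    proof (rule nn_integral_mono_AE)
      show "AE w in M n. ennreal (real (C n k w)) \<le> ennreal (real n) * ennreal (G n w)"
        using AE_regular_path[OF n] G_bound[OF n]
      proof eventually_elim
        case (elim w)
        interpret regular_path I p "X n" w lam' "\<lambda>k. ZA n k w" by (rule elim(1))
        have "real (C n k w) \<le> init_queue n k w + real (arrivals (X n) k (T n w) w)"
          using CB_le[of "I * L" k] by linarith
        also have "\<dots> \<le> real n * G n w" using elim by blast
        finally show ?case using elim by (simp add: ennreal_mult[symmetric] ennreal_leI)
      qed
    qed
    also have "\<dots> = ennreal (real n) * (\<integral>\<^sup>+w. ennreal (G n w) \<partial>M n)" by (rule nn_integral_cmult) measurable
    also have "\<dots> \<le> ennreal (real n) * ennreal B" by (intro mult_left_mono B n) simp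
    finally show ?thesis using B by (simp add: ennreal_mult)
  qed
  have D_meas: "D n k \<in> borel_measurable (M n)" if n: "n \<in> {1..}" for n k
  proof -
    interpret binomial_exhaustive_system I lam nuS "nuV n" L r "X n" using system n by auto
    have "(\<lambda>w. \<Sum>l<m. service (X n) k l w - 1 / mu k) \<in> borel_measurable (M n)" for m by measurable
    from measurable_compose_countable[OF this measurable_completed_before[of I p "I * L" k]]
    show ?thesis unfolding D_def[abs_def] .
  qed
  define v where "v k = (\<integral>x. (x - 1 / mu k)\<^sup>2 \<partial>nuS k)" for k
  have v: "0 \<le> v k" for k by (simp add: v_def)
  \<comment> \<open>Wald's identity bounds the second moment of \<open>D\<close> by
    \<open>v k * (real n * B)\<close>; division by the square of \<open>n\<close> leaves order
    \<open>1 / n\<close>, the situation of \<open>unif_tail_vanishing\<close>.\<close>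
  have D_tail: "unif_tail 2 {1..} M (\<lambda>n w. \<bar>D n k w\<bar> / real n)" for k
  proof (rule unif_tail_vanishing[where C="v k * B"])
    fix n :: nat assume n: "n \<in> {1..}"
    interpret binomial_exhaustive_system I lam nuS "nuV n" L r "X n" using system n by auto
    note [measurable] = D_meas[OF n]
    show "(\<lambda>w. \<bar>D n k w\<bar> / real n) \<in> borel_measurable (M n)" by measurable
    have wald: "(\<integral>\<^sup>+w. ennreal ((D n k w)\<^sup>2) \<partial>M n) \<le> ennreal (v k) * (\<integral>\<^sup>+w. ennreal (real (C n k w)) \<partial>M n)"
      unfolding D_def v_def
      by (rule wald_services[OF _ service_dist service_sq service_mean])
        (use AE_regular_path[OF n] in \<open>auto elim: eventually_mono\<close>)
    have "(\<integral>\<^sup>+w. ennreal (\<bar>\<bar>D n k w\<bar> / real n\<bar> ^ 2) \<partial>M n) = (\<integral>\<^sup>+w. ennreal (1 / (real n)\<^sup>2) * ennreal ((D n k w)\<^sup>2) \<partial>M n)"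
      by (intro nn_integral_cong) (simp add: ennreal_mult[symmetric] power_divide)
    also have "\<dots> = ennreal (1 / (real n)\<^sup>2) * (\<integral>\<^sup>+w. ennreal ((D n k w)\<^sup>2) \<partial>M n)"
      by (rule nn_integral_cmult) measurable
    also have "\<dots> \<le> ennreal (1 / (real n)\<^sup>2) * (ennreal (v k) * ennreal (real n * B))"
      by (intro mult_left_mono order_trans[OF wald] C_mean n) auto
    also have "\<dots> = ennreal (1 / (real n)\<^sup>2 * (v k * (real n * B)))"
      using v[of k] B(1) by (simp add: ennreal_mult[symmetric])
    also have "1 / (real n)\<^sup>2 * (v k * (real n * B)) = v k * B / real n"
      using n by (simp add: power2_eq_square)
    finally show "(\<integral>\<^sup>+w. ennreal (\<bar>\<bar>D n k w\<bar> / real n\<bar> ^ 2) \<partial>M n) \<le> ennreal (v k * B / real n)" .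
  qed simp
  \<comment> \<open>Second run of the Lyapunov argument: the centred sum at the actual number of
    services replaces the suprema as error term.\<close>
  show ?thesis
  proof (rule unif_tail_cycle[where E="\<lambda>n k w. \<bar>D n k w\<bar>"])
    fix n :: nat and k
    have "1 / mu k \<le> u k" and "(1 - eta) / mu k \<le> 1 / mu k"
      unfolding u_def using eta mu_pos[of k] by (intro divide_right_mono; simp)+
    then have "1 / mu k * real (C n k w) \<le> u k * real (C n k w)"
      and "(1 - eta) / mu k * real (C n k w) \<le> 1 / mu k * real (C n k w)" for w
      by (intro mult_right_mono; simp)+
    then have up: "(\<Sum>l<C n k w. service (X n) k l w) \<le> u k * real (C n k w) + \<bar>D n k w\<bar>"
      and low: "(1 - eta) / mu k * real (C n k w) \<le> (\<Sum>l<C n k w. service (X n) k l w) + \<bar>D n k w\<bar>" for w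
      unfolding D_eq[of n k w] by (smt (verit))+
    show "AE w in M n. (\<Sum>l<C n k w. service (X n) k l w) \<le> u k * real (C n k w) + \<bar>D n k w\<bar>"
      by (rule AE_I2) (rule up)
    show "AE w in M n. (1 - eta) / mu k * real (C n k w) \<le> (\<Sum>l<C n k w. service (X n) k l w) + \<bar>D n k w\<bar>"
      by (rule AE_I2) (rule low)
  qed (use D_tail in auto)
qed

lemma uniformly_integrable_cycle_cost:
  assumes G: "unif_tail (Suc q) {1..} M G" and G_bound: "\<And>n. n \<in> {1..} \<Longrightarrow>
      AE w in M n. 0 \<le> G n w \<and> T n w \<le> real n * G n w \<and>
        (\<forall>k. init_queue n k w + real (arrivals (X n) k (T n w) w) \<le> real n * G n w)"
    and psi_nonneg: "\<And>x. x \<ge> 0 \<Longrightarrow> \<psi> x \<ge> 0" and psi_mono: "mono_on {0..} \<psi>"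
    and psi_cont: "continuous_on {0..} \<psi>" and p0: "0 \<le> p0" "p0 \<le> real q"
    and growth: "\<psi> \<in> O[inf at_infinity (principal {0..})](\<lambda>x. norm x powr p0)"
  shows "uniformly_integrable {1..} M (\<lambda>n. scaled_cycle_cost I p \<psi> L n (X n))"
proof -
  obtain c R where c: "0 \<le> c" "0 \<le> R"
    and psi: "\<And>x y. 0 \<le> x \<Longrightarrow> (\<And>k. x $ k \<le> y) \<Longrightarrow> \<psi> x \<le> c * (y + R) ^ q"
    using growth_bound[OF growth psi_mono p0] by blast
  show ?thesis
  proof (rule uniformly_integrable_if_unif_tail[where G="\<lambda>n w. G n w + R" and C=c and P="Suc q"])
    show "unif_tail (Suc q) {1..} M (\<lambda>n w. G n w + R)"
      by (intro unif_tail_add G unif_tail_const) simp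
    fix n :: nat assume n: "n \<in> {1..}"
    then have n0: "real n > 0" by simp
    interpret binomial_exhaustive_system I lam nuS "nuV n" L r "X n" using system n by auto
    show "scaled_cycle_cost I p \<psi> L n (X n) \<in> borel_measurable (M n)"
      by (rule measurable_scaled_cycle_cost[OF psi_cont])
    show "AE w in M n. 0 \<le> G n w + R"
      using G_bound[OF n] by eventually_elim (use c in simp)
    show "AE w in M n. \<bar>scaled_cycle_cost I p \<psi> L n (X n) w\<bar> \<le> c * (G n w + R) ^ Suc q"
      using AE_regular_path[OF n] G_bound[OF n]
    proof eventually_elim
      case (elim w)
      interpret path: regular_path I p "X n" w lam' "\<lambda>k. ZA n k w" by (rule elim(1))
      have T: "0 \<le> T n w / real n" using path.PE_nonneg n0 by simp
      have nonneg: "0 \<le> scaled_queue I p n (X n) v w" for v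
        by (simp add: scaled_queue_def less_eq_vec_def)
      \<comment> \<open>Departures are ignored: at any time of the cycle a queue is at most its
        initial length plus all arrivals up to the end of the cycle.\<close>
      have "\<psi> (scaled_queue I p n (X n) v w) \<le> c * (G n w + R) ^ q" if v: "v \<in> {0..T n w / real n}" for v
      proof (rule psi[OF nonneg])
        fix k
        have "real n * v \<le> T n w" using v n0 by (simp add: pos_le_divide_eq mult.commute)
        then have "arrivals (X n) k (real n * v) w \<le> arrivals (X n) k (T n w) w" by (rule path.arrivals_mono)
        then have "real (queue I p (X n) (real n * v) w $ k) \<le> init_queue n k w + real (arrivals (X n) k (T n w) w)"
          unfolding queue_def vec_lambda_beta by linarith
        also have "\<dots> \<le> real n * G n w" using elim by blast
        finally show "scaled_queue I p n (X n) v w $ k \<le> G n w"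
          using n0 by (simp add: scaled_queue_def pos_divide_le_eq mult.commute)
      qed
      then have "\<bar>scaled_cycle_cost I p \<psi> L n (X n) w\<bar> \<le> T n w / real n * (c * (G n w + R) ^ q)"
        unfolding scaled_cycle_cost_def using psi_nonneg nonneg T by (intro abs_set_integral_le) auto
      also have "\<dots> \<le> (G n w + R) * (c * (G n w + R) ^ q)"
      proof (rule mult_right_mono)
        have "T n w / real n \<le> G n w" using elim n0 by (simp add: pos_divide_le_eq mult.commute)
        then show "T n w / real n \<le> G n w + R" using c by simp
      qed (use elim c in simp)
      finally show ?case by (simp add: mult_ac)
    qed
  qed (use c in auto)
qed

end

theorem theorem2:
  fixes I :: nat and p :: "nat \<Rightarrow> 'k::finite"
    and lam mu :: "'k \<Rightarrow> real" and s :: "nat \<Rightarrow> real"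
    and \<psi> :: "real^'k \<Rightarrow> real" and p0 :: real
    and nuS :: "'k \<Rightarrow> real measure" and nuV :: "nat \<Rightarrow> nat \<Rightarrow> real measure"
    and L :: nat and r :: "nat \<Rightarrow> real"
    and X :: "nat \<Rightarrow> ('k, 'w) primitives"
  assumes table_surj: "p ` {..<I} = UNIV"
    and table_nonconsecutive: "\<And>i. Suc i < I \<Longrightarrow> p i \<noteq> p (Suc i)"
    and rates: "\<And>k. lam k > 0" "\<And>k. mu k > 0"
    and stable: "load lam mu < 1"
    and s_nonneg: "\<And>i. i < I \<Longrightarrow> s i \<ge> 0"
    and s_pos: "(\<Sum>i<I. s i) > 0"
    and psi_nonneg: "\<And>x. x \<ge> 0 \<Longrightarrow> \<psi> x \<ge> 0"
    and psi_mono: "mono_on {0..} \<psi>"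
    and psi_cont: "continuous_on {0..} \<psi>"
    and service_dist: "\<And>k. real_distribution (nuS k)"
    and service_nonneg: "\<And>k. AE x in nuS k. x \<ge> 0"
    and service_mean: "\<And>k. has_bochner_integral (nuS k) (\<lambda>x. x) (1 / mu k)"
    and switch_dist: "\<And>n i. n \<ge> 1 \<Longrightarrow> i < I \<Longrightarrow> real_distribution (nuV n i)"
    and switch_nonneg: "\<And>n i. n \<ge> 1 \<Longrightarrow> i < I \<Longrightarrow> AE x in nuV n i. x \<ge> 0"
    and switch_mean:
      "\<And>n i. n \<ge> 1 \<Longrightarrow> i < I \<Longrightarrow> has_bochner_integral (nuV n i) (\<lambda>x. x) (real n * s i)"
    and switch_weak:
      "\<And>i. i < I \<Longrightarrow>
         weak_conv_m (\<lambda>n. distr (nuV n i) borel (\<lambda>x. x / real n)) (return borel (s i))"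
    and p0: "p0 \<ge> 1"
    and psi_growth: "\<psi> \<in> O[inf at_infinity (principal {0..})](\<lambda>x. norm x powr p0)"
    and optimal: "optimal_parameters I p lam mu s \<psi> L r"
    and system:
      "\<And>n. n \<ge> 1 \<Longrightarrow> binomial_exhaustive_system I lam nuS (nuV n) L r (X n)"
    and stationary: "\<And>n. n \<ge> 1 \<Longrightarrow> stationary_start I p L (X n)"
    and a: "\<And>i n t. i < I \<Longrightarrow> n \<ge> 1 \<Longrightarrow> t \<ge> 0 \<Longrightarrow> integrable (nuV n i) (\<lambda>x. exp (t * x))"
    and b: "\<And>i l. i < I \<Longrightarrow> l \<ge> (2::nat) \<Longrightarrow>
              (\<lambda>n. \<integral>x. (x / real n) ^ l \<partial>nuV n i) \<longlonglongrightarrow> s i ^ l"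
    and either:
      "(p0 > 1 \<and> (\<forall>k. \<exists>\<epsilon>>0. \<forall>t\<in>{-\<epsilon><..<\<epsilon>}. integrable (nuS k) (\<lambda>x. exp (t * x)))) \<or>
       (p0 = 1 \<and> (\<forall>k. integrable (nuS k) (\<lambda>x. x\<^sup>2)))"
  shows "uniformly_integrable {1..} (\<lambda>n. prob_sp (X n))
           (\<lambda>n. scaled_cycle_cost I p \<psi> L n (X n))"
proof -
  have service_expectation: "(\<integral>x. x \<partial>nuS k) = 1 / mu k" for k
    using service_mean[of k] by (simp add: has_bochner_integral_iff)
  have moments: "integrable (nuS k) (\<lambda>x. \<bar>x\<bar> ^ q)"
    if exp: "\<forall>k. \<exists>\<epsilon>>0. \<forall>t\<in>{-\<epsilon><..<\<epsilon>}. integrable (nuS k) (\<lambda>x. exp (t * x))" for k q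
  proof -
    obtain \<epsilon> where \<epsilon>: "\<epsilon> > 0" "\<forall>t\<in>{-\<epsilon><..<\<epsilon>}. integrable (nuS k) (\<lambda>x. exp (t * x))" using exp by blast
    then have "\<epsilon> / 2 > 0" "integrable (nuS k) (\<lambda>x. exp (\<epsilon> / 2 * x))"
      using bspec[OF \<epsilon>(2), of "\<epsilon> / 2"] by simp_all
    then show ?thesis by (rule integrable_power_if_exp[OF service_dist service_nonneg])
  qed
  \<comment> \<open>Condition (b) gives convergent, hence bounded, moments. Condition (a) makes them
    integrals of integrable functions, so that they agree with the nonnegative integrals and are not
    a default value.\<close>
  have switch_bound: "\<exists>B. \<forall>n\<ge>1. (\<integral>\<^sup>+x. ennreal (\<bar>x / real n\<bar> ^ q) \<partial>nuV n i) \<le> ennreal B"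
    if i: "i < I" and q: "q \<ge> 2" for i q
  proof -
    let ?m = "\<lambda>n. \<integral>x. (x / real n) ^ q \<partial>nuV n i"
    have "Bseq ?m" using b[OF i q] by (intro convergent_imp_Bseq) (auto simp: convergent_def)
    then obtain B where B: "\<And>n. norm (?m n) \<le> B" by (auto simp: Bseq_def)
    have "(\<integral>\<^sup>+x. ennreal (\<bar>x / real n\<bar> ^ q) \<partial>nuV n i) \<le> ennreal B" if n: "n \<ge> 1" for n
    proof -
      have "integrable (nuV n i) (\<lambda>x. \<bar>x\<bar> ^ q)"
        using a[OF i n, of 1] by (intro integrable_power_if_exp[OF switch_dist[OF n i] switch_nonneg[OF n i] zero_less_one]) simp
      then have int: "integrable (nuV n i) (\<lambda>x. \<bar>x / real n\<bar> ^ q)" by (simp add: power_divide)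
      have eq: "AE x in nuV n i. \<bar>x / real n\<bar> ^ q = (x / real n) ^ q"
        using switch_nonneg[OF n i] by eventually_elim simp
      interpret nu: real_distribution "nuV n i" by (rule switch_dist[OF n i])
      have "(\<integral>\<^sup>+x. ennreal (\<bar>x / real n\<bar> ^ q) \<partial>nuV n i) = ennreal (\<integral>x. \<bar>x / real n\<bar> ^ q \<partial>nuV n i)"
        by (rule nn_integral_eq_integral[OF int]) simp
      also have "(\<integral>x. \<bar>x / real n\<bar> ^ q \<partial>nuV n i) = ?m n"
        by (rule integral_cong_AE[OF _ _ eq]) auto
      also have "\<dots> \<le> B" using B[of n] by simp
      finally show ?thesis by (simp add: ennreal_leI)
    qed
    then show ?thesis by blast
  qed
  have visit: "\<exists>i<I * L. p (i mod I) = k \<and> r i > 0" for k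
  proof -
    obtain bt qe where cand: "PE_candidate I p lam mu s L bt qe" and r: "\<forall>i<I * L. r i = PE_ratio I p s bt qe i"
      using optimal unfolding optimal_parameters_def PE_minimizer_def by blast
    from PE_ratio_pos[OF cand rates stable s_nonneg s_pos, of k] r show ?thesis by auto
  qed
  have sq: "integrable (nuS k) (\<lambda>x. x\<^sup>2)" for k
    using either
  proof
    assume "p0 > 1 \<and> (\<forall>k. \<exists>\<epsilon>>0. \<forall>t\<in>{-\<epsilon><..<\<epsilon>}. integrable (nuS k) (\<lambda>x. exp (t * x)))"
    then show ?thesis using moments[of k 2] by simp
  qed blast
  interpret polling_family I p lam mu nuS nuV L r X
    by (rule polling_family.intro) (fact rates stable service_dist service_nonneg service_expectation sq switch_nonneg
        switch_bound system stationary visit)+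
  have p0': "0 \<le> p0" using p0 by simp
  \<comment> \<open>Integer exponents: under (i) \<open>q\<close> is \<open>p0\<close> rounded up
    and services have moments of order \<open>q + 2\<close>; under (ii) \<open>q = 1\<close>, and
    tails of order 2 come from \<open>unif_tail_cycle_square\<close>.\<close>
  obtain q G where q: "p0 \<le> real q" and G: "unif_tail (Suc q) {1..} (\<lambda>n. prob_sp (X n)) G"
    "\<forall>n\<in>{1..}. AE w in prob_sp (X n). 0 \<le> G n w \<and> polling_epoch I p (X n) (I * L) w \<le> real n * G n w \<and>
      (\<forall>k. real (init (X n) w $ k) + real (arrivals (X n) k (polling_epoch I p (X n) (I * L) w) w) \<le> real n * G n w)"
    using either
  proof
    assume exp: "p0 > 1 \<and> (\<forall>k. \<exists>\<epsilon>>0. \<forall>t\<in>{-\<epsilon><..<\<epsilon>}. integrable (nuS k) (\<lambda>x. exp (t * x)))"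
    have le: "p0 \<le> real (nat \<lceil>p0\<rceil>)" by linarith
    have "integrable (nuS k) (\<lambda>x. \<bar>x\<bar> ^ Suc (Suc (nat \<lceil>p0\<rceil>)))" for k
      using moments exp by blast
    from unif_tail_cycle_service_moments[OF _ this] show thesis using that[OF le] by force
  next
    assume p0_1: "p0 = 1 \<and> (\<forall>k. integrable (nuS k) (\<lambda>x. x\<^sup>2))"
    then have le: "p0 \<le> real 1" by simp
    from unif_tail_cycle_square[folded Suc_1] show thesis using that[OF le] by blast
  qed
  show ?thesis
    by (rule uniformly_integrable_cycle_cost[OF G(1) _ psi_nonneg psi_mono psi_cont p0' q psi_growth])
      (use G(2) in blast)
qed

end
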